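(* Let $\lambda,\alpha\in\mathbb{C}^*$ and $\beta,\gamma,\eta,\epsilon,\theta\in\mathbb{C}$ with $\eta,\epsilon,\theta$ not all zero, and let $M(\lambda,\alpha,\beta,\gamma)$ be one of $\Omega(\lambda,\alpha,\beta,\gamma)$, $\Delta(\lambda,\alpha,\beta,\gamma)$, $\Theta(\lambda,\alpha,\beta,\gamma)$. Then the $\mathfrak{L}$-module $M(\lambda,\alpha,\beta,\gamma)\otimes V(\eta,\epsilon,\theta)$ is not a weight module, and it is isomorphic neither to any Whittaker $\mathfrak{L}$-module nor to any of the modules $\Omega(\lambda',\alpha',\beta',\gamma')$, $\Delta(\lambda',\alpha',\beta',\gamma')$, $\Theta(\lambda',\alpha',\beta',\gamma')$ with $\lambda',\alpha'\in\mathbb{C}^*$ and $\beta',\gamma'\in\mathbb{C}$.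
   Context: All vector spaces are over $\mathbb{C}$; $\mathbb{C}^*=\mathbb{C}\setminus\{0\}$, $\mathbb{Z}_+$ is the set of nonnegative integers, $\mathbb{N}$ the set of positive integers. The affine-Virasoro algebra of type $A_1$, denoted $\mathfrak{L}$, is the Lie algebra with basis $\{e_i,f_i,h_i,d_i,C\mid i\in\mathbb{Z}\}$ and brackets $[e_i,f_j]=h_{i+j}+i\delta_{i+j,0}C$, $[h_i,e_j]=2e_{i+j}$, $[h_i,f_j]=-2f_{i+j}$, $[d_i,d_j]=(j-i)d_{i+j}+\delta_{i+j,0}\frac{i^3-i}{12}C$, $[d_i,h_j]=jh_{i+j}$, $[h_i,h_j]=2i\delta_{i+j,0}C$, $[d_i,e_j]=je_{i+j}$, $[d_i,f_j]=jf_{i+j}$, $[e_i,e_j]=[f_i,f_j]=[C,\mathfrak{L}]=0$. The Cartan subalgebra is $\mathfrak{h}=\mathbb{C}d_0+\mathbb{C}h_0+\mathbb{C}C$; a weight module is an $\mathfrak{L}$-module that is the direct sum of its simultaneous eigenspaces for $\mathfrak{h}$. Put $\mathfrak{L}_+=\mathrm{span}_{\mathbb{C}}\{e_i,f_i,h_i,d_i,e_0\mid i\in\mathbb{N}\}$. For $\lambda,\alpha\in\mathbb{C}^*$, $\beta,\gamma\in\mathbb{C}$, the $\mathfrak{L}$-modules $\Omega(\lambda,\alpha,\beta,\gamma)$, $\Delta(\lambda,\alpha,\beta,\gamma)$, $\Theta(\lambda,\alpha,\beta,\gamma)$ are all equal to the polynomial algebra $\mathbb{C}[s,t]$ as vector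 spaces. In all three, for $i\in\mathbb{Z}$ and $g(s,t)\in\mathbb{C}[s,t]$: $h_i\cdot g(s,t)=\lambda^i t\,g(s-i,t)$, $d_i\cdot g(s,t)=\lambda^i(s+i\gamma)g(s-i,t)$, $C\cdot g(s,t)=0$. The remaining actions are: - $\Omega$: $e_i\cdot g(s,t)=\lambda^i\alpha\, g(s-i,t-2)$, $f_i\cdot g(s,t)=-\frac{\lambda^i}{\alpha}(\frac t2-\beta)(\frac t2+\beta+1)g(s-i,t+2)$; - $\Delta$: $e_i\cdot g(s,t)=-\frac{\lambda^i}{\alpha}(\frac t2+\beta)(\frac t2-\beta-1)g(s-i,t-2)$, $f_i\cdot g(s,t)=\lambda^i\alpha\, g(s-i,t+2)$; - $\Theta$: $e_i\cdot g(s,t)=\lambda^i\alpha(\frac t2+\beta)g(s-i,t-2)$, $f_i\cdot g(s,t)=-\frac{\lambda^i}{\alpha}(\frac t2-\beta)g(s-i,t+2)$. For $\eta,\epsilon,\theta\in\mathbb{C}$, the Verma module is $\overline{V}(\eta,\epsilon,\theta)=U(\mathfrak{L})/I(\eta,\epsilon,\theta)$, where $I(\eta,\epsilon,\theta)$ is the left ideal of $U(\mathfrak{L})$ generated by $\{e_0,e_i,f_i,h_i,d_i\mid i\in\mathbb{N}\}\cup\{d_0-\eta,h_0-\epsilon,C-\theta\}$. $V(\eta,\epsilon,\theta)$ denotes the irreducible highest weight module $\overline{V}(\eta,\epsilon,\theta)/J$, where $J$ is the unique maximal proper submodule of $\overline{V}(\eta,\epsilon,\theta)$. Tensor products carry the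 usual action $x(u\otimes v)=xu\otimes v+u\otimes xv$ for $x\in\mathfrak{L}$. Whittaker modules: for $\underline{\mu}=(\mu_1,\dots,\mu_5)\in\mathbb{C}^5$, let $J_{\underline{\mu}}$ be the left ideal of $U(\mathfrak{L}_+\oplus\mathbb{C}C)$ generated by $\{d_1-\mu_1,d_2-\mu_2,e_0-\mu_3,f_1-\mu_4,C-\mu_5\}\cup\{d_j,e_k,f_l,h_m\mid j\ge 3,\ k\ge 1,\ l\ge 2,\ m\ge 1\}$, let $N_{\underline{\mu}}=U(\mathfrak{L}_+\oplus\mathbb{C}C)/J_{\underline{\mu}}$, and let $\mathrm{Ind}(N_{\underline{\mu}})=U(\mathfrak{L})\otimes_{U(\mathfrak{L}_+\oplus\mathbb{C}C)}N_{\underline{\mu}}$ (the universal Whittaker module). A Whittaker module is an $\mathfrak{L}$-module isomorphic to a quotient of $\mathrm{Ind}(N_{\underline{\mu}})$ for some $\underline{\mu}\in\mathbb{C}^5$. *)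

theory Defs
  imports
    "HOL-Algebra.Algebra"
    "HOL-Algebra.Algebraic_Closure_Type"
    "HOL-Computational_Algebra.Computational_Algebra"
    "HOL-Library.Poly_Mapping"
begin

section \<open>Linear extension from a basis\<close>

abbreviation complex_ring :: "complex ring" (\<open>\<complex>\<close>)
  where "\<complex> \<equiv> ring_of_type_algebra"

definition pm_scale :: "complex \<Rightarrow> ('a \<Rightarrow>\<^sub>0 complex) \<Rightarrow> ('a \<Rightarrow>\<^sub>0 complex)"
  where "pm_scale c p = Poly_Mapping.map ((*) c) p"

definition lin_ext ::
  "(complex \<Rightarrow> 'v \<Rightarrow> 'v) \<Rightarrow> ('a \<Rightarrow> 'v::comm_monoid_add) \<Rightarrow> ('a \<Rightarrow>\<^sub>0 complex) \<Rightarrow> 'v"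
  where "lin_ext scale f p = (\<Sum>a\<in>Poly_Mapping.keys p. scale (Poly_Mapping.lookup p a) (f a))"

section \<open>The affine-Virasoro algebra of type \<open>A\<^sub>1\<close>\<close>

datatype gen = E int | F int | H int | D int | C


type_synonym lie = "gen \<Rightarrow>\<^sub>0 complex"

abbreviation basis :: "gen \<Rightarrow> lie"
  where "basis a \<equiv> Poly_Mapping.single a 1"

fun gen_bracket :: "gen \<Rightarrow> gen \<Rightarrow> lie" where
  "gen_bracket (E i) (F j) =
     Poly_Mapping.single (H (i + j)) 1 + Poly_Mapping.single C (if i + j = 0 then of_int i else 0)"
| "gen_bracket (F j) (E i) =
     - (Poly_Mapping.single (H (i + j)) 1 + Poly_Mapping.single C (if i + j = 0 then of_int i else 0))"
| "gen_bracket (H i) (E j) = Poly_Mapping.single (E (i + j)) 2"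
| "gen_bracket (E j) (H i) = - Poly_Mapping.single (E (i + j)) 2"
| "gen_bracket (H i) (F j) = Poly_Mapping.single (F (i + j)) (- 2)"
| "gen_bracket (F j) (H i) = - Poly_Mapping.single (F (i + j)) (- 2)"
| "gen_bracket (D i) (D j) =
     Poly_Mapping.single (D (i + j)) (of_int (j - i)) +
     Poly_Mapping.single C (if i + j = 0 then of_int (i ^ 3 - i) / 12 else 0)"
| "gen_bracket (D i) (H j) = Poly_Mapping.single (H (i + j)) (of_int j)"
| "gen_bracket (H j) (D i) = - Poly_Mapping.single (H (i + j)) (of_int j)"
| "gen_bracket (H i) (H j) = Poly_Mapping.single C (if i + j = 0 then 2 * of_int i else 0)"
| "gen_bracket (D i) (E j) = Poly_Mapping.single (E (i + j)) (of_int j)"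
| "gen_bracket (E j) (D i) = - Poly_Mapping.single (E (i + j)) (of_int j)"
| "gen_bracket (D i) (F j) = Poly_Mapping.single (F (i + j)) (of_int j)"
| "gen_bracket (F j) (D i) = - Poly_Mapping.single (F (i + j)) (of_int j)"
| "gen_bracket (E i) (E j) = 0"
| "gen_bracket (F i) (F j) = 0"
| "gen_bracket C a = 0"
| "gen_bracket a C = 0"

definition lie_bracket :: "lie \<Rightarrow> lie \<Rightarrow> lie"
  where "lie_bracket x y = lin_ext pm_scale (\<lambda>a. lin_ext pm_scale (gen_bracket a) y) x"

definition Lplus :: "lie set"
  where "Lplus = {x. Poly_Mapping.keys x \<subseteq>
    {E 0} \<union> {E i | i. i > 0} \<union> {F i | i. i > 0} \<union> {H i | i. i > 0} \<union> {D i | i. i > 0}}"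

definition LplusC :: "lie set"
  where "LplusC = {x + pm_scale c (basis C) | x c. x \<in> Lplus}"

section \<open>Complex vector spaces with an action\<close>

text \<open>A complex vector space with operators indexed by \<open>'r\<close>, which is either the Lie algebra or
  an enveloping algebra. The fields \<open>mult\<close> and \<open>one\<close>, which the library's module record inherits
  from rings, carry no meaning here.\<close>

record ('r, 'v) act_module = "(complex, 'v) module" +
  act :: "'r \<Rightarrow> 'v \<Rightarrow> 'v"

definition lie_module :: "(lie, 'v) act_module \<Rightarrow> bool"
  where "lie_module M \<longleftrightarrow> module \<complex> M \<and>
    (\<forall>x. \<forall>v\<in>carrier M. act M x v \<in> carrier M) \<and>
    (\<forall>x. \<forall>u\<in>carrier M. \<forall>v\<in>carrier M. act M x (u \<oplus>\<^bsub>M\<^esub> v) = act M x u \<oplus>\<^bsub>M\<^esub> act M x v) \<and>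
    (\<forall>x c. \<forall>v\<in>carrier M. act M x (c \<odot>\<^bsub>M\<^esub> v) = c \<odot>\<^bsub>M\<^esub> act M x v) \<and>
    (\<forall>x y. \<forall>v\<in>carrier M. act M (x + y) v = act M x v \<oplus>\<^bsub>M\<^esub> act M y v) \<and>
    (\<forall>c x. \<forall>v\<in>carrier M. act M (pm_scale c x) v = c \<odot>\<^bsub>M\<^esub> act M x v) \<and>
    (\<forall>x y. \<forall>v\<in>carrier M.
       act M (lie_bracket x y) v = act M x (act M y v) \<ominus>\<^bsub>M\<^esub> act M y (act M x v))"

definition lie_submodule :: "'v set \<Rightarrow> (lie, 'v) act_module \<Rightarrow> bool"
  where "lie_submodule K M \<longleftrightarrow> submodule K \<complex> M \<and> (\<forall>x. \<forall>v\<in>K. act M x v \<in> K)"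

definition maximal_submodule :: "'v set \<Rightarrow> (lie, 'v) act_module \<Rightarrow> bool"
  where "maximal_submodule J M \<longleftrightarrow> lie_submodule J M \<and> J \<noteq> carrier M \<and>
    (\<forall>K. lie_submodule K M \<and> J \<subseteq> K \<and> K \<noteq> carrier M \<longrightarrow> K = J)"

definition lie_isomorphic :: "(lie, 'v) act_module \<Rightarrow> (lie, 'w) act_module \<Rightarrow> bool"
  where "lie_isomorphic M N \<longleftrightarrow> (\<exists>\<phi>. bij_betw \<phi> (carrier M) (carrier N) \<and>
    (\<forall>u\<in>carrier M. \<forall>v\<in>carrier M. \<phi> (u \<oplus>\<^bsub>M\<^esub> v) = \<phi> u \<oplus>\<^bsub>N\<^esub> \<phi> v) \<and>
    (\<forall>c. \<forall>v\<in>carrier M. \<phi> (c \<odot>\<^bsub>M\<^esub> v) = c \<odot>\<^bsub>N\<^esub> \<phi> v) \<and>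
    (\<forall>x. \<forall>v\<in>carrier M. \<phi> (act M x v) = act N x (\<phi> v)))"

text \<open>The operators pass to cosets when they preserve \<open>K\<close>; then \<open>K + c \<cdot> (v + K) = cv + K\<close> and
  \<open>K + x \<cdot> (v + K) = xv + K\<close>. Only this invariance is used, so that \<open>M\<close> may be a vector space
  with operators which becomes a module after division by \<open>K\<close>.\<close>

definition quot_mod :: "('r, 'v) act_module \<Rightarrow> 'v set \<Rightarrow> ('r, 'v set) act_module"
  where "quot_mod M K =
    \<lparr> carrier = a_rcosets\<^bsub>M\<^esub> K, monoid.mult = undefined, one = undefined, ring.zero = K,
      add = set_add M,
      module.smult = (\<lambda>c Y. K <+>\<^bsub>M\<^esub> (module.smult M c ` Y)),
      act = (\<lambda>x Y. K <+>\<^bsub>M\<^esub> (act M x ` Y)) \<rparr>"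

definition pullback :: "('q \<Rightarrow> 'r) \<Rightarrow> ('r, 'v) act_module \<Rightarrow> ('q, 'v) act_module"
  where "pullback f M =
    \<lparr> carrier = carrier M, monoid.mult = undefined, one = undefined, ring.zero = \<zero>\<^bsub>M\<^esub>,
      add = add M, module.smult = module.smult M, act = (\<lambda>x. act M (f x)) \<rparr>"

definition weight_space ::
  "(lie, 'v) act_module \<Rightarrow> complex \<times> complex \<times> complex \<Rightarrow> 'v set"
  where "weight_space M = (\<lambda>(a, b, c). {v \<in> carrier M.
    act M (basis (D 0)) v = a \<odot>\<^bsub>M\<^esub> v \<and>
    act M (basis (H 0)) v = b \<odot>\<^bsub>M\<^esub> v \<and>
    act M (basis C) v = c \<odot>\<^bsub>M\<^esub> v})"

text \<open>Internal direct sum: every vector is a finite sum of weight vectors in a unique way.\<close>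

definition weight_module :: "(lie, 'v) act_module \<Rightarrow> bool"
  where "weight_module M \<longleftrightarrow> (\<forall>v\<in>carrier M. \<exists>!w.
    (\<forall>\<chi>. w \<chi> \<in> weight_space M \<chi>) \<and> finite {\<chi>. w \<chi> \<noteq> \<zero>\<^bsub>M\<^esub>} \<and>
    v = finsum M w {\<chi>. w \<chi> \<noteq> \<zero>\<^bsub>M\<^esub>})"

section \<open>Tensor products\<close>

text \<open>The free vector space on \<open>carrier A \<times> carrier B\<close>, with operators given on generators.\<close>

definition free_pairs ::
  "('p, 'a) act_module \<Rightarrow> ('q, 'b) act_module \<Rightarrow> ('r \<Rightarrow> 'a \<times> 'b \<Rightarrow> ('a \<times> 'b \<Rightarrow>\<^sub>0 complex)) \<Rightarrow>
   ('r, 'a \<times> 'b \<Rightarrow>\<^sub>0 complex) act_module"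
  where "free_pairs A B f =
    \<lparr> carrier = {p. Poly_Mapping.keys p \<subseteq> carrier A \<times> carrier B}, monoid.mult = undefined, one = undefined,
      ring.zero = 0, add = (+), module.smult = pm_scale, act = (\<lambda>x. lin_ext pm_scale (f x)) \<rparr>"

abbreviation pair :: "'a \<Rightarrow> 'b \<Rightarrow> ('a \<times> 'b \<Rightarrow>\<^sub>0 complex)"
  where "pair a b \<equiv> Poly_Mapping.single (a, b) 1"

definition bilinear_relators ::
  "('p, 'a) act_module \<Rightarrow> ('q, 'b) act_module \<Rightarrow> ('a \<times> 'b \<Rightarrow>\<^sub>0 complex) set"
  where "bilinear_relators A B =
    {pair (a \<oplus>\<^bsub>A\<^esub> a') b - pair a b - pair a' b | a a' b.
       a \<in> carrier A \<and> a' \<in> carrier A \<and> b \<in> carrier B} \<union>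
    {pair a (b \<oplus>\<^bsub>B\<^esub> b') - pair a b - pair a b' | a b b'.
       a \<in> carrier A \<and> b \<in> carrier B \<and> b' \<in> carrier B} \<union>
    {pair (c \<odot>\<^bsub>A\<^esub> a) b - pm_scale c (pair a b) | c a b. a \<in> carrier A \<and> b \<in> carrier B} \<union>
    {pair a (c \<odot>\<^bsub>B\<^esub> b) - pm_scale c (pair a b) | c a b. a \<in> carrier A \<and> b \<in> carrier B}"

definition subspace_gen :: "('r, 'v) act_module \<Rightarrow> 'v set \<Rightarrow> 'v set"
  where "subspace_gen M S = (\<lambda>K. submodule K \<complex> M) hull S"

definition tensor_mod ::
  "(lie, 'a) act_module \<Rightarrow> (lie, 'b) act_module \<Rightarrow> (lie, ('a \<times> 'b \<Rightarrow>\<^sub>0 complex) set) act_module"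
  where "tensor_mod M N =
    (let P = free_pairs M N (\<lambda>x (u, v). pair (act M x u) v + pair u (act N x v))
     in quot_mod P (subspace_gen P (bilinear_relators M N)))"

section \<open>Enveloping algebras\<close>

text \<open>Words form a monoid under concatenation, so that finitely supported functions on words,
  with their convolution product, are noncommutative polynomials.\<close>

instantiation list :: (type) monoid_add
begin
definition zero_list :: "'a list" where "zero_list = []"
definition plus_list :: "'a list \<Rightarrow> 'a list \<Rightarrow> 'a list" where "plus_list xs ys = xs @ ys"
instance by standard (simp_all add: zero_list_def plus_list_def)
end

definition free_algebra :: "'a set \<Rightarrow> ('a list \<Rightarrow>\<^sub>0 complex) ring"
  where "free_algebra Y = ring_of_type_algebra\<lparr>carrier := {p. Poly_Mapping.keys p \<subseteq> lists Y}\<rparr>"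

abbreviation word :: "'a list \<Rightarrow> ('a list \<Rightarrow>\<^sub>0 complex)"
  where "word w \<equiv> Poly_Mapping.single w 1"

text \<open>For a Lie subalgebra \<open>g\<close>, the free algebra on the set \<open>g\<close> modulo the first two families is
  the tensor algebra of the vector space \<open>g\<close>; the third family then gives \<open>U(g)\<close>.\<close>

definition env_relators :: "lie set \<Rightarrow> (lie list \<Rightarrow>\<^sub>0 complex) set"
  where "env_relators g =
    {word [x + y] - word [x] - word [y] | x y. x \<in> g \<and> y \<in> g} \<union>
    {word [pm_scale c x] - pm_scale c (word [x]) | c x. x \<in> g} \<union>
    {word [x, y] - word [y, x] - word [lie_bracket x y] | x y. x \<in> g \<and> y \<in> g}"

type_synonym env_elt = "(lie list \<Rightarrow>\<^sub>0 complex) set"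

definition env_ideal :: "lie set \<Rightarrow> env_elt"
  where "env_ideal g = Idl\<^bsub>free_algebra g\<^esub> (env_relators g)"

definition env :: "lie set \<Rightarrow> env_elt ring"
  where "env g = free_algebra g Quot env_ideal g"

definition env_of :: "lie set \<Rightarrow> lie \<Rightarrow> env_elt"
  where "env_of g x = env_ideal g +>\<^bsub>free_algebra g\<^esub> word [x]"

definition env_scalar :: "lie set \<Rightarrow> complex \<Rightarrow> env_elt"
  where "env_scalar g c = env_ideal g +>\<^bsub>free_algebra g\<^esub> pm_scale c (word [])"

text \<open>The homomorphism from \<open>U(g)\<close> to \<open>U(L)\<close> induced by the inclusion of \<open>g\<close> in \<open>L\<close>.\<close>

definition env_incl :: "env_elt \<Rightarrow> env_elt"
  where "env_incl Y = env_ideal UNIV <+>\<^bsub>free_algebra UNIV\<^esub> Y"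

definition env_regular :: "lie set \<Rightarrow> (env_elt, env_elt) act_module"
  where "env_regular g =
    \<lparr> carrier = carrier (env g), monoid.mult = undefined, one = undefined,
      ring.zero = \<zero>\<^bsub>env g\<^esub>, add = add (env g),
      module.smult = (\<lambda>c u. env_scalar g c \<otimes>\<^bsub>env g\<^esub> u), act = (\<lambda>r u. r \<otimes>\<^bsub>env g\<^esub> u) \<rparr>"

definition left_ideal :: "'a set \<Rightarrow> 'a ring \<Rightarrow> bool"
  where "left_ideal J R \<longleftrightarrow> additive_subgroup J R \<and> (\<forall>r\<in>carrier R. \<forall>a\<in>J. r \<otimes>\<^bsub>R\<^esub> a \<in> J)"

definition left_ideal_gen :: "'a ring \<Rightarrow> 'a set \<Rightarrow> 'a set"
  where "left_ideal_gen R S = (\<lambda>J. left_ideal J R) hull S"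

section \<open>Highest weight modules\<close>

definition verma :: "complex \<Rightarrow> complex \<Rightarrow> complex \<Rightarrow> (lie, env_elt set) act_module"
  where "verma \<eta> \<epsilon> \<theta> =
    (let u = (\<lambda>a. env_of UNIV (basis a));
         I = left_ideal_gen (env UNIV)
           ({u (E 0)} \<union> {u (E i) | i. i > 0} \<union> {u (F i) | i. i > 0} \<union>
            {u (H i) | i. i > 0} \<union> {u (D i) | i. i > 0} \<union>
            {u (D 0) \<ominus>\<^bsub>env UNIV\<^esub> env_scalar UNIV \<eta>,
             u (H 0) \<ominus>\<^bsub>env UNIV\<^esub> env_scalar UNIV \<epsilon>,
             u C \<ominus>\<^bsub>env UNIV\<^esub> env_scalar UNIV \<theta>})
     in pullback (env_of UNIV) (quot_mod (env_regular UNIV) I))"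

definition irr_hw :: "complex \<Rightarrow> complex \<Rightarrow> complex \<Rightarrow> (lie, env_elt set set) act_module"
  where "irr_hw \<eta> \<epsilon> \<theta> =
    quot_mod (verma \<eta> \<epsilon> \<theta>) (THE J. maximal_submodule J (verma \<eta> \<epsilon> \<theta>))"

section \<open>Whittaker modules\<close>

definition whittaker_N ::
  "complex \<Rightarrow> complex \<Rightarrow> complex \<Rightarrow> complex \<Rightarrow> complex \<Rightarrow> (env_elt, env_elt set) act_module"
  where "whittaker_N \<mu>1 \<mu>2 \<mu>3 \<mu>4 \<mu>5 =
    (let U = env LplusC;
         u = (\<lambda>a. env_of LplusC (basis a));
         s = env_scalar LplusC;
         J = left_ideal_gen U
           ({u (D 1) \<ominus>\<^bsub>U\<^esub> s \<mu>1, u (D 2) \<ominus>\<^bsub>U\<^esub> s \<mu>2, u (E 0) \<ominus>\<^bsub>U\<^esub> s \<mu>3,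
             u (F 1) \<ominus>\<^bsub>U\<^esub> s \<mu>4, u C \<ominus>\<^bsub>U\<^esub> s \<mu>5} \<union>
            {u (D j) | j. j \<ge> 3} \<union> {u (E k) | k. k \<ge> 1} \<union>
            {u (F l) | l. l \<ge> 2} \<union> {u (H m) | m. m \<ge> 1})
     in quot_mod (env_regular LplusC) J)"

text \<open>The tensor product of \<open>U(L)\<close> with a left module \<open>N\<close> over \<open>U(LplusC)\<close>.\<close>

definition induced :: "(env_elt, 'v) act_module \<Rightarrow> (lie, (env_elt \<times> 'v \<Rightarrow>\<^sub>0 complex) set) act_module"
  where "induced N =
    (let A = env_regular UNIV;
         P = free_pairs A N (\<lambda>x (u, v). pair (env_of UNIV x \<otimes>\<^bsub>env UNIV\<^esub> u) v);
         bal = {pair (u \<otimes>\<^bsub>env UNIV\<^esub> env_incl r) v - pair u (act N r v) | u r v.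
           u \<in> carrier A \<and> r \<in> carrier (env LplusC) \<and> v \<in> carrier N}
     in quot_mod P (subspace_gen P (bilinear_relators A N \<union> bal)))"

definition whittaker_module :: "(lie, 'w) act_module \<Rightarrow> bool"
  where "whittaker_module W \<longleftrightarrow> lie_module W \<and> (\<exists>\<mu>1 \<mu>2 \<mu>3 \<mu>4 \<mu>5 K.
    lie_submodule K (induced (whittaker_N \<mu>1 \<mu>2 \<mu>3 \<mu>4 \<mu>5)) \<and>
    lie_isomorphic W (quot_mod (induced (whittaker_N \<mu>1 \<mu>2 \<mu>3 \<mu>4 \<mu>5)) K))"

section \<open>The polynomial modules\<close>

text \<open>\<open>\<complex>[s,t]\<close> as polynomials in \<open>s\<close> with coefficients in \<open>\<complex>[t]\<close>.\<close>

type_synonym poly_st = "complex poly poly"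

abbreviation poly_const :: "complex \<Rightarrow> poly_st"
  where "poly_const c \<equiv> [:[:c:]:]"

definition poly_s :: poly_st
  where "poly_s = [:0, 1:]"

definition poly_t :: poly_st
  where "poly_t = [:[:0, 1:]:]"

text \<open>\<open>shift a b g\<close> is \<open>g(s - a, t - b)\<close>.\<close>

definition shift :: "complex \<Rightarrow> complex \<Rightarrow> poly_st \<Rightarrow> poly_st"
  where "shift a b g = pcompose (map_poly (\<lambda>c. pcompose c [:- b, 1:]) g) [:[:- a:], 1:]"

definition poly_module :: "(gen \<Rightarrow> poly_st \<Rightarrow> poly_st) \<Rightarrow> (lie, poly_st) act_module"
  where "poly_module f =
    \<lparr> carrier = UNIV, monoid.mult = undefined, one = undefined, ring.zero = 0, add = (+),
      module.smult = (\<lambda>c g. poly_const c * g),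
      act = (\<lambda>x g. lin_ext (\<lambda>c p. poly_const c * p) (\<lambda>a. f a g) x) \<rparr>"

definition Omega_mod :: "complex \<Rightarrow> complex \<Rightarrow> complex \<Rightarrow> complex \<Rightarrow> (lie, poly_st) act_module"
  where "Omega_mod lam \<alpha> \<beta> \<gamma> = poly_module (\<lambda>a g. case a of
      E i \<Rightarrow> poly_const (lam powi i * \<alpha>) * shift (of_int i) 2 g
    | F i \<Rightarrow> poly_const (- (lam powi i / \<alpha>)) * (poly_const (1/2) * poly_t - poly_const \<beta>) *
             (poly_const (1/2) * poly_t + poly_const \<beta> + 1) * shift (of_int i) (- 2) g
    | H i \<Rightarrow> poly_const (lam powi i) * poly_t * shift (of_int i) 0 g
    | D i \<Rightarrow> poly_const (lam powi i) * (poly_s + poly_const (of_int i * \<gamma>)) * shift (of_int i) 0 g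
    | C \<Rightarrow> 0)"

definition Delta_mod :: "complex \<Rightarrow> complex \<Rightarrow> complex \<Rightarrow> complex \<Rightarrow> (lie, poly_st) act_module"
  where "Delta_mod lam \<alpha> \<beta> \<gamma> = poly_module (\<lambda>a g. case a of
      E i \<Rightarrow> poly_const (- (lam powi i / \<alpha>)) * (poly_const (1/2) * poly_t + poly_const \<beta>) *
             (poly_const (1/2) * poly_t - poly_const \<beta> - 1) * shift (of_int i) 2 g
    | F i \<Rightarrow> poly_const (lam powi i * \<alpha>) * shift (of_int i) (- 2) g
    | H i \<Rightarrow> poly_const (lam powi i) * poly_t * shift (of_int i) 0 g
    | D i \<Rightarrow> poly_const (lam powi i) * (poly_s + poly_const (of_int i * \<gamma>)) * shift (of_int i) 0 g
    | C \<Rightarrow> 0)"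

definition Theta_mod :: "complex \<Rightarrow> complex \<Rightarrow> complex \<Rightarrow> complex \<Rightarrow> (lie, poly_st) act_module"
  where "Theta_mod lam \<alpha> \<beta> \<gamma> = poly_module (\<lambda>a g. case a of
      E i \<Rightarrow> poly_const (lam powi i * \<alpha>) * (poly_const (1/2) * poly_t + poly_const \<beta>) *
             shift (of_int i) 2 g
    | F i \<Rightarrow> poly_const (- (lam powi i / \<alpha>)) * (poly_const (1/2) * poly_t - poly_const \<beta>) *
             shift (of_int i) (- 2) g
    | H i \<Rightarrow> poly_const (lam powi i) * poly_t * shift (of_int i) 0 g
    | D i \<Rightarrow> poly_const (lam powi i) * (poly_s + poly_const (of_int i * \<gamma>)) * shift (of_int i) 0 g
    | C \<Rightarrow> 0)"

end

theory Submission
  imports Defs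
begin

text \<open>Let $V$ be the irreducible highest weight module with highest weight vector $v$, and let $M$ be
  the polynomial module. All claims are read off from one linear map. Let $\psi$ be the functional on
  $V$ that gives the coefficient of $v$ in the weight decomposition. It vanishes on the image of every
  lowering generator, and $\psi(x w) = \chi(x) \psi(w)$ for $x$ in the Cartan subalgebra, where $\chi$
  is the highest weight. The map $\Phi(p \otimes w) = \psi(w) p$ from $M \otimes V$ to $C[s,t]$
  therefore commutes with the lowering generators, and it satisfies $\Phi(h_0 w) = (t + \epsilon)
  \Phi(w)$, $\Phi(d_0 w) = (s + \eta) \Phi(w)$ and $\Phi(C w) = \theta \Phi(w)$. Moreover
  $\Phi(1 \otimes v) = 1$, and $\Phi(x (1 \otimes v)) = x \cdot 1$ for a raising generator $x$.

  A weight vector of $h_0$-weight $b$ is mapped to a polynomial that $t + \epsilon - b$ annihilates,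
  hence to zero; as $\Phi(1 \otimes v) = 1$, the tensor product is not spanned by weight vectors. In a
  Whittaker module every vector is annihilated by $h_m$ for all large $m$, but
  $\Phi(h_m (1 \otimes v)) = \lambda^m t$. In a polynomial module, finally, $d_{-i} h_i$ acts as
  multiplication by $(s - i \gamma') t$, so that $d_{-2} h_2 + d_0 h_0 = 2 d_{-1} h_1$, and $C$ acts
  as zero. If these relations held in $M \otimes V$, then $\Phi$ would turn them, applied to
  $1 \otimes v$, into $(s + \eta)(t + \epsilon) = s t$ and $\theta = 0$, which is impossible as
  $\eta$, $\epsilon$, $\theta$ are not all zero.

  It remains to find $\psi$, that is, to show that $v$ is nonzero in the Verma module and that there
  is a largest submodule without a component along $v$. Let the lowering generators act freely on
  words, by prefixing, and let the other generators act by commuting them to the right (\<open>gen_act\<close>). By the Jacobi identity the bracket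
  relations with one argument in the Borel subalgebra hold (\<open>lie_act_commute\<close>). Those between
  lowering generators fail, but only by elements of the radical (\<open>defect_radical\<close>), which is stable under the
  action and on which the coefficient of the empty word vanishes. This coefficient thus gives a
  functional \<open>hw\<close> on the enveloping algebra that vanishes on the relators of the Verma
  module (\<open>Ann_hw_null\<close>). Straightening (\<open>neg_span_all\<close>) and the eigenvalues
  of $2 d_0 + h_0/2$ show that every submodule with a component along $v$ contains $v$
  (\<open>isolate_top\<close>). Hence the maximal submodule is unique, and $\psi$ is induced by
  \<open>hw\<close> (\<open>irr_functional\<close>).\<close>

section \<open>Linear extension\<close>

abbreviation linear_map ::
  "(complex \<Rightarrow> 'a::ab_group_add \<Rightarrow> 'a) \<Rightarrow> (complex \<Rightarrow> 'b::ab_group_add \<Rightarrow> 'b) \<Rightarrow> ('a \<Rightarrow> 'b) \<Rightarrow> bool"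
  where "linear_map \<equiv> Modules.module_hom"

lemma lookup_pm_scale: "Poly_Mapping.lookup (pm_scale c p) a = c * Poly_Mapping.lookup p a"
  by (simp add: pm_scale_def Poly_Mapping.map.rep_eq when_def)

lemma module_pm_scale: "Modules.module pm_scale"
  by unfold_locales (rule poly_mapping_eqI; simp add: lookup_pm_scale lookup_add algebra_simps)+

interpretation pm: Modules.module "pm_scale :: complex \<Rightarrow> ('a \<Rightarrow>\<^sub>0 complex) \<Rightarrow> _"
  by (rule module_pm_scale)

lemma pm_scale_single [simp]: "pm_scale c (Poly_Mapping.single a d) = Poly_Mapping.single a (c * d)"
  by (rule poly_mapping_eqI) (simp add: lookup_pm_scale lookup_single when_def)

lemma keys_pm_scale: "Poly_Mapping.keys (pm_scale c p) \<subseteq> Poly_Mapping.keys p"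
  by (auto simp: in_keys_iff lookup_pm_scale)

lemma poly_mapping_sum_single:
  "(\<Sum>a\<in>Poly_Mapping.keys p. Poly_Mapping.single a (Poly_Mapping.lookup p a)) = p"
  by (rule poly_mapping_eqI) (auto simp: lookup_sum lookup_single when_def in_keys_iff)

lemma poly_mapping_add_induct [case_names zero add single]:
  fixes p :: "'a \<Rightarrow>\<^sub>0 complex"
  assumes "P 0" and "\<And>p q. P p \<Longrightarrow> P q \<Longrightarrow> P (p + q)"
    and "\<And>a c. a \<in> Poly_Mapping.keys p \<Longrightarrow> P (Poly_Mapping.single a c)"
  shows "P p"
proof -
  have "P (\<Sum>a\<in>A. Poly_Mapping.single a (Poly_Mapping.lookup p a))"
    if "A \<subseteq> Poly_Mapping.keys p" for A
    using finite_subset[OF that finite_keys] that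
    by (induction A) (use assms in simp_all)
  from this[of "Poly_Mapping.keys p"] show ?thesis by (simp add: poly_mapping_sum_single)
qed

lemma pm_scale_mult:
  fixes p q :: "'a::monoid_add \<Rightarrow>\<^sub>0 complex"
  shows "pm_scale c p * q = pm_scale c (p * q)" and "p * pm_scale c q = pm_scale c (p * q)"
proof -
  have left: "pm_scale c r = Poly_Mapping.single 0 c * r" for r :: "'a \<Rightarrow>\<^sub>0 complex"
    by (simp add: pm_scale_def mult_map_scale_conv_mult)
  have central: "Poly_Mapping.single 0 c * r = r * Poly_Mapping.single 0 c" for r :: "'a \<Rightarrow>\<^sub>0 complex"
    by (induction r rule: poly_mapping_add_induct) (simp_all add: algebra_simps mult_single)
  show "pm_scale c p * q = pm_scale c (p * q)" by (simp add: left mult.assoc)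
  show "p * pm_scale c q = pm_scale c (p * q)" by (metis left central mult.assoc)
qed

lemma linear_mapI:
  assumes "Modules.module s1" "Modules.module s2"
    and "\<And>x y. f (x + y) = f x + f y" "\<And>c x. f (s1 c x) = s2 c (f x)"
  shows "linear_map s1 s2 f"
  using assms by (simp add: module_hom_iff)

lemmas linear_comp = Modules.module_hom_compose[unfolded o_def]

context
  fixes s1 :: "complex \<Rightarrow> 'a::ab_group_add \<Rightarrow> 'a" and s2 :: "complex \<Rightarrow> 'b::ab_group_add \<Rightarrow> 'b" and f g
  assumes f: "linear_map s1 s2 f" and g: "linear_map s1 s2 g"
begin

interpretation f: Modules.module_hom s1 s2 f by (rule f)
interpretation g: Modules.module_hom s1 s2 g by (rule g)

lemma linear_add: "linear_map s1 s2 (\<lambda>x. f x + g x)"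
  using f by (simp add: module_hom_iff f.add g.add f.scale g.scale f.m2.scale_right_distrib)

lemma linear_diff: "linear_map s1 s2 (\<lambda>x. f x - g x)"
  using f by (simp add: module_hom_iff f.add g.add f.scale g.scale f.m2.scale_right_diff_distrib)

end

lemma linear_zero:
  "Modules.module s1 \<Longrightarrow> Modules.module s2 \<Longrightarrow> linear_map s1 s2 (\<lambda>x. 0)"
  by (simp add: module_hom_iff module.scale_zero_right)

lemma linear_minus: "linear_map s1 s2 f \<Longrightarrow> linear_map s1 s2 (\<lambda>x. - f x)"
  using linear_diff[OF linear_zero, of s1 s2 f] by (simp add: module_hom_iff)

lemma lin_ext_superset:
  assumes "Modules.module scale" "finite A" "Poly_Mapping.keys p \<subseteq> A"
  shows "lin_ext scale f p = (\<Sum>a\<in>A. scale (Poly_Mapping.lookup p a) (f a))"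
proof -
  interpret m: Modules.module scale by fact
  show ?thesis unfolding lin_ext_def
    by (rule sum.mono_neutral_left) (use assms in \<open>auto simp: in_keys_iff\<close>)
qed

lemma linear_lin_ext:
  assumes "Modules.module scale"
  shows "linear_map pm_scale scale (lin_ext scale f)"
proof (rule linear_mapI[OF module_pm_scale assms])
  interpret m: Modules.module scale by fact
  show "lin_ext scale f (p + q) = lin_ext scale f p + lin_ext scale f q" for p q
  proof -
    let ?A = "Poly_Mapping.keys p \<union> Poly_Mapping.keys q"
    have "Poly_Mapping.keys (p + q) \<subseteq> ?A" by (rule keys_add)
    then show ?thesis
      by (simp add: lin_ext_superset[OF assms, of ?A] lookup_add m.scale_left_distrib sum.distrib)
  qed
  show "lin_ext scale f (pm_scale c p) = scale c (lin_ext scale f p)" for c p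
    by (simp add: lin_ext_superset[OF assms, of "Poly_Mapping.keys p"] keys_pm_scale
        lookup_pm_scale m.scale_sum_right)
qed

lemma lin_ext_single:
  assumes "Modules.module scale"
  shows "lin_ext scale f (Poly_Mapping.single a c) = scale c (f a)"
proof -
  interpret m: Modules.module scale by fact
  show ?thesis by (simp add: lin_ext_superset[OF assms, of "{a}"])
qed

text \<open>Agreement is demanded only on the keys of the argument: this is what makes the lemma
  usable for maps that behave well on a subspace only, such as the span of the nonnegative
  generators.\<close>

lemma linear_map_eqI:
  assumes "linear_map pm_scale scale f" "linear_map pm_scale scale g"
    and "\<And>a. a \<in> Poly_Mapping.keys p \<Longrightarrow> f (Poly_Mapping.single a 1) = g (Poly_Mapping.single a 1)"
  shows "f p = g p"
proof -
  interpret f: Modules.module_hom pm_scale scale f by fact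
  interpret g: Modules.module_hom pm_scale scale g by fact
  show ?thesis
  proof (induction p rule: poly_mapping_add_induct)
    case (single a c)
    then show ?case
      using assms(3)[of a] f.scale[of c "Poly_Mapping.single a 1"] g.scale[of c "Poly_Mapping.single a 1"]
      by simp
  qed (simp_all add: f.add g.add f.zero g.zero)
qed

text \<open>The linear extension of a family of linear maps, as a function of the common argument
  of the family. Together with linearity in the first argument this makes extended operations
  bilinear.\<close>

lemma linear_lin_ext_family:
  assumes "Modules.module s2" and "\<And>a. linear_map s1 s2 (f a)"
  shows "linear_map s1 s2 (\<lambda>v. lin_ext s2 (\<lambda>a. f a v) p)"
proof -
  interpret s2: Modules.module s2 by fact
  interpret f: Modules.module_hom s1 s2 "f a" for a by fact
  show ?thesis
  proof (rule linear_mapI)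
    show "Modules.module s1" by (rule f.m1.module_axioms)
    show "Modules.module s2" by fact
  qed (simp_all add: lin_ext_def f.add f.scale s2.scale_right_distrib sum.distrib s2.scale_sum_right
        s2.scale_left_commute mult.commute)
qed

section \<open>The Lie algebra\<close>

lemma lin_ext_pm_single [simp]:
  "lin_ext pm_scale f (Poly_Mapping.single a c) = pm_scale c (f a)"
  by (rule lin_ext_single[OF module_pm_scale])

interpretation lin_ext_pm: Modules.module_hom pm_scale pm_scale "lin_ext pm_scale f" for f
  by (rule linear_lin_ext[OF module_pm_scale])

lemma linear_bracket_left: "linear_map pm_scale pm_scale (\<lambda>x. lie_bracket x y)"
  unfolding lie_bracket_def by (rule linear_lin_ext[OF module_pm_scale])

lemma linear_bracket_right: "linear_map pm_scale pm_scale (\<lambda>y. lie_bracket x y)"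
  unfolding lie_bracket_def
  by (rule linear_lin_ext_family[OF module_pm_scale linear_lin_ext[OF module_pm_scale]])

interpretation bracket_left: Modules.module_hom pm_scale pm_scale "\<lambda>x. lie_bracket x y" for y
  by (rule linear_bracket_left)

interpretation bracket_right: Modules.module_hom pm_scale pm_scale "\<lambda>y. lie_bracket x y" for x
  by (rule linear_bracket_right)

lemma bracket_single:
  "lie_bracket (Poly_Mapping.single a c) (Poly_Mapping.single b d) = pm_scale (c * d) (gen_bracket a b)"
  by (simp add: lie_bracket_def mult.commute)

lemma gen_bracket_antisym: "gen_bracket b a = - gen_bracket a b"
  by (cases a; cases b)
    (auto simp: single_uminus[symmetric] single_add[symmetric] add.commute diff_divide_distrib
      simp flip: eq_neg_iff_add_eq_0)

lemmas bracket_simps = bracket_left.add bracket_left.neg bracket_left.diff bracket_left.zero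
  bracket_left.scale bracket_right.add bracket_right.neg bracket_right.diff bracket_right.zero bracket_right.scale

text \<open>After expansion both sides are combinations of one generator and $C$. The coefficients
  of the former agree identically; those of $C$ agree after one index has been eliminated through
  the condition that the indices sum to zero.\<close>

lemma gen_jacobi:
  "lie_bracket (basis a) (gen_bracket b c) =
   lie_bracket (gen_bracket a b) (basis c) + lie_bracket (basis b) (gen_bracket a c)"
  apply (cases a; cases b; cases c)
  apply (simp_all add: bracket_simps bracket_single pm.scale_right_distrib pm.scale_minus_right
     single_uminus[symmetric] single_add[symmetric] algebra_simps)
  apply (auto intro!: poly_mapping_eqI simp: lookup_add lookup_single when_def algebra_simps)
  apply (simp_all only: eq_neg_iff_add_eq_0[symmetric])
  apply (auto simp: algebra_simps)
  apply (simp add: field_simps power3_eq_cube)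
  done

lemma bracket_antisym: "lie_bracket y x = - lie_bracket x y"
proof (rule linear_map_eqI[OF linear_bracket_left])
  show "linear_map pm_scale pm_scale (\<lambda>y. - lie_bracket x y)"
    by (rule linear_minus[OF linear_bracket_right])
  show "lie_bracket (basis b) x = - lie_bracket x (basis b)" for b
  proof (rule linear_map_eqI[OF linear_bracket_right])
    show "linear_map pm_scale pm_scale (\<lambda>x. - lie_bracket x (basis b))"
      by (rule linear_minus[OF linear_bracket_left])
    show "lie_bracket (basis b) (basis a) = - lie_bracket (basis a) (basis b)" for a
      using gen_bracket_antisym[of b a] by (simp add: bracket_single)
  qed
qed

text \<open>Identities that hold on basis elements hold everywhere when both sides are linear in
  three arguments. The restriction to keys of the first argument is inherited by the identities
  that involve an element of the Borel subalgebra.\<close>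

lemma trilinear_eqI:
  assumes "\<And>y z. linear_map pm_scale s (\<lambda>x. f x y z)" "\<And>y z. linear_map pm_scale s (\<lambda>x. g x y z)"
    and "\<And>x z. linear_map pm_scale s (\<lambda>y. f x y z)" "\<And>x z. linear_map pm_scale s (\<lambda>y. g x y z)"
    and "\<And>x y. linear_map pm_scale s (\<lambda>z. f x y z)" "\<And>x y. linear_map pm_scale s (\<lambda>z. g x y z)"
    and "\<And>a b c. a \<in> Poly_Mapping.keys x \<Longrightarrow>
      f (Poly_Mapping.single a 1) (Poly_Mapping.single b 1) (Poly_Mapping.single c 1) =
      g (Poly_Mapping.single a 1) (Poly_Mapping.single b 1) (Poly_Mapping.single c 1)"
  shows "f x y z = g x y z"
proof -
  have "f (Poly_Mapping.single a 1) (Poly_Mapping.single b 1) z =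
      g (Poly_Mapping.single a 1) (Poly_Mapping.single b 1) z" if "a \<in> Poly_Mapping.keys x" for a b
    by (rule linear_map_eqI[where p = z, OF assms(5,6)]) (use assms(7) that in blast)
  then have "f (Poly_Mapping.single a 1) y z = g (Poly_Mapping.single a 1) y z"
    if "a \<in> Poly_Mapping.keys x" for a
    using that by (intro linear_map_eqI[where p = y, OF assms(3,4)]) blast
  then show ?thesis by (intro linear_map_eqI[where p = x, OF assms(1,2)]) blast
qed

lemma jacobi: "lie_bracket x (lie_bracket y z) = lie_bracket (lie_bracket x y) z + lie_bracket y (lie_bracket x z)"
proof -
  note lin = linear_bracket_left linear_bracket_right
    linear_comp[OF linear_bracket_left linear_bracket_left] linear_comp[OF linear_bracket_left linear_bracket_right]
    linear_comp[OF linear_bracket_right linear_bracket_left] linear_comp[OF linear_bracket_right linear_bracket_right]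
  show ?thesis
    by (rule trilinear_eqI[where f = "\<lambda>x y z. lie_bracket x (lie_bracket y z)"
          and g = "\<lambda>x y z. lie_bracket (lie_bracket x y) z + lie_bracket y (lie_bracket x z)"])
      (rule lin linear_add | (simp add: bracket_single, rule gen_jacobi))+
qed

section \<open>Lowering generators acting freely\<close>

text \<open>The principal grading, given by the element $2 d_0 + h_0/2$. It is positive exactly on
  the generators of the raising subalgebra and zero exactly on $d_0$, $h_0$ and $C$; the grading
  by $d_0$ alone would not separate $e_0$ and $f_0$ from the Cartan subalgebra.\<close>

fun degree :: "gen \<Rightarrow> int" where
  "degree (E i) = 2 * i + 1"
| "degree (F i) = 2 * i - 1"
| "degree (H i) = 2 * i"
| "degree (D i) = 2 * i"
| "degree C = 0"

lemma word_mult: "word u * word v = word (u @ v)"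
  by (simp add: mult_single plus_list_def)

lemma word_Nil: "word [] = 1"
  by (metis single_one zero_list_def)

lemma linear_mult_left: "linear_map pm_scale pm_scale (\<lambda>p. (u :: 'a list \<Rightarrow>\<^sub>0 complex) * p)"
  by (rule linear_mapI[OF module_pm_scale module_pm_scale]) (simp_all add: distrib_left pm_scale_mult)

lemma linear_mult_right: "linear_map pm_scale pm_scale (\<lambda>p. p * (u :: 'a list \<Rightarrow>\<^sub>0 complex))"
  by (rule linear_mapI[OF module_pm_scale module_pm_scale]) (simp_all add: distrib_right pm_scale_mult)

locale weight =
  fixes \<eta> \<epsilon> \<theta> :: complex
begin

fun \<chi> :: "gen \<Rightarrow> complex" where
  "\<chi> (D i) = (if i = 0 then \<eta> else 0)"
| "\<chi> (H i) = (if i = 0 then \<epsilon> else 0)"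
| "\<chi> C = \<theta>"
| "\<chi> _ = 0"

text \<open>Words in the generators carry a highest weight module for a Lie algebra in which the
  lowering generators are free: a lowering generator is put in front of the word, any other
  generator is commuted to the right past the letters, and on the empty word it acts through
  \<open>\<chi>\<close>. Lowering generators do not yet satisfy the bracket relations among
  themselves.\<close>

primrec gen_act :: "gen list \<Rightarrow> gen \<Rightarrow> (gen list \<Rightarrow>\<^sub>0 complex)" where
  "gen_act [] a = (if degree a < 0 then word [a] else Poly_Mapping.single [] (\<chi> a))"
| "gen_act (y # w) a = (if degree a < 0 then word (a # y # w)
     else word [y] * gen_act w a + lin_ext pm_scale (gen_act w) (gen_bracket a y))"

definition lie_act :: "lie \<Rightarrow> (gen list \<Rightarrow>\<^sub>0 complex) \<Rightarrow> (gen list \<Rightarrow>\<^sub>0 complex)"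
  where "lie_act x t = lin_ext pm_scale (\<lambda>w. lin_ext pm_scale (gen_act w) x) t"

lemma linear_lie_act_right: "linear_map pm_scale pm_scale (lie_act x)"
  unfolding lie_act_def by (rule linear_lin_ext[OF module_pm_scale])

lemma linear_lie_act_left: "linear_map pm_scale pm_scale (\<lambda>x. lie_act x t)"
  unfolding lie_act_def
  by (rule linear_lin_ext_family[OF module_pm_scale linear_lin_ext[OF module_pm_scale]])

sublocale tl: Modules.module_hom pm_scale pm_scale "\<lambda>x. lie_act x t" for t
  by (rule linear_lie_act_left)

sublocale tr: Modules.module_hom pm_scale pm_scale "lie_act x" for x
  by (rule linear_lie_act_right)

lemma lie_act_word: "lie_act x (word w) = lin_ext pm_scale (gen_act w) x"
  by (simp add: lie_act_def)

lemma lie_act_negative: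
  assumes "degree a < 0"
  shows "lie_act (basis a) t = word [a] * t"
proof (rule linear_map_eqI[OF linear_lie_act_right linear_mult_left])
  show "lie_act (basis a) (word w) = word [a] * word w" for w
    using assms by (cases w) (simp_all add: lie_act_word word_mult)
qed

abbreviation borel :: "lie \<Rightarrow> bool"
  where "borel x \<equiv> Poly_Mapping.keys x \<subseteq> {a. degree a \<ge> 0}"

lemma lie_act_cons:
  assumes "borel x"
  shows "lie_act x (word [y] * t) = word [y] * lie_act x t + lie_act (lie_bracket x (basis y)) t"
proof -
  have gen: "lie_act (basis a) (word [y] * t) = word [y] * lie_act (basis a) t + lie_act (lie_bracket (basis a) (basis y)) t"
    if "degree a \<ge> 0" for a
  proof (rule linear_map_eqI[where p = t])
    show "linear_map pm_scale pm_scale (\<lambda>t. lie_act (basis a) (word [y] * t))"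
      by (rule linear_comp[OF linear_mult_left linear_lie_act_right])
    show "linear_map pm_scale pm_scale (\<lambda>t. word [y] * lie_act (basis a) t + lie_act (lie_bracket (basis a) (basis y)) t)"
      by (intro linear_add linear_comp[OF linear_lie_act_right linear_mult_left] linear_lie_act_right)
    show "lie_act (basis a) (word [y] * word w) = word [y] * lie_act (basis a) (word w) + lie_act (lie_bracket (basis a) (basis y)) (word w)" for w
      using that by (simp add: word_mult lie_act_word bracket_single)
  qed
  show ?thesis
  proof (rule linear_map_eqI[where p = x])
    show "linear_map pm_scale pm_scale (\<lambda>x. lie_act x (word [y] * t))" by (rule linear_lie_act_left)
    show "linear_map pm_scale pm_scale (\<lambda>x. word [y] * lie_act x t + lie_act (lie_bracket x (basis y)) t)"
      by (intro linear_add linear_comp[OF linear_lie_act_left linear_mult_left]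
          linear_comp[OF linear_bracket_left linear_lie_act_left])
  qed (use assms gen in auto)
qed

text \<open>The Borel subalgebra is closed under brackets, and brackets of its basis elements
  involve neither $d_0$ nor $h_0$ nor $C$; therefore \<open>\<chi>\<close> extends to a character
  of it.\<close>

lemma gen_bracket_borel:
  assumes "degree a \<ge> 0" "degree b \<ge> 0"
  shows "Poly_Mapping.keys (gen_bracket a b) \<subseteq> {c. degree c \<ge> 0 \<and> \<chi> c = 0}"
  using assms
  by (cases a; cases b)
    (auto simp: in_keys_iff lookup_add lookup_single when_def split: if_splits)

text \<open>By induction on the word. Commuting both generators past the first letter leaves two
  terms in which a generator meets a bracket with that letter. Such a bracket is a combination of
  lowering generators, where the relation holds by definition, and of nonnegative ones, where the
  induction hypothesis applies; the Jacobi identity collects the result.\<close>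

lemma lie_act_commute_borel_gens:
  assumes "degree a \<ge> 0" "degree b \<ge> 0"
  shows "lie_act (basis a) (lie_act (basis b) (word w)) - lie_act (basis b) (lie_act (basis a) (word w))
    = lie_act (gen_bracket a b) (word w)"
  using assms
proof (induction w arbitrary: a b)
  case Nil
  have "lie_act (gen_bracket a b) (word []) = 0"
  proof (rule linear_map_eqI[OF linear_lie_act_left linear_zero[OF module_pm_scale module_pm_scale]])
    show "lie_act (basis c) (word []) = 0" if "c \<in> Poly_Mapping.keys (gen_bracket a b)" for c
      using that gen_bracket_borel[OF Nil] by (auto simp: lie_act_word)
  qed
  moreover have "lie_act (basis c) (lie_act (basis d) (word [])) = Poly_Mapping.single [] (\<chi> d * \<chi> c)"
    if "degree c \<ge> 0" "degree d \<ge> 0" for c d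
  proof -
    have "lie_act (basis d) (word []) = pm_scale (\<chi> d) (word [])" using that by (simp add: lie_act_word)
    then show ?thesis using that by (simp only: tr.scale) (simp add: lie_act_word)
  qed
  ultimately show ?case using Nil by (simp add: mult.commute)
next
  case (Cons y w)
  have comm: "lie_act (basis a) (lie_act z (word w)) - lie_act z (lie_act (basis a) (word w))
    = lie_act (lie_bracket (basis a) z) (word w)" if a: "degree a \<ge> 0" for a z
  proof (rule linear_map_eqI[where p = z])
    show "linear_map pm_scale pm_scale (\<lambda>z. lie_act (basis a) (lie_act z (word w)) - lie_act z (lie_act (basis a) (word w)))"
      by (intro linear_diff linear_comp[OF linear_lie_act_left linear_lie_act_right] linear_lie_act_left)
    show "linear_map pm_scale pm_scale (\<lambda>z. lie_act (lie_bracket (basis a) z) (word w))"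
      by (rule linear_comp[OF linear_bracket_right linear_lie_act_left])
    show "lie_act (basis a) (lie_act (basis c) (word w)) - lie_act (basis c) (lie_act (basis a) (word w))
      = lie_act (lie_bracket (basis a) (basis c)) (word w)" for c
    proof (cases "degree c \<ge> 0")
      case True
      then show ?thesis using Cons.IH[OF a] by (simp add: bracket_single)
    next
      case False
      then show ?thesis using a by (simp add: lie_act_negative lie_act_cons del: single_one)
    qed
  qed
  let ?t = "word w"
  have ba: "borel (basis a)" and bb: "borel (basis b)" and bab: "borel (gen_bracket a b)"
    using Cons.prems gen_bracket_borel[OF Cons.prems] by auto
  have yw: "word (y # w) = word [y] * word w" by (simp add: word_mult)
  have "lie_act (basis a) (lie_act (basis b) (word (y # w))) - lie_act (basis b) (lie_act (basis a) (word (y # w)))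
    = word [y] * (lie_act (basis a) (lie_act (basis b) ?t) - lie_act (basis b) (lie_act (basis a) ?t))
      - (lie_act (basis b) (lie_act (gen_bracket a y) ?t) - lie_act (gen_bracket a y) (lie_act (basis b) ?t))
      + (lie_act (basis a) (lie_act (gen_bracket b y) ?t) - lie_act (gen_bracket b y) (lie_act (basis a) ?t))"
    unfolding yw by (simp add: lie_act_cons[OF ba] lie_act_cons[OF bb] tr.add bracket_single right_diff_distrib)
  also have "\<dots> = word [y] * lie_act (gen_bracket a b) ?t
      + lie_act (lie_bracket (basis a) (gen_bracket b y) - lie_bracket (basis b) (gen_bracket a y)) ?t"
    by (simp add: Cons.IH[OF Cons.prems] comm Cons.prems tl.diff)
  also have "\<dots> = lie_act (gen_bracket a b) (word [y] * ?t)"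
    by (simp add: lie_act_cons[OF bab] gen_jacobi[of a b y])
  finally show ?case unfolding yw .
qed

text \<open>For a lowering second argument this is the rule by which the action on a prefixed word
  is defined; for a nonnegative one it is the preceding lemma.\<close>

lemma lie_act_commute:
  assumes "borel x"
  shows "lie_act x (lie_act z t) = lie_act z (lie_act x t) + lie_act (lie_bracket x z) t"
proof -
  have word: "lie_act (basis a) (lie_act (basis c) (word w)) = lie_act (basis c) (lie_act (basis a) (word w))
      + lie_act (lie_bracket (basis a) (basis c)) (word w)" if "degree a \<ge> 0" for a c w
    using that lie_act_commute_borel_gens[of a c w]
    by (cases "degree c \<ge> 0") (auto simp: lie_act_negative lie_act_cons bracket_single algebra_simps)
  note lin = linear_lie_act_left linear_lie_act_right 
    linear_comp[OF linear_lie_act_left linear_lie_act_right]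
    linear_comp[OF linear_lie_act_right linear_lie_act_right]
    linear_comp[OF linear_bracket_left linear_lie_act_left] linear_comp[OF linear_bracket_right linear_lie_act_left]
  show ?thesis
    by (rule trilinear_eqI[where f = "\<lambda>x z t. lie_act x (lie_act z t)"
          and g = "\<lambda>x z t. lie_act z (lie_act x t) + lie_act (lie_bracket x z) t"])
      (rule lin linear_add | (rule word, use assms in auto))+
qed

section \<open>The radical\<close>

abbreviation act_word :: "gen list \<Rightarrow> (gen list \<Rightarrow>\<^sub>0 complex) \<Rightarrow> (gen list \<Rightarrow>\<^sub>0 complex)"
  where "act_word u t \<equiv> foldr (\<lambda>a. lie_act (basis a)) u t"

text \<open>The coordinate of the highest weight vector, which is the empty word.\<close>

definition vac :: "(gen list \<Rightarrow>\<^sub>0 complex) \<Rightarrow> complex"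
  where "vac t = Poly_Mapping.lookup t []"

lemma linear_vac: "linear_map pm_scale (*) vac"
  by (rule linear_mapI[OF module_pm_scale])
    (unfold_locales, simp_all add: vac_def lookup_add lookup_pm_scale algebra_simps)

sublocale vac: Modules.module_hom pm_scale "(*)" vac by (rule linear_vac)

lemma linear_act_word: "linear_map pm_scale pm_scale (act_word u)"
proof (induction u)
  case Nil
  then show ?case by (simp add: module_hom_iff module_pm_scale)
next
  case (Cons a u)
  then show ?case using linear_comp[OF Cons linear_lie_act_right] by simp
qed

sublocale aw: Modules.module_hom pm_scale pm_scale "act_word u" for u by (rule linear_act_word)

lemma vac_word_mult [simp]: "vac (word [a] * t) = 0"
proof (rule linear_map_eqI[where p = t and f = "\<lambda>t. vac (word [a] * t)"])
  show "linear_map pm_scale (*) (\<lambda>t. vac (word [a] * t))"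
    by (rule linear_comp[OF linear_mult_left linear_vac])
  show "linear_map pm_scale (*) (\<lambda>t. 0)" 
    by (rule linear_zero[OF module_pm_scale vac.m2.module_axioms])
  show "vac (word [a] * word w) = 0" for w
    by (simp add: word_mult vac_def lookup_single when_def)
qed

text \<open>The largest subspace of the kernel of \<open>vac\<close> that the Borel subalgebra
  preserves. Lowering generators preserve it too, and so it is what has to be divided out in order
  to make the remaining bracket relations true.\<close>

definition radical :: "(gen list \<Rightarrow>\<^sub>0 complex) set"
  where "radical = {t. \<forall>u. (\<forall>a\<in>set u. degree a \<ge> 0) \<longrightarrow> vac (act_word u t) = 0}"

lemma radical_zero: "0 \<in> radical" by (simp add: radical_def aw.zero vac.zero)

lemma radical_add: "s \<in> radical \<Longrightarrow> t \<in> radical \<Longrightarrow> s + t \<in> radical"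
  by (simp add: radical_def aw.add vac.add)

lemma radical_scale: "t \<in> radical \<Longrightarrow> pm_scale c t \<in> radical"
  by (simp add: radical_def aw.scale vac.scale)

lemma vac_radical: "t \<in> radical \<Longrightarrow> vac t = 0"
  unfolding radical_def by (drule CollectD, drule spec[of _ "[]"]) simp

text \<open>A lowering generator is moved to the left through the product of nonnegative
  generators in front of it. Once it is leftmost it produces words that start with it, which
  \<open>vac\<close> does not see; the commutators on the way have fewer factors in front of
  them.\<close>

lemma radical_lie_act_gen: "t \<in> radical \<Longrightarrow> lie_act (basis a) t \<in> radical"
proof (cases "degree a \<ge> 0")
  case True
  assume t: "t \<in> radical"
  show ?thesis unfolding radical_def
  proof (intro CollectI allI impI)
    fix u assume "\<forall>a\<in>set u. degree a \<ge> 0"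
    with True have "\<forall>a\<in>set (u @ [a]). degree a \<ge> 0" by simp
    with t have "vac (act_word (u @ [a]) t) = 0" unfolding radical_def by blast
    then show "vac (act_word u (lie_act (basis a) t)) = 0" by simp
  qed
next
  case False
  assume t: "t \<in> radical"
  have "vac (act_word u (lie_act (basis a) t)) = 0"
    if "\<forall>a\<in>set u. degree a \<ge> 0" "degree a < 0" "t \<in> radical" for u a t
    using that
  proof (induction u arbitrary: a t rule: rev_induct)
    case Nil
    then show ?case by (simp add: lie_act_negative)
  next
    case (snoc x u)
    have u: "\<forall>a\<in>set u. degree a \<ge> 0" and x: "degree x \<ge> 0" using snoc.prems by auto
    \<comment> \<open>The commutator may lie in the Borel subalgebra or be lowering again.\<close>
    have gen: "vac (act_word u (lie_act (basis b) t)) = 0" for b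
    proof (cases "degree b \<ge> 0")
      case True
      then have "\<forall>a\<in>set (u @ [b]). degree a \<ge> 0" using u by simp
      then have "vac (act_word (u @ [b]) t) = 0" using snoc.prems(3) unfolding radical_def by blast
      then show ?thesis by simp
    qed (use snoc.IH[OF u _ snoc.prems(3)] in simp)
    have "vac (act_word u (lie_act z t)) = 0" for z
    proof (rule linear_map_eqI[where p = z and f = "\<lambda>z. vac (act_word u (lie_act z t))"])
      show "linear_map pm_scale (*) (\<lambda>z. vac (act_word u (lie_act z t)))"
        by (rule linear_comp[OF linear_comp[OF linear_lie_act_left linear_act_word] linear_vac])
      show "linear_map pm_scale (*) (\<lambda>t. 0)"
        by (rule linear_zero[OF module_pm_scale vac.m2.module_axioms])
    qed (rule gen)
    moreover have "lie_act (basis x) t \<in> radical"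
      unfolding radical_def
    proof (intro CollectI allI impI)
      fix u assume "\<forall>a\<in>set u. degree a \<ge> 0"
      with x have "\<forall>a\<in>set (u @ [x]). degree a \<ge> 0" by simp
      with snoc.prems(3) have "vac (act_word (u @ [x]) t) = 0" unfolding radical_def by blast
      then show "vac (act_word u (lie_act (basis x) t)) = 0" by simp
    qed
    then have "vac (act_word u (lie_act (basis a) (lie_act (basis x) t))) = 0"
      by (rule snoc.IH[OF u snoc.prems(2)])
    ultimately show ?case using x by (simp add: lie_act_commute aw.add vac.add)
  qed
  with t False show ?thesis by (simp add: radical_def)
qed

lemma radical_lie_act: "t \<in> radical \<Longrightarrow> lie_act x t \<in> radical"
proof (induction x rule: poly_mapping_add_induct)
  case (single a c)
  then show ?case using radical_scale[OF radical_lie_act_gen[of t a], of c]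
    by (simp flip: tl.scale)
qed (simp_all add: tl.zero tl.add radical_zero radical_add)

definition defect :: "lie \<Rightarrow> lie \<Rightarrow> (gen list \<Rightarrow>\<^sub>0 complex) \<Rightarrow> (gen list \<Rightarrow>\<^sub>0 complex)"
  where "defect x y t = lie_act x (lie_act y t) - lie_act y (lie_act x t) - lie_act (lie_bracket x y) t"

text \<open>An element of the Borel subalgebra acts on defects as a derivation in both arguments,
  so that a product of such elements in front of a defect can be absorbed. What is left is the
  value of \<open>vac\<close> on a defect. If an argument is nonnegative the defect vanishes;
  otherwise it is a combination of words that start with a lowering generator.\<close>

lemma defect_radical: "defect x y t \<in> radical"
proof -
  have "vac (act_word u (defect x y t)) = 0" if "\<forall>a\<in>set u. degree a \<ge> 0" for u
    using that
  proof (induction u arbitrary: x y t rule: rev_induct)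
    case Nil
    note lin = linear_lie_act_left linear_lie_act_right
      linear_comp[OF linear_lie_act_left linear_lie_act_right] linear_comp[OF linear_lie_act_right linear_lie_act_right]
      linear_comp[OF linear_bracket_left linear_lie_act_left] linear_comp[OF linear_bracket_right linear_lie_act_left]
    have "vac (defect x y t) = 0"
    proof (rule trilinear_eqI[where f = "\<lambda>x y t. vac (defect x y t)"])
      fix a b w
      have "defect (basis a) (basis b) t = 0" if "degree a \<ge> 0" for t
        using that by (simp add: defect_def lie_act_commute)
      moreover have "defect (basis a) (basis b) t = 0" if "degree b \<ge> 0" for t
        using that by (simp add: defect_def lie_act_commute[of "basis b"] bracket_antisym[of "basis b"] tl.neg)
      moreover have "vac (defect (basis a) (basis b) t) = 0" if "degree a < 0" "degree b < 0" for t
      proof -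
        have "vac (lie_act (gen_bracket a b) t) = 0"
        proof (rule linear_map_eqI[where f = "\<lambda>z. vac (lie_act z t)"])
          show "linear_map pm_scale (*) (\<lambda>z. vac (lie_act z t))"
            by (rule linear_comp[OF linear_lie_act_left linear_vac])
          show "linear_map pm_scale (*) (\<lambda>t. 0)"
            by (rule linear_zero[OF module_pm_scale vac.m2.module_axioms])
          fix c assume "c \<in> Poly_Mapping.keys (gen_bracket a b)"
          then have "degree c < 0" using that
            by (cases a; cases b) (auto simp: in_keys_iff lookup_add lookup_single when_def split: if_splits)
          then show "vac (lie_act (basis c) t) = 0" by (simp add: lie_act_negative)
        qed
        then show ?thesis using that by (simp add: defect_def vac.diff lie_act_negative bracket_single)
      qed
      ultimately show "vac (defect (basis a) (basis b) (word w)) = 0"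
        by (cases "degree a \<ge> 0"; cases "degree b \<ge> 0") (simp_all add: vac.zero)
    qed (unfold defect_def, ((rule linear_comp[OF _ linear_vac] linear_diff lin
          linear_zero[OF module_pm_scale vac.m2.module_axioms])+))
    then show ?case by simp
  next
    case (snoc a u)
    then have u: "\<forall>a\<in>set u. degree a \<ge> 0" and a: "borel (basis a)" by auto
    have "lie_act (basis a) (defect x y t) = defect x y (lie_act (basis a) t)
        + defect (lie_bracket (basis a) x) y t + defect x (lie_bracket (basis a) y) t"
      by (simp add: defect_def tr.diff lie_act_commute[OF a] jacobi[of "basis a"] tr.add tl.add)
    then show ?case using snoc.IH[OF u] by (simp add: aw.add vac.add)
  qed
  then show ?thesis by (simp add: radical_def)
qed

section \<open>A functional on the enveloping algebra\<close>

text \<open>The action of the free algebra on words. It respects the relations of the enveloping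
  algebra only up to the radical, which is enough after composition with
  \<open>vac\<close>.\<close>

definition ev :: "(lie list \<Rightarrow>\<^sub>0 complex) \<Rightarrow> (gen list \<Rightarrow>\<^sub>0 complex) \<Rightarrow> (gen list \<Rightarrow>\<^sub>0 complex)"
  where "ev p t = lin_ext pm_scale (\<lambda>w. foldr lie_act w t) p"

lemma linear_foldr_lie_act: "linear_map pm_scale pm_scale (foldr lie_act w)"
proof (induction w)
  case Nil
  then show ?case by (simp add: module_hom_iff module_pm_scale)
next
  case (Cons a u)
  then show ?case using linear_comp[OF Cons linear_lie_act_right] by simp
qed

lemma linear_ev_left: "linear_map pm_scale pm_scale (\<lambda>p. ev p t)"
  unfolding ev_def by (rule linear_lin_ext[OF module_pm_scale])

lemma linear_ev_right: "linear_map pm_scale pm_scale (ev p)"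
  unfolding ev_def by (rule linear_lin_ext_family[OF module_pm_scale linear_foldr_lie_act])

sublocale el: Modules.module_hom pm_scale pm_scale "\<lambda>p. ev p t" for t
  by (rule linear_ev_left)

sublocale er: Modules.module_hom pm_scale pm_scale "ev p" for p
  by (rule linear_ev_right)

lemma ev_word: "ev (word w) t = foldr lie_act w t"
  by (simp add: ev_def)

lemma ev_single: "ev (Poly_Mapping.single w c) t = pm_scale c (foldr lie_act w t)"
  by (simp add: ev_def)

lemma ev_one: "ev 1 t = t"
  using ev_word[of "[]"] by (simp add: word_Nil)

lemma ev_mult: "ev (p * q) t = ev p (ev q t)"
proof (rule trilinear_eqI[where f = "\<lambda>p q t. ev (p * q) t" and g = "\<lambda>p q t. ev p (ev q t)"])
qed (rule linear_ev_left linear_ev_right linear_comp[OF linear_mult_left linear_ev_left]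
    linear_comp[OF linear_mult_right linear_ev_left]
    linear_comp[OF linear_ev_left linear_ev_right] linear_comp[OF linear_ev_right linear_ev_right]
    | simp add: word_mult ev_word)+

lemma radical_ev: "t \<in> radical \<Longrightarrow> ev p t \<in> radical"
proof (induction p rule: poly_mapping_add_induct)
  case (single w c)
  have "foldr lie_act w t \<in> radical"
    by (induction w) (simp_all add: single radical_lie_act)
  then show ?case by (simp add: ev_def radical_scale)
qed (simp_all add: el.zero el.add radical_zero radical_add)

lemma ev_env_relators: "r \<in> env_relators UNIV \<Longrightarrow> ev r t \<in> radical"
  using defect_radical radical_zero
  by (auto simp: env_relators_def el.diff ev_single tl.add tl.scale defect_def)

text \<open>The Harish-Chandra projection followed by the evaluation at the weight
  \<open>\<chi>\<close>.\<close>

definition hw :: "(lie list \<Rightarrow>\<^sub>0 complex) \<Rightarrow> complex"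
  where "hw p = vac (ev p (word []))"

lemma linear_hw: "linear_map pm_scale (*) hw"
  unfolding hw_def by (rule linear_comp[OF linear_ev_left linear_vac])

sublocale hw: Modules.module_hom pm_scale "(*)" hw by (rule linear_hw)

lemma hw_one: "hw 1 = 1"
  by (simp add: hw_def ev_one vac_def)

lemma hw_env_relators: "r \<in> env_relators UNIV \<Longrightarrow> hw (u * r * w) = 0"
  by (simp add: hw_def ev_mult vac_radical radical_ev ev_env_relators)

lemma hw_negative: "degree a < 0 \<Longrightarrow> hw (word [basis a] * p) = 0"
  by (simp add: hw_def ev_mult ev_word lie_act_negative)

lemma hw_borel: 
  assumes "degree a \<ge> 0"
  shows "hw (p * word [basis a]) = \<chi> a * hw p"
proof -
  have "lie_act (basis a) (word []) = pm_scale (\<chi> a) (word [])" using assms by (simp add: lie_act_word)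
  then show ?thesis by (simp only: hw_def ev_mult ev_word foldr.simps o_apply id_apply er.scale vac.scale)
qed

end

section \<open>Presentations\<close>

text \<open>The modules in play are iterated quotients, whose elements are cosets of cosets. A
  presentation describes such a module as the image of a subspace \<open>S\<close> of a free
  vector space under a map \<open>\<pi>\<close>, the operators being images of operators on
  \<open>S\<close>. All computations can then be made with finitely supported functions. The index
  map \<open>ix\<close> is needed because the operators may be indexed by elements that are
  themselves cosets.\<close>

locale presentation =
  fixes N :: "('r, 'v) act_module" and S :: "('b \<Rightarrow>\<^sub>0 complex) set"
    and R :: "'q set" and ix :: "'q \<Rightarrow> 'r" and ac :: "'q \<Rightarrow> ('b \<Rightarrow>\<^sub>0 complex) \<Rightarrow> ('b \<Rightarrow>\<^sub>0 complex)"
    and \<pi> :: "('b \<Rightarrow>\<^sub>0 complex) \<Rightarrow> 'v"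
  assumes S_zero: "0 \<in> S"
    and S_add: "\<And>p q. p \<in> S \<Longrightarrow> q \<in> S \<Longrightarrow> p + q \<in> S"
    and S_scale: "\<And>c p. p \<in> S \<Longrightarrow> pm_scale c p \<in> S"
    and S_act: "\<And>r p. r \<in> R \<Longrightarrow> p \<in> S \<Longrightarrow> ac r p \<in> S"
    and linear_ac: "\<And>r. r \<in> R \<Longrightarrow> linear_map pm_scale pm_scale (ac r)"
    and carrier_eq: "carrier N = \<pi> ` S"
    and zero_eq: "\<zero>\<^bsub>N\<^esub> = \<pi> 0"
    and add_eq: "\<And>p q. p \<in> S \<Longrightarrow> q \<in> S \<Longrightarrow> \<pi> p \<oplus>\<^bsub>N\<^esub> \<pi> q = \<pi> (p + q)"
    and smult_eq: "\<And>c p. p \<in> S \<Longrightarrow> c \<odot>\<^bsub>N\<^esub> \<pi> p = \<pi> (pm_scale c p)"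
    and act_eq: "\<And>r p. r \<in> R \<Longrightarrow> p \<in> S \<Longrightarrow> act N (ix r) (\<pi> p) = \<pi> (ac r p)"
begin

lemma S_neg: "p \<in> S \<Longrightarrow> - p \<in> S"
  using S_scale[of p "-1"] by simp

lemma S_diff: "p \<in> S \<Longrightarrow> q \<in> S \<Longrightarrow> p - q \<in> S"
  using S_add[OF _ S_neg] by fastforce

lemma ac_add: "r \<in> R \<Longrightarrow> ac r (p + q) = ac r p + ac r q"
  using linear_ac by (simp add: module_hom_iff)

lemma ac_diff: "r \<in> R \<Longrightarrow> ac r (p - q) = ac r p - ac r q"
  using linear_ac module_hom.diff by blast

definition subspace :: "'v set \<Rightarrow> bool"
  where "subspace K \<longleftrightarrow> K \<subseteq> carrier N \<and> \<zero>\<^bsub>N\<^esub> \<in> K \<and> (\<forall>u\<in>K. \<forall>v\<in>K. u \<oplus>\<^bsub>N\<^esub> v \<in> K) \<and>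
    (\<forall>c. \<forall>v\<in>K. c \<odot>\<^bsub>N\<^esub> v \<in> K)"

lemma inv_eq: "p \<in> S \<Longrightarrow> m_inv (add_monoid N) (\<pi> p) = \<pi> (- p)"
  unfolding m_inv_def
proof (rule the_equality)
  assume p: "p \<in> S"
  show "\<pi> (- p) \<in> carrier (add_monoid N) \<and> \<pi> p \<otimes>\<^bsub>add_monoid N\<^esub> \<pi> (- p) = \<one>\<^bsub>add_monoid N\<^esub> \<and>
    \<pi> (- p) \<otimes>\<^bsub>add_monoid N\<^esub> \<pi> p = \<one>\<^bsub>add_monoid N\<^esub>"
    using p by (simp add: carrier_eq add_eq S_neg zero_eq)
  fix y
  assume y: "y \<in> carrier (add_monoid N) \<and> \<pi> p \<otimes>\<^bsub>add_monoid N\<^esub> y = \<one>\<^bsub>add_monoid N\<^esub> \<and>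
    y \<otimes>\<^bsub>add_monoid N\<^esub> \<pi> p = \<one>\<^bsub>add_monoid N\<^esub>"
  then obtain q where q: "q \<in> S" "y = \<pi> q" by (auto simp: carrier_eq)
  have sum: "\<pi> (p + q) = \<pi> 0" using y p q by (simp add: add_eq zero_eq)
  have "y = \<pi> ((- p) + (p + q))" using q by simp
  also have "\<dots> = \<pi> (- p) \<oplus>\<^bsub>N\<^esub> \<pi> 0"
    using add_eq[OF S_neg[OF p] S_add[OF p q(1)]] sum by simp
  also have "\<dots> = \<pi> (- p)" using p by (simp add: add_eq S_neg S_zero)
  finally show "y = \<pi> (- p)" .
qed

text \<open>Closure under negation is automatic because the negative of a vector is its multiple
  by $-1$.\<close>

lemma submodule_iff: "submodule K \<complex> N \<longleftrightarrow> subspace K"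
proof
  assume "submodule K \<complex> N"
  then interpret submodule K \<complex> N .
  show "subspace K" unfolding subspace_def
    using subset m_closed one_closed smult_closed by (simp add: ring_of_type_algebra_def)
next
  assume K: "subspace K"
  show "submodule K \<complex> N"
  proof unfold_locales
    show "K \<subseteq> carrier (add_monoid N)" using K by (simp add: subspace_def)
    fix x assume x: "x \<in> K"
    then obtain p where p: "p \<in> S" "x = \<pi> p" using K by (auto simp: subspace_def carrier_eq)
    have "inv\<^bsub>add_monoid N\<^esub> x = (-1) \<odot>\<^bsub>N\<^esub> x" using p by (simp add: inv_eq smult_eq)
    then show "inv\<^bsub>add_monoid N\<^esub> x \<in> K" using K x by (simp add: subspace_def)
  qed (use K in \<open>auto simp: subspace_def\<close>)
qed

context
  fixes K
  assumes K: "subspace K"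
begin

lemma K_zero: "\<pi> 0 \<in> K" using K by (simp add: subspace_def zero_eq)

lemma K_add: "p \<in> S \<Longrightarrow> q \<in> S \<Longrightarrow> \<pi> p \<in> K \<Longrightarrow> \<pi> q \<in> K \<Longrightarrow> \<pi> (p + q) \<in> K"
  using K by (simp add: subspace_def flip: add_eq)

lemma K_scale: "p \<in> S \<Longrightarrow> \<pi> p \<in> K \<Longrightarrow> \<pi> (pm_scale c p) \<in> K"
  using K by (simp add: subspace_def flip: smult_eq)

lemma K_cong: "p \<in> S \<Longrightarrow> q \<in> S \<Longrightarrow> r \<in> S \<Longrightarrow> \<pi> p = \<pi> q \<Longrightarrow> \<pi> (p - r) = \<pi> (q - r)"
  using add_eq[of p "- r"] add_eq[of q "- r"] S_neg[of r] by simp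

lemma coset: "p \<in> S \<Longrightarrow> K +>\<^bsub>N\<^esub> \<pi> p = {\<pi> q | q. q \<in> S \<and> \<pi> (q - p) \<in> K}"
proof safe
  fix v assume p: "p \<in> S" and "v \<in> K +>\<^bsub>N\<^esub> \<pi> p"
  then obtain k where k: "k \<in> K" "v = k \<oplus>\<^bsub>N\<^esub> \<pi> p" by (auto simp: a_r_coset_def')
  then obtain q where "q \<in> S" "k = \<pi> q" using K by (auto simp: subspace_def carrier_eq)
  then show "\<exists>q. v = \<pi> q \<and> q \<in> S \<and> \<pi> (q - p) \<in> K"
    using p k by (intro exI[of _ "q + p"]) (simp add: add_eq S_add)
next
  fix q assume p: "p \<in> S" and "q \<in> S" "\<pi> (q - p) \<in> K"
  moreover have "\<pi> q = \<pi> (q - p) \<oplus>\<^bsub>N\<^esub> \<pi> p" using \<open>q \<in> S\<close> p by (simp add: add_eq S_diff)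
  ultimately show "\<pi> q \<in> K +>\<^bsub>N\<^esub> \<pi> p" by (auto simp: a_r_coset_def')
qed

lemma coset_eq_iff:
  assumes p: "p \<in> S" and q: "q \<in> S"
  shows "K +>\<^bsub>N\<^esub> \<pi> p = K +>\<^bsub>N\<^esub> \<pi> q \<longleftrightarrow> \<pi> (p - q) \<in> K"
proof
  assume "K +>\<^bsub>N\<^esub> \<pi> p = K +>\<^bsub>N\<^esub> \<pi> q"
  moreover have "\<pi> p \<in> K +>\<^bsub>N\<^esub> \<pi> p" using p K_zero by (subst coset) (auto intro!: exI[of _ p])
  ultimately show "\<pi> (p - q) \<in> K" using p q by (auto simp: coset dest: K_cong)
next
  have sub: "\<pi> r \<in> K +>\<^bsub>N\<^esub> \<pi> q"
    if "p \<in> S" "q \<in> S" "r \<in> S" "\<pi> (p - q) \<in> K" "\<pi> (r - p) \<in> K" for p q r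
    using K_add[of "r - p" "p - q"] that by (subst coset) (auto simp: S_diff)
  assume pq: "\<pi> (p - q) \<in> K"
  then have qp: "\<pi> (q - p) \<in> K" using K_scale[of "p - q" "-1"] p q by (simp add: S_diff)
  show "K +>\<^bsub>N\<^esub> \<pi> p = K +>\<^bsub>N\<^esub> \<pi> q"
  proof (intro equalityI subsetI)
    show "v \<in> K +>\<^bsub>N\<^esub> \<pi> q" if "v \<in> K +>\<^bsub>N\<^esub> \<pi> p" for v
      using that sub[OF p q _ pq] by (auto simp: coset[OF p])
    show "v \<in> K +>\<^bsub>N\<^esub> \<pi> p" if "v \<in> K +>\<^bsub>N\<^esub> \<pi> q" for v
      using that sub[OF q p _ qp] by (auto simp: coset[OF q])
  qed
qed

lemma coset_mem:
  "p \<in> S \<Longrightarrow> q \<in> S \<Longrightarrow> \<pi> q \<in> K +>\<^bsub>N\<^esub> \<pi> p \<longleftrightarrow> \<pi> (q - p) \<in> K"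
  by (auto simp: coset dest: K_cong)

text \<open>The common computation behind the scalar multiplication and the action on a
  quotient.\<close>

lemma coset_plus_image:
  assumes p: "p \<in> S" and fS: "\<And>q. q \<in> S \<Longrightarrow> f q \<in> S" and fd: "\<And>q r. f (q - r) = f q - f r"
    and fK: "\<And>q. q \<in> S \<Longrightarrow> \<pi> q \<in> K \<Longrightarrow> \<pi> (f q) \<in> K" and gf: "\<And>q. q \<in> S \<Longrightarrow> g (\<pi> q) = \<pi> (f q)"
  shows "K <+>\<^bsub>N\<^esub> (g ` (K +>\<^bsub>N\<^esub> \<pi> p)) = K +>\<^bsub>N\<^esub> \<pi> (f p)"
proof (intro equalityI subsetI)
  fix v assume "v \<in> K <+>\<^bsub>N\<^esub> (g ` (K +>\<^bsub>N\<^esub> \<pi> p))"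
  then obtain k q where kq: "k \<in> K" "q \<in> S" "\<pi> (q - p) \<in> K" "v = k \<oplus>\<^bsub>N\<^esub> g (\<pi> q)"
    using p by (auto simp: set_add_def' coset)
  then obtain l where l: "l \<in> S" "k = \<pi> l" using K by (auto simp: subspace_def carrier_eq)
  have "\<pi> (l + f (q - p)) \<in> K" using kq l p fK S_diff fS by (intro K_add) auto
  then have "\<pi> (l + f q - f p) \<in> K" by (simp add: fd add_diff_eq)
  moreover have "v = \<pi> (l + f q)" using kq l by (simp add: gf add_eq fS)
  ultimately show "v \<in> K +>\<^bsub>N\<^esub> \<pi> (f p)" using l kq p by (simp add: coset_mem fS S_add)
next
  fix v assume "v \<in> K +>\<^bsub>N\<^esub> \<pi> (f p)"
  then obtain q where q: "q \<in> S" "\<pi> (q - f p) \<in> K" "v = \<pi> q" using p fS by (auto simp: coset)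
  have "v = \<pi> (q - f p) \<oplus>\<^bsub>N\<^esub> g (\<pi> p)" using q p by (simp add: gf add_eq fS S_diff)
  moreover have "\<pi> p \<in> K +>\<^bsub>N\<^esub> \<pi> p" using p K_zero by (simp add: coset_mem)
  ultimately show "v \<in> K <+>\<^bsub>N\<^esub> (g ` (K +>\<^bsub>N\<^esub> \<pi> p))" using q by (auto simp: set_add_def')
qed

lemma coset_add:
  assumes p: "p \<in> S" and q: "q \<in> S"
  shows "(K +>\<^bsub>N\<^esub> \<pi> p) <+>\<^bsub>N\<^esub> (K +>\<^bsub>N\<^esub> \<pi> q) = K +>\<^bsub>N\<^esub> \<pi> (p + q)"
proof (intro equalityI subsetI)
  fix v assume "v \<in> (K +>\<^bsub>N\<^esub> \<pi> p) <+>\<^bsub>N\<^esub> (K +>\<^bsub>N\<^esub> \<pi> q)"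
  then obtain a b where ab: "a \<in> S" "\<pi> (a - p) \<in> K" "b \<in> S" "\<pi> (b - q) \<in> K" "v = \<pi> a \<oplus>\<^bsub>N\<^esub> \<pi> b"
    using p q by (auto simp: set_add_def' coset)
  then have "\<pi> ((a - p) + (b - q)) \<in> K" using p q by (intro K_add S_diff)
  moreover have "(a - p) + (b - q) = (a + b) - (p + q)" by simp
  ultimately show "v \<in> K +>\<^bsub>N\<^esub> \<pi> (p + q)" using ab p q by (simp add: add_eq coset_mem S_add)
next
  fix v assume "v \<in> K +>\<^bsub>N\<^esub> \<pi> (p + q)"
  then obtain r where r: "r \<in> S" "\<pi> (r - (p + q)) \<in> K" "v = \<pi> r" using p q by (auto simp: coset S_add)
  have "\<pi> (r - q) \<in> K +>\<^bsub>N\<^esub> \<pi> p" using r p q by (simp add: coset_mem S_diff diff_diff_eq2 algebra_simps)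
  moreover have "\<pi> q \<in> K +>\<^bsub>N\<^esub> \<pi> q" using q K_zero by (simp add: coset_mem)
  moreover have "v = \<pi> (r - q) \<oplus>\<^bsub>N\<^esub> \<pi> q" using r q by (simp add: add_eq S_diff)
  ultimately show "v \<in> (K +>\<^bsub>N\<^esub> \<pi> p) <+>\<^bsub>N\<^esub> (K +>\<^bsub>N\<^esub> \<pi> q)" by (auto simp: set_add_def')
qed

text \<open>Composing with the passage to cosets presents the quotient by the same space
  \<open>S\<close>; this is how presentations propagate through the iterated
  constructions.\<close>

lemma presentation_quot:
  assumes stable: "\<And>r v. r \<in> R \<Longrightarrow> v \<in> K \<Longrightarrow> act N (ix r) v \<in> K"
  shows "presentation (quot_mod N K) S R ix ac (\<lambda>p. K +>\<^bsub>N\<^esub> \<pi> p)"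
proof (rule presentation.intro)
  show "carrier (quot_mod N K) = (\<lambda>p. K +>\<^bsub>N\<^esub> \<pi> p) ` S"
    by (auto simp: quot_mod_def A_RCOSETS_def' carrier_eq)
  have "K +>\<^bsub>N\<^esub> \<pi> 0 = K"
  proof (intro equalityI subsetI)
    fix v assume v: "v \<in> K"
    then obtain q where "q \<in> S" "v = \<pi> q" using K by (auto simp: subspace_def carrier_eq)
    then show "v \<in> K +>\<^bsub>N\<^esub> \<pi> 0" using v by (simp add: coset_mem S_zero)
  qed (auto simp: coset S_zero)
  then show "\<zero>\<^bsub>quot_mod N K\<^esub> = K +>\<^bsub>N\<^esub> \<pi> 0" by (simp add: quot_mod_def)
  show "(K +>\<^bsub>N\<^esub> \<pi> p) \<oplus>\<^bsub>quot_mod N K\<^esub> (K +>\<^bsub>N\<^esub> \<pi> q) = K +>\<^bsub>N\<^esub> \<pi> (p + q)"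
    if "p \<in> S" "q \<in> S" for p q
    using coset_add[OF that] by (simp add: quot_mod_def)
  show "c \<odot>\<^bsub>quot_mod N K\<^esub> (K +>\<^bsub>N\<^esub> \<pi> p) = K +>\<^bsub>N\<^esub> \<pi> (pm_scale c p)" if "p \<in> S" for c p
    using coset_plus_image[of p "pm_scale c" "module.smult N c"] that
    by (simp add: quot_mod_def smult_eq S_scale K_scale pm.scale_right_diff_distrib)
  show "act (quot_mod N K) (ix r) (K +>\<^bsub>N\<^esub> \<pi> p) = K +>\<^bsub>N\<^esub> \<pi> (ac r p)" if "r \<in> R" "p \<in> S" for r p
  proof -
    have "K <+>\<^bsub>N\<^esub> (act N (ix r) ` (K +>\<^bsub>N\<^esub> \<pi> p)) = K +>\<^bsub>N\<^esub> \<pi> (ac r p)"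
      by (rule coset_plus_image) (use that stable[of r] in \<open>auto simp: S_act ac_diff act_eq[symmetric]\<close>)
    then show ?thesis by (simp add: quot_mod_def)
  qed
qed (fact S_zero S_add S_scale S_act linear_ac)+

end

lemma presentation_pullback:
  assumes "\<And>x. f x = ix (h x)" "\<And>x. h x \<in> R"
  shows "presentation (pullback f N) S UNIV (\<lambda>x. x) (\<lambda>x. ac (h x)) \<pi>"
  by (rule presentation.intro)
    (simp_all add: pullback_def S_zero S_add S_scale S_act linear_ac carrier_eq zero_eq add_eq smult_eq act_eq assms)

end

section \<open>Enveloping algebras\<close>

lemma free_algebra_simps [simp]:
  "carrier (free_algebra g) = {p. Poly_Mapping.keys p \<subseteq> lists g}"
  "add (free_algebra g) = (+)" "monoid.mult (free_algebra g) = (*)"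
  "\<zero>\<^bsub>free_algebra g\<^esub> = 0" "\<one>\<^bsub>free_algebra g\<^esub> = 1"
  by (simp_all add: free_algebra_def ring_of_type_algebra_def)

definition env_class :: "lie set \<Rightarrow> (lie list \<Rightarrow>\<^sub>0 complex) \<Rightarrow> env_elt"
  where "env_class g p = env_ideal g +>\<^bsub>free_algebra g\<^esub> p"

lemma env_of_eq: "env_of g x = env_class g (word [x])" by (simp add: env_of_def env_class_def)

lemma env_scalar_eq: "env_scalar g c = env_class g (pm_scale c (word []))" by (simp add: env_scalar_def env_class_def)

lemma keys_mult_lists:
  "Poly_Mapping.keys p \<subseteq> lists g \<Longrightarrow> Poly_Mapping.keys q \<subseteq> lists g \<Longrightarrow> Poly_Mapping.keys (p * q) \<subseteq> lists g"
proof
  fix w assume p: "Poly_Mapping.keys p \<subseteq> lists g" and q: "Poly_Mapping.keys q \<subseteq> lists g"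
    and "w \<in> Poly_Mapping.keys (p * q)"
  then obtain u v where "w = u @ v" "u \<in> Poly_Mapping.keys p" "v \<in> Poly_Mapping.keys q"
    using keys_mult[of p q] by (auto simp: plus_list_def)
  then show "w \<in> lists g" using p q by auto
qed

lemma keys_diff_subset:
  fixes p q :: "'a \<Rightarrow>\<^sub>0 complex"
  shows "Poly_Mapping.keys p \<subseteq> A \<Longrightarrow> Poly_Mapping.keys q \<subseteq> A \<Longrightarrow> Poly_Mapping.keys (p - q) \<subseteq> A"
proof
  fix a assume "Poly_Mapping.keys p \<subseteq> A" "Poly_Mapping.keys q \<subseteq> A" "a \<in> Poly_Mapping.keys (p - q)"
  moreover from this(3) have "a \<in> Poly_Mapping.keys p \<or> a \<in> Poly_Mapping.keys q"
    by (auto simp: in_keys_iff lookup_minus)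
  ultimately show "a \<in> A" by blast
qed

lemma keys_add_subset:
  fixes p q :: "'a \<Rightarrow>\<^sub>0 complex"
  shows "Poly_Mapping.keys p \<subseteq> A \<Longrightarrow> Poly_Mapping.keys q \<subseteq> A \<Longrightarrow> Poly_Mapping.keys (p + q) \<subseteq> A"
  by (rule order_trans[OF keys_add Un_least])

lemma keys_scale_subset: "Poly_Mapping.keys p \<subseteq> A \<Longrightarrow> Poly_Mapping.keys (pm_scale c p) \<subseteq> A"
  by (rule order_trans[OF keys_pm_scale])

lemma ring_free_algebra: "ring (free_algebra g)"
proof (rule ringI)
  show "abelian_group (free_algebra g)"
  proof (rule abelian_groupI)
    fix p assume "p \<in> carrier (free_algebra g)"
    then show "\<exists>q\<in>carrier (free_algebra g). q \<oplus>\<^bsub>free_algebra g\<^esub> p = \<zero>\<^bsub>free_algebra g\<^esub>"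
      using keys_diff_subset[of 0 "lists g" p] by (intro bexI[of _ "- p"]) auto
  qed (simp_all add: add.assoc add.commute keys_add_subset)
  show "Group.monoid (free_algebra g)"
    by (rule monoidI) (simp_all add: keys_mult_lists mult.assoc zero_list_def)
qed (simp_all add: algebra_simps)

text \<open>The enveloping algebras of the whole Lie algebra and of the subalgebra used for
  Whittaker modules are both needed.\<close>

locale subalgebra =
  fixes g :: "lie set"
  assumes g_zero: "0 \<in> g" and g_add: "\<And>x y. x \<in> g \<Longrightarrow> y \<in> g \<Longrightarrow> x + y \<in> g"
    and g_scale: "\<And>c x. x \<in> g \<Longrightarrow> pm_scale c x \<in> g"
    and g_bracket: "\<And>x y. x \<in> g \<Longrightarrow> y \<in> g \<Longrightarrow> lie_bracket x y \<in> g"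
begin

abbreviation "Fg \<equiv> carrier (free_algebra g)"

lemma relators_carrier: "env_relators g \<subseteq> Fg"
proof
  fix r assume "r \<in> env_relators g"
  then show "r \<in> Fg" unfolding env_relators_def
    by (elim UnE CollectE exE conjE)
      (simp_all add: keys_diff_subset g_add g_scale g_bracket split: if_splits)
qed

lemma ideal_env_ideal: "ideal (env_ideal g) (free_algebra g)"
  unfolding env_ideal_def by (rule ring.genideal_ideal[OF ring_free_algebra relators_carrier])

interpretation I: ideal "env_ideal g" "free_algebra g"
  by (rule ideal_env_ideal)

lemma relators_env_ideal: "env_relators g \<subseteq> env_ideal g"
  unfolding env_ideal_def by (rule ring.genideal_self[OF ring_free_algebra relators_carrier])

lemma env_ideal_zero: "0 \<in> env_ideal g"
  using additive_subgroup.zero_closed[OF I.additive_subgroup_axioms] by simp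

lemma env_ideal_add: "p \<in> env_ideal g \<Longrightarrow> q \<in> env_ideal g \<Longrightarrow> p + q \<in> env_ideal g"
  using additive_subgroup.a_closed[OF I.additive_subgroup_axioms] by simp

lemma env_ideal_mult:
  "p \<in> env_ideal g \<Longrightarrow> u \<in> Fg \<Longrightarrow> u * p \<in> env_ideal g"
  "p \<in> env_ideal g \<Longrightarrow> u \<in> Fg \<Longrightarrow> p * u \<in> env_ideal g"
  using I.I_l_closed[of p u] I.I_r_closed[of p u] by simp_all

lemma env_simps:
  "carrier (env g) = env_class g ` Fg" "\<zero>\<^bsub>env g\<^esub> = env_class g 0"
  "p \<in> Fg \<Longrightarrow> q \<in> Fg \<Longrightarrow> env_class g p \<oplus>\<^bsub>env g\<^esub> env_class g q = env_class g (p + q)"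
  "p \<in> Fg \<Longrightarrow> q \<in> Fg \<Longrightarrow> env_class g p \<otimes>\<^bsub>env g\<^esub> env_class g q = env_class g (p * q)"
  using I.a_coset_add_zero[OF I.a_subset] I.a_rcos_sum[of p q] I.rcoset_mult_add[of p q]
  by (auto simp: env_def FactRing_def A_RCOSETS_def' env_class_def)

lemma a_minus_free: "p \<in> Fg \<Longrightarrow> q \<in> Fg \<Longrightarrow> p \<ominus>\<^bsub>free_algebra g\<^esub> q = p - q"
proof -
  assume p: "p \<in> Fg" and q: "q \<in> Fg"
  then have "- q \<in> Fg" using keys_diff_subset[of 0 "lists g" q] by simp
  then have "\<ominus>\<^bsub>free_algebra g\<^esub> q = - q"
    using I.minus_equality[of "- q" q] q by simp
  then show ?thesis by (simp add: a_minus_def)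
qed

lemma env_class_eq_iff: "p \<in> Fg \<Longrightarrow> q \<in> Fg \<Longrightarrow> env_class g p = env_class g q \<longleftrightarrow> p - q \<in> env_ideal g"
  using ring.quotient_eq_iff_same_a_r_cos[OF ring_free_algebra ideal_env_ideal, of p q]
  by (simp add: a_minus_free env_class_def)

lemma env_minus: "p \<in> Fg \<Longrightarrow> q \<in> Fg \<Longrightarrow> env_class g p \<ominus>\<^bsub>env g\<^esub> env_class g q = env_class g (p - q)"
proof -
  interpret env: ring "env g" unfolding env_def by (rule I.quotient_is_ring)
  assume p: "p \<in> Fg" and q: "q \<in> Fg"
  then have nq: "- q \<in> Fg" using keys_diff_subset[of 0 "lists g" q] by simp
  then have "\<ominus>\<^bsub>env g\<^esub> env_class g q = env_class g (- q)"
    using env.minus_equality[of "env_class g (- q)" "env_class g q"] q env_simps(3)[OF nq q] by (simp add: env_simps)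
  then show ?thesis using env_simps(3)[OF p nq] by (simp add: a_minus_def)
qed

lemma scalar_mult: "pm_scale c (word []) * p = pm_scale c p"
  by (simp only: word_Nil pm_scale_mult mult_1)

lemma presentation_env: "presentation (env_regular g) Fg Fg (env_class g) (*) (env_class g)"
proof (rule presentation.intro)
  show "c \<odot>\<^bsub>env_regular g\<^esub> env_class g p = env_class g (pm_scale c p)" if "p \<in> Fg" for c p
  proof -
    have "pm_scale c (word []) \<in> Fg" by (auto intro: keys_scale_subset)
    then show ?thesis using that by (simp only: env_regular_def module.simps env_scalar_eq env_simps scalar_mult)
  qed
  show "act (env_regular g) (env_class g r) (env_class g p) = env_class g (r * p)" if "r \<in> Fg" "p \<in> Fg" for r p
    using env_simps(4)[OF that] by (simp add: env_regular_def)
  show "env_class g p \<oplus>\<^bsub>env_regular g\<^esub> env_class g q = env_class g (p + q)" if "p \<in> Fg" "q \<in> Fg" for p q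
    using env_simps(3)[OF that] by (simp add: env_regular_def)
qed (simp_all add: env_regular_def env_simps(1,2) linear_mult_left keys_add_subset keys_scale_subset
    keys_mult_lists)

sublocale reg: presentation "env_regular g" Fg Fg "env_class g" "(*)" "env_class g"
  by (rule presentation_env)

lemma left_ideal_iff:
  "left_ideal J (env g) \<longleftrightarrow> reg.subspace J \<and> (\<forall>r\<in>carrier (env g). \<forall>v\<in>J. r \<otimes>\<^bsub>env g\<^esub> v \<in> J)"
proof -
  have monoids: "subgroup J (add_monoid (env g)) \<longleftrightarrow> subgroup J (add_monoid (env_regular g))"
    by (simp add: subgroup_def m_inv_def env_regular_def)
  have scalar: "env_scalar g c \<in> carrier (env g)" for c
    unfolding env_scalar_eq env_simps by (rule imageI) (auto intro: keys_scale_subset)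
  show ?thesis
    unfolding left_ideal_def additive_subgroup_def monoids reg.submodule_iff[symmetric] submodule_def submodule_axioms_def
    using scalar by (auto simp: env_regular_def)
qed

lemma left_ideal_left_ideal_gen: "A \<subseteq> carrier (env g) \<Longrightarrow> left_ideal (left_ideal_gen (env g) A) (env g)"
proof -
  assume A: "A \<subseteq> carrier (env g)"
  interpret env: ring "env g" unfolding env_def by (rule I.quotient_is_ring)
  have "left_ideal (carrier (env g)) (env g)"
    unfolding left_ideal_def additive_subgroup_def using env.add.subgroup_self env.m_closed by blast
  then show ?thesis
    using A unfolding left_ideal_gen_def hull_def left_ideal_iff reg.subspace_def
    by (auto simp: env_regular_def)
qed

text \<open>Left ideals of the free algebra give left ideals of the enveloping algebra. This is
  the means of bounding generated left ideals from above.\<close>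

lemma left_ideal_image:
  assumes "B \<subseteq> Fg" "0 \<in> B" "\<And>p q. p \<in> B \<Longrightarrow> q \<in> B \<Longrightarrow> p + q \<in> B" "\<And>c p. p \<in> B \<Longrightarrow> pm_scale c p \<in> B"
    "\<And>r p. r \<in> Fg \<Longrightarrow> p \<in> B \<Longrightarrow> r * p \<in> B"
  shows "left_ideal (env_class g ` B) (env g)"
proof -
  have BF: "p \<in> Fg" if "p \<in> B" for p using that assms(1) by blast
  have smult: "c \<odot>\<^bsub>env_regular g\<^esub> env_class g p \<in> env_class g ` B" if "p \<in> B" for c p
    using reg.smult_eq[OF BF[OF that]] assms(4)[OF that] by auto
  have add: "env_class g p \<oplus>\<^bsub>env_regular g\<^esub> env_class g q \<in> env_class g ` B" if "p \<in> B" "q \<in> B" for p q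
    using reg.add_eq[OF BF[OF that(1)] BF[OF that(2)]] assms(3)[OF that] by auto
  have mult: "env_class g r \<otimes>\<^bsub>env g\<^esub> env_class g p \<in> env_class g ` B" if "r \<in> Fg" "p \<in> B" for r p
    using env_simps(4)[OF that(1) BF[OF that(2)]] assms(5)[OF that] by auto
  show ?thesis
    unfolding left_ideal_iff reg.subspace_def reg.carrier_eq reg.zero_eq
    using assms(1,2) smult add mult by (auto simp: env_simps(1))
qed

end

interpretation L: subalgebra UNIV by unfold_locales auto

lemma positive_gens:
  "{E 0} \<union> {E i | i. i > 0} \<union> {F i | i. i > 0} \<union> {H i | i. i > 0} \<union> {D i | i. i > 0} = {a. degree a > 0}"
  (is "?L = ?R")
proof (intro equalityI subsetI)
  show "a \<in> ?L" if "a \<in> ?R" for a using that by (cases a) auto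
qed auto

text \<open>The degree is additive under brackets, so that this description makes closure under
  brackets evident.\<close>

lemma LplusC_eq: "LplusC = {x. Poly_Mapping.keys x \<subseteq> {a. degree a > 0 \<or> a = C}}"
proof -
  have Lplus: "Lplus = {x. Poly_Mapping.keys x \<subseteq> {a. degree a > 0}}"
    unfolding Lplus_def positive_gens ..
  show ?thesis
  proof (intro equalityI subsetI)
    fix x assume "x \<in> LplusC"
    then obtain y c where "x = y + pm_scale c (basis C)" "y \<in> Lplus" by (auto simp: LplusC_def)
    then show "x \<in> {x. Poly_Mapping.keys x \<subseteq> {a. degree a > 0 \<or> a = C}}"
      using keys_add[of y "pm_scale c (basis C)"] by (auto simp: Lplus split: if_splits)
  next
    fix x :: lie assume x: "x \<in> {x. Poly_Mapping.keys x \<subseteq> {a. degree a > 0 \<or> a = C}}"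
    let ?c = "Poly_Mapping.lookup x C"
    let ?y = "x - pm_scale ?c (basis C)"
    have "?y \<in> Lplus"
      using x by (auto simp: Lplus in_keys_iff lookup_minus lookup_single when_def split: if_splits)
    then have "?y + pm_scale ?c (basis C) \<in> LplusC" unfolding LplusC_def by blast
    then show "x \<in> LplusC" by simp
  qed
qed

lemma keys_sum_subset:
  "(\<And>a. a \<in> A \<Longrightarrow> Poly_Mapping.keys (f a :: 'a \<Rightarrow>\<^sub>0 complex) \<subseteq> B) \<Longrightarrow> Poly_Mapping.keys (sum f A) \<subseteq> B"
  by (induction A rule: infinite_finite_induct) (simp_all add: keys_add_subset)

lemma keys_lin_ext:
  "(\<And>a. a \<in> Poly_Mapping.keys p \<Longrightarrow> Poly_Mapping.keys (f a) \<subseteq> B)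
    \<Longrightarrow> Poly_Mapping.keys (lin_ext pm_scale f p) \<subseteq> B"
  unfolding lin_ext_def by (intro keys_sum_subset keys_scale_subset)

lemma keys_bracket:
  "(\<And>a b. a \<in> Poly_Mapping.keys x \<Longrightarrow> b \<in> Poly_Mapping.keys y \<Longrightarrow> Poly_Mapping.keys (gen_bracket a b) \<subseteq> B)
    \<Longrightarrow> Poly_Mapping.keys (lie_bracket x y) \<subseteq> B"
  unfolding lie_bracket_def by (intro keys_lin_ext)

interpretation P: subalgebra LplusC
proof
  show "lie_bracket x y \<in> LplusC" if "x \<in> LplusC" "y \<in> LplusC" for x y
    unfolding LplusC_eq
  proof (intro CollectI keys_bracket)
    fix a b assume "a \<in> Poly_Mapping.keys x" "b \<in> Poly_Mapping.keys y"
    then have "degree a > 0 \<or> a = C" "degree b > 0 \<or> b = C" using that unfolding LplusC_eq by blast+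
    then show "Poly_Mapping.keys (gen_bracket a b) \<subseteq> {a. degree a > 0 \<or> a = C}"
      by (cases a; cases b) (auto simp: in_keys_iff lookup_add lookup_single when_def split: if_splits)
  qed
qed (simp_all add: LplusC_eq keys_add_subset keys_scale_subset)

text \<open>The relators of the subalgebra are relators of the whole Lie algebra, and the ideal
  that they generate is computed inside a smaller free algebra. Hence inclusion induces a
  homomorphism of enveloping algebras.\<close>

lemma env_ideal_LplusC: "env_ideal LplusC \<subseteq> env_ideal UNIV"
proof -
  have uminus: "- p \<in> env_ideal UNIV" if "p \<in> env_ideal UNIV" for p
    using L.env_ideal_mult(1)[OF that, of "- 1"] by simp
  have uminusP: "Poly_Mapping.keys (- p) \<subseteq> lists LplusC" if "Poly_Mapping.keys p \<subseteq> lists LplusC" for p :: "lie list \<Rightarrow>\<^sub>0 complex"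
    using keys_scale_subset[OF that, of "-1"] by simp
  have "ideal (env_ideal UNIV \<inter> P.Fg) (free_algebra LplusC)"
  proof (rule idealI[OF ring_free_algebra])
    interpret ring "free_algebra LplusC" by (rule ring_free_algebra)
    show "subgroup (env_ideal UNIV \<inter> P.Fg) (add_monoid (free_algebra LplusC))"
    proof
      fix p assume p: "p \<in> env_ideal UNIV \<inter> P.Fg"
      have "inv\<^bsub>add_monoid (free_algebra LplusC)\<^esub> p = - p"
        using minus_equality[of "- p" p] p uminusP unfolding a_inv_def by simp
      then show "inv\<^bsub>add_monoid (free_algebra LplusC)\<^esub> p \<in> env_ideal UNIV \<inter> P.Fg"
        using p uminus uminusP by simp
    qed (simp_all add: keys_add_subset L.env_ideal_zero L.env_ideal_add)
  qed (simp_all add: keys_mult_lists L.env_ideal_mult)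
  moreover have "env_relators LplusC \<subseteq> env_relators UNIV"
    unfolding env_relators_def by blast
  ultimately have "env_ideal LplusC \<subseteq> env_ideal UNIV \<inter> P.Fg"
    unfolding env_ideal_def[of LplusC] using L.relators_env_ideal P.relators_carrier
    by (intro ring.genideal_minimal[OF ring_free_algebra]) blast+
  then show ?thesis by blast
qed

lemma env_incl_cl:
  assumes "p \<in> P.Fg"
  shows "env_incl (env_class LplusC p) = env_class UNIV p"
proof -
  have "0 \<in> env_ideal LplusC" by (rule P.env_ideal_zero)
  moreover have "k + l \<in> env_ideal UNIV" if "k \<in> env_ideal UNIV" "l \<in> env_ideal LplusC" for k l
    using L.env_ideal_add[of k l] that env_ideal_LplusC by auto
  ultimately show ?thesis
    unfolding env_incl_def env_class_def set_add_def' a_r_coset_def'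
    by (auto simp: add.assoc[symmetric])
qed

section \<open>Verma modules and their irreducible quotients\<close>

lemma L_Fg [simp]: "L.Fg = UNIV" by simp

context weight begin

text \<open>The generators of the left ideal that defines the Verma module, in terms of the
  grading.\<close>

definition hw_relators :: "(lie list \<Rightarrow>\<^sub>0 complex) set"
  where "hw_relators = {word [basis a] | a. degree a > 0} \<union>
    {word [basis a] - pm_scale (\<chi> a) (word []) | a. a \<in> {D 0, H 0, C}}"

definition hw_ideal :: "env_elt set"
  where "hw_ideal = left_ideal_gen (env UNIV) (env_class UNIV ` hw_relators)"

lemma verma_eq: "verma \<eta> \<epsilon> \<theta> = pullback (env_of UNIV) (quot_mod (env_regular UNIV) hw_ideal)"
proof -
  let ?u = "\<lambda>a. env_of UNIV (basis a)"
  have pos: "{?u (E 0)} \<union> {?u (E i) | i. i > 0} \<union> {?u (F i) | i. i > 0} \<union>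
      {?u (H i) | i. i > 0} \<union> {?u (D i) | i. i > 0} = env_class UNIV ` {word [basis a] | a. degree a > 0}"
    unfolding setcompr_eq_image[of _ "\<lambda>a. degree a > 0"] positive_gens[symmetric]
    by (auto simp: env_of_eq)
  have min: "?u a \<ominus>\<^bsub>env UNIV\<^esub> env_scalar UNIV c = env_class UNIV (word [basis a] - pm_scale c (word []))" for a c
    unfolding env_of_eq env_scalar_eq by (rule L.env_minus) auto
  have zero: "{?u (D 0) \<ominus>\<^bsub>env UNIV\<^esub> env_scalar UNIV \<eta>, ?u (H 0) \<ominus>\<^bsub>env UNIV\<^esub> env_scalar UNIV \<epsilon>,
      ?u C \<ominus>\<^bsub>env UNIV\<^esub> env_scalar UNIV \<theta>}
    = env_class UNIV ` {word [basis a] - pm_scale (\<chi> a) (word []) | a. a \<in> {D 0, H 0, C}}"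
    unfolding min setcompr_eq_image Collect_mem_eq by simp
  show ?thesis
    unfolding verma_def Let_def pos zero hw_ideal_def hw_relators_def image_Un ..
qed

lemma left_ideal_hw_ideal: "left_ideal hw_ideal (env UNIV)"
  unfolding hw_ideal_def by (rule L.left_ideal_left_ideal_gen) (auto simp: L.env_simps)

lemma hw_ideal: "L.reg.subspace hw_ideal"
  "r \<in> carrier (env UNIV) \<Longrightarrow> v \<in> hw_ideal \<Longrightarrow> r \<otimes>\<^bsub>env UNIV\<^esub> v \<in> hw_ideal"
  using left_ideal_hw_ideal by (simp_all add: L.left_ideal_iff)

text \<open>The annihilator in the free algebra of the generator of the Verma module; it is the
  kernel of the presentation.\<close>

definition Ann :: "(lie list \<Rightarrow>\<^sub>0 complex) set"
  where "Ann = {p. env_class UNIV p \<in> hw_ideal}"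

lemma Ann_zero: "0 \<in> Ann"
  using L.reg.K_zero[OF hw_ideal(1)] by (simp add: Ann_def)

lemma Ann_add: "p \<in> Ann \<Longrightarrow> q \<in> Ann \<Longrightarrow> p + q \<in> Ann"
  using L.reg.K_add[OF hw_ideal(1), of p q] by (simp add: Ann_def)

lemma Ann_scale: "p \<in> Ann \<Longrightarrow> pm_scale c p \<in> Ann"
  using L.reg.K_scale[OF hw_ideal(1), of p c] by (simp add: Ann_def)

lemma Ann_mult: "p \<in> Ann \<Longrightarrow> u * p \<in> Ann"
  using hw_ideal(2)[of "env_class UNIV u" "env_class UNIV p"] by (simp add: Ann_def L.env_simps)

lemma hw_relators_Ann: "p \<in> hw_relators \<Longrightarrow> p \<in> Ann"
  unfolding Ann_def hw_ideal_def left_ideal_gen_def by (simp add: hull_inc)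

lemma env_ideal_Ann: "p \<in> env_ideal UNIV \<Longrightarrow> p \<in> Ann"
  using L.env_class_eq_iff[of p 0] Ann_zero by (simp add: Ann_def)

lemma env_relators_Ann: "r \<in> env_relators UNIV \<Longrightarrow> r * p \<in> Ann"
  using L.relators_env_ideal by (intro env_ideal_Ann L.env_ideal_mult) auto

definition verma_pr :: "(lie list \<Rightarrow>\<^sub>0 complex) \<Rightarrow> env_elt set"
  where "verma_pr p = hw_ideal +>\<^bsub>env_regular UNIV\<^esub> env_class UNIV p"

lemma presentation_verma:
  "presentation (verma \<eta> \<epsilon> \<theta>) UNIV UNIV (\<lambda>x. x) (\<lambda>x p. word [x] * p) verma_pr"
proof -
  have "presentation (quot_mod (env_regular UNIV) hw_ideal) L.Fg L.Fg (env_class UNIV) (*) verma_pr"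
    unfolding verma_pr_def using hw_ideal
    by (intro L.reg.presentation_quot) (auto simp: env_regular_def L.env_simps(1))
  from presentation.presentation_pullback[OF this, of "env_of UNIV" "\<lambda>x. word [x]"]
  show ?thesis by (simp add: verma_eq env_of_eq)
qed

sublocale V: presentation "verma \<eta> \<epsilon> \<theta>" UNIV UNIV "\<lambda>x. x" "\<lambda>x p. word [x] * p" verma_pr
  by (rule presentation_verma)

lemma verma_pr_eq_iff: "verma_pr p = verma_pr q \<longleftrightarrow> p - q \<in> Ann"
  unfolding verma_pr_def Ann_def using L.reg.coset_eq_iff[OF hw_ideal(1), of p q] by simp

text \<open>The largest left ideal in the kernel of \<open>hw\<close>. It will turn out to be the
  annihilator of the generator in the irreducible quotient.\<close>

definition hw_null :: "(lie list \<Rightarrow>\<^sub>0 complex) set"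
  where "hw_null = {p. \<forall>u. hw (u * p) = 0}"

lemma hw_null_zero: "0 \<in> hw_null" by (simp add: hw_null_def hw.zero)

lemma hw_null_add: "p \<in> hw_null \<Longrightarrow> q \<in> hw_null \<Longrightarrow> p + q \<in> hw_null"
  by (simp add: hw_null_def distrib_left hw.add)

lemma hw_null_scale: "p \<in> hw_null \<Longrightarrow> pm_scale c p \<in> hw_null"
  by (simp add: hw_null_def pm_scale_mult hw.scale)

lemma hw_null_mult: "p \<in> hw_null \<Longrightarrow> u * p \<in> hw_null"
  by (simp add: hw_null_def flip: mult.assoc)

lemma hw_hw_null: "p \<in> hw_null \<Longrightarrow> hw p = 0"
  unfolding hw_null_def by (drule CollectD, drule spec[of _ 1]) simp

lemma env_ideal_hw_null: "env_ideal UNIV \<subseteq> hw_null"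
proof -
  let ?B = "{p. \<forall>u w. hw (u * p * w) = 0}"
  interpret ring "free_algebra UNIV" by (rule ring_free_algebra)
  have "ideal ?B (free_algebra UNIV)"
  proof (rule idealI[OF ring_free_algebra])
    show "subgroup ?B (add_monoid (free_algebra UNIV))"
    proof
      fix p assume p: "p \<in> ?B"
      have "inv\<^bsub>add_monoid (free_algebra UNIV)\<^esub> p = - p"
        using minus_equality[of "- p" p] unfolding a_inv_def by simp
      then show "inv\<^bsub>add_monoid (free_algebra UNIV)\<^esub> p \<in> ?B" using p by (simp add: hw.neg)
    qed (simp_all add: distrib_left distrib_right hw.add hw.zero)
  next
    fix a x assume a: "a \<in> ?B"
    have "hw (u * (x * a) * w) = hw ((u * x) * a * w)" for u w by (simp add: mult.assoc)
    then show "x \<otimes>\<^bsub>free_algebra UNIV\<^esub> a \<in> ?B" using a by simp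
    have "hw (u * (a * x) * w) = hw (u * a * (x * w))" for u w by (simp add: mult.assoc)
    then show "a \<otimes>\<^bsub>free_algebra UNIV\<^esub> x \<in> ?B" using a by simp
  qed
  moreover have "env_relators UNIV \<subseteq> ?B" using hw_env_relators by blast
  ultimately have "env_ideal UNIV \<subseteq> ?B"
    unfolding env_ideal_def by (rule genideal_minimal)
  moreover have "?B \<subseteq> hw_null"
  proof
    fix p assume "p \<in> ?B"
    then have "hw (u * p * 1) = 0" for u by blast
    then show "p \<in> hw_null" by (simp add: hw_null_def)
  qed
  ultimately show ?thesis by blast
qed

text \<open>The relators of the Verma module are killed by \<open>hw\<close> even after
  multiplication from the left, because \<open>hw\<close> multiplies a factor from the Borel
  subalgebra on the right by its value under \<open>\<chi>\<close>. As \<open>hw 1 = 1\<close>,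
  this is the proof that Verma modules do not vanish.\<close>

lemma Ann_hw_null: "Ann \<subseteq> hw_null"
proof
  fix p assume p: "p \<in> Ann"
  have "left_ideal (env_class UNIV ` hw_null) (env UNIV)"
    by (rule L.left_ideal_image) (auto simp: hw_null_zero hw_null_add hw_null_scale hw_null_mult)
  moreover have "hw_relators \<subseteq> hw_null"
  proof
    fix r assume "r \<in> hw_relators"
    then consider a where "degree a > 0" "r = word [basis a]"
      | a where "a \<in> {D 0, H 0, C}" "r = word [basis a] - pm_scale (\<chi> a) (word [])"
      unfolding hw_relators_def by blast
    then show "r \<in> hw_null"
    proof cases
      case (1 a)
      then have "\<chi> a = 0" by (cases a) auto
      then show ?thesis using 1 by (simp add: hw_null_def hw_borel)
    next
      case (2 a)
      then have "degree a \<ge> 0" by auto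
      then show ?thesis unfolding hw_null_def 2 word_Nil
        by (simp add: hw_borel right_diff_distrib hw.diff pm_scale_mult hw.scale del: pm_scale_single)
    qed
  qed
  ultimately have "hw_ideal \<subseteq> env_class UNIV ` hw_null"
    unfolding hw_ideal_def left_ideal_gen_def by (intro hull_minimal image_mono)
  then obtain q where q: "q \<in> hw_null" "env_class UNIV p = env_class UNIV q" using p unfolding Ann_def by blast
  then have "p - q \<in> hw_null" using L.env_class_eq_iff[of p q] env_ideal_hw_null by auto
  from hw_null_add[OF this q(1)] show "p \<in> hw_null" by simp
qed

lemma hw_Ann: "p \<in> Ann \<Longrightarrow> hw p = 0" using Ann_hw_null hw_hw_null by blast

section \<open>Straightening\<close>

lemma word_Cons: "word (x # w) = word [x] * word w" by (simp add: word_mult)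

lemma commute_Ann: "word [x] * word [y] * p - word [y] * word [x] * p - word [lie_bracket x y] * p \<in> Ann"
proof -
  have "word [x, y] - word [y, x] - word [lie_bracket x y] \<in> env_relators UNIV"
    unfolding env_relators_def by blast
  from env_relators_Ann[OF this, of p] show ?thesis
    by (simp add: word_mult left_diff_distrib)
qed

lemma add_Ann: "word [x + y] * p - word [x] * p - word [y] * p \<in> Ann"
proof -
  have "word [x + y] - word [x] - word [y] \<in> env_relators UNIV"
    unfolding env_relators_def by blast
  from env_relators_Ann[OF this, of p] show ?thesis by (simp add: left_diff_distrib)
qed

lemma scale_Ann: "word [pm_scale c x] * p - pm_scale c (word [x] * p) \<in> Ann"
proof -
  have "word [pm_scale c x] - pm_scale c (word [x]) \<in> env_relators UNIV"
    unfolding env_relators_def by blast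
  from env_relators_Ann[OF this, of p] show ?thesis
    by (simp add: left_diff_distrib pm_scale_mult del: pm_scale_single)
qed

text \<open>The span of the words in lowering generators modulo the annihilator. Its induction
  rule extends to the span what holds for such words.\<close>

inductive neg_span :: "(lie list \<Rightarrow>\<^sub>0 complex) \<Rightarrow> bool" where
  Ann: "p \<in> Ann \<Longrightarrow> neg_span p"
| neg_word: "\<forall>a\<in>set ys. degree a < 0 \<Longrightarrow> neg_span (pm_scale c (word (map basis ys)))"
| add: "neg_span p \<Longrightarrow> neg_span q \<Longrightarrow> neg_span (p + q)"

lemma neg_span_scale: "neg_span p \<Longrightarrow> neg_span (pm_scale c p)"
proof (induction rule: neg_span.induct)
  case (neg_word ys d)
  then show ?case using neg_span.neg_word[of ys "c * d"] by simp
qed (simp_all add: Ann_scale pm.scale_right_distrib neg_span.intros)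

lemma neg_span_negative: "neg_span p \<Longrightarrow> degree a < 0 \<Longrightarrow> neg_span (word [basis a] * p)"
proof (induction rule: neg_span.induct)
  case (neg_word ys c)
  then show ?case using neg_span.neg_word[of "a # ys" c]
    by (simp add: pm_scale_mult word_mult del: pm_scale_single)
qed (simp_all add: Ann_mult distrib_left neg_span.intros)

lemma neg_span_linear:
  assumes "\<And>a. neg_span (word [basis a] * p)"
  shows "neg_span (word [z] * p)"
proof (induction z rule: poly_mapping_add_induct)
  case zero
  have "word [0] * p \<in> Ann" using scale_Ann[of 0 0 p] by simp
  then show ?case by (rule neg_span.Ann)
next
  case (add x y)
  from neg_span.add[OF neg_span.add[OF neg_span.Ann[OF add_Ann[of x y p]] add(1)] add(2)]
  show ?case by simp
next
  case (single a c)
  from neg_span.add[OF neg_span.Ann[OF scale_Ann[of c "basis a" p]] neg_span_scale[OF assms[of a], of c]]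
  show ?case by simp
qed

text \<open>Straightening, by induction on the length: a nonnegative generator is commuted to the
  right past the first letter, and both the commuted product and the bracket multiply a shorter
  word.\<close>

lemma neg_span_gen_word:
  "\<forall>a\<in>set ys. degree a < 0 \<Longrightarrow> neg_span (word [basis a] * word (map basis ys))"
proof (induction ys arbitrary: a)
  case Nil
  consider "degree a < 0" | "degree a > 0" | "a \<in> {D 0, H 0, C}"
    by (cases a; cases "degree a > 0"; cases "degree a < 0") (auto, presburger+)
  then show ?case
  proof cases
    case 1
    then show ?thesis using neg_span.neg_word[of "[a]" 1] by (simp add: word_Nil)
  next
    case 2
    then show ?thesis by (intro neg_span.Ann) (auto simp: word_Nil hw_relators_def intro!: hw_relators_Ann)
  next
    case 3
    then have "word [basis a] - pm_scale (\<chi> a) (word []) \<in> Ann"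
      by (intro hw_relators_Ann) (auto simp: hw_relators_def)
    from neg_span.add[OF neg_span.Ann[OF this] neg_span.neg_word[of "[]" "\<chi> a"]]
    show ?thesis by (simp add: word_Nil)
  qed
next
  case (Cons y ys)
  let ?w = "word (map basis ys)"
  show ?case
  proof (cases "degree a < 0")
    case True
    then show ?thesis using neg_span.neg_word[of "a # y # ys" 1] Cons.prems by (simp add: word_mult)
  next
    case False
    have neg: "degree y < 0" "\<forall>a\<in>set ys. degree a < 0" using Cons.prems by auto
    note IH = Cons.IH[OF neg(2)]
    from neg_span.add[OF neg_span.add[OF neg_span.Ann[OF commute_Ann[of "basis a" "basis y" ?w]]
          neg_span_negative[OF IH[of a] neg(1)]] neg_span_linear[OF IH, of "lie_bracket (basis a) (basis y)"]]
    show ?thesis by (simp add: word_mult mult.assoc)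
  qed
qed

lemma neg_span_mult: "neg_span p \<Longrightarrow> neg_span (word [x] * p)"
proof (induction rule: neg_span.induct)
  case (neg_word ys c)
  then have "neg_span (pm_scale c (word [x] * word (map basis ys)))"
    by (rule neg_span_scale[OF neg_span_linear[OF neg_span_gen_word]])
  then show ?case by (simp only: pm_scale_mult)
qed (simp_all add: Ann_mult distrib_left neg_span.intros)

lemma neg_span_all: "neg_span p"
proof (induction p rule: poly_mapping_add_induct)
  case zero
  then show ?case by (rule neg_span.Ann[OF Ann_zero])
next
  case (single w c)
  have "neg_span (word w)"
  proof (induction w)
    case Nil
    then show ?case using neg_span.neg_word[of "[]" 1] by simp
  next
    case (Cons x w)
    then show ?case unfolding word_Cons[of x w] by (rule neg_span_mult)
  qed
  from neg_span_scale[OF this, of c] show ?case by simp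
qed (rule neg_span.add)

text \<open>Moving \<open>x\<close> past a letter costs the weight of that letter.\<close>

lemma eigen_neg_word:
  assumes wt: "\<And>a. lie_bracket x (basis a) = pm_scale (wt a) (basis a)"
    and top: "word [x] - pm_scale k 1 \<in> Ann"
  shows "word [x] * word (map basis ys) - pm_scale (k + sum_list (map wt ys)) (word (map basis ys)) \<in> Ann"
proof (induction ys)
  case Nil
  then show ?case using top by (simp add: word_Nil)
next
  case (Cons y ys)
  let ?w = "word (map basis ys)"
  let ?k = "k + sum_list (map wt ys)"
  have "(word [x] * word [basis y] * ?w - word [basis y] * word [x] * ?w - word [lie_bracket x (basis y)] * ?w)
     + word [basis y] * (word [x] * ?w - pm_scale ?k ?w)
     + (word [pm_scale (wt y) (basis y)] * ?w - pm_scale (wt y) (word [basis y] * ?w)) \<in> Ann" (is "?l \<in> _")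
    by (intro Ann_add commute_Ann scale_Ann Ann_mult Cons)
  moreover have "?l = word [x] * (word [basis y] * ?w) - pm_scale (?k + wt y) (word [basis y] * ?w)"
    unfolding wt pm_scale_mult right_diff_distrib pm.scale_left_distrib by (simp only: mult.assoc) (simp add: distrib_left pm_scale_mult del: pm_scale_single)
  moreover have "word (map basis (y # ys)) = word [basis y] * ?w" by (simp add: word_mult)
  moreover have "k + sum_list (map wt (y # ys)) = ?k + wt y" by simp
  ultimately show ?case by (simp only:)
qed

section \<open>Isolating the highest weight vector\<close>

lemma cartan_Ann: "a \<in> {D 0, H 0, C} \<Longrightarrow> word [basis a] - pm_scale (\<chi> a) 1 \<in> Ann"
  unfolding word_Nil[symmetric] by (rule hw_relators_Ann) (unfold hw_relators_def, blast)

text \<open>The Cartan subalgebra acts by scalars on words in lowering generators, and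
  \<open>hw\<close> is nonzero only on the empty one.\<close>

lemma hw_cartan:
  assumes "a \<in> {D 0, H 0, C}"
  shows "hw (word [basis a] * p) = \<chi> a * hw p"
  using neg_span_all[of p]
proof (induction rule: neg_span.induct)
  case (Ann p)
  then show ?case using hw_Ann Ann_mult by simp
next
  case (neg_word ys c)
  define wt :: "gen \<Rightarrow> complex" where "wt b = (case a of D _ \<Rightarrow> (case b of E j \<Rightarrow> of_int j | F j \<Rightarrow> of_int j | H j \<Rightarrow> of_int j | D j \<Rightarrow> of_int j | C \<Rightarrow> 0)
     | H _ \<Rightarrow> (case b of E j \<Rightarrow> 2 | F j \<Rightarrow> - 2 | _ \<Rightarrow> 0) | _ \<Rightarrow> 0)" for b
  have "lie_bracket (basis a) (basis b) = pm_scale (wt b) (basis b)" for b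
    using assms by (cases b) (auto simp: bracket_single wt_def)
  moreover have "word [basis a] - pm_scale (\<chi> a) 1 \<in> Ann"
    using assms by (rule cartan_Ann)
  ultimately have eq: "hw (word [basis a] * word (map basis ys)) = (\<chi> a + sum_list (map wt ys)) * hw (word (map basis ys))"
    using hw_Ann[OF eigen_neg_word] by (simp add: hw.diff hw.scale del: pm_scale_single)
  show ?case
  proof (cases ys)
    case Nil
    then show ?thesis using eq by (simp add: hw.scale pm_scale_mult del: pm_scale_single)
  next
    case (Cons b bs)
    then have "word (map basis ys) = word [basis b] * word (map basis bs)" by (simp add: word_mult)
    then have "hw (word (map basis ys)) = 0" using hw_negative neg_word Cons by simp
    then show ?thesis using eq by (simp add: hw.scale pm_scale_mult del: pm_scale_single)
  qed
qed (simp add: distrib_left hw.add)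

text \<open>The element that induces the principal grading.\<close>

definition \<rho> :: lie where "\<rho> = pm_scale 2 (basis (D 0)) + pm_scale (1/2) (basis (H 0))"

lemma bracket_\<rho>: "lie_bracket \<rho> (basis a) = pm_scale (of_int (degree a)) (basis a)"
  by (cases a) (auto simp: \<rho>_def bracket_simps bracket_single simp flip: single_add)

definition rho_top :: complex where "rho_top = 2 * \<eta> + \<epsilon> / 2"

lemma top_Ann: "word [\<rho>] - pm_scale rho_top 1 \<in> Ann"
proof -
  have D: "word [basis (D 0)] - pm_scale \<eta> 1 \<in> Ann" and H: "word [basis (H 0)] - pm_scale \<epsilon> 1 \<in> Ann"
    using cartan_Ann[of "D 0"] cartan_Ann[of "H 0"] by simp_all
  have "(word [\<rho>] * 1 - word [pm_scale 2 (basis (D 0))] * 1 - word [pm_scale (1/2) (basis (H 0))] * 1)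
    + (word [pm_scale 2 (basis (D 0))] * 1 - pm_scale 2 (word [basis (D 0)] * 1))
    + (word [pm_scale (1/2) (basis (H 0))] * 1 - pm_scale (1/2) (word [basis (H 0)] * 1))
    + pm_scale 2 (word [basis (D 0)] - pm_scale \<eta> 1) + pm_scale (1/2) (word [basis (H 0)] - pm_scale \<epsilon> 1) \<in> Ann"
    (is "?l \<in> _")
    unfolding \<rho>_def by (intro Ann_add add_Ann scale_Ann Ann_scale D H)
  moreover have "?l = word [\<rho>] - pm_scale rho_top 1"
    by (simp add: rho_top_def pm.scale_right_diff_distrib pm.scale_left_distrib del: pm_scale_single)
  ultimately show ?thesis by (simp only:)
qed

text \<open>On vectors whose principal weight lies \<open>n\<close> below the top this acts as
  zero, on the highest weight vector it acts as the scalar \<open>n\<close>.\<close>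

definition rho_factor :: "int \<Rightarrow> (lie list \<Rightarrow>\<^sub>0 complex)"
  where "rho_factor n = word [\<rho>] - pm_scale (rho_top - of_int n) 1"

abbreviation "rho_factors ns \<equiv> prod_list (map rho_factor ns)"

lemma rho_factor_commute: "rho_factor m * rho_factor n = rho_factor n * rho_factor m"
  by (simp add: rho_factor_def left_diff_distrib right_diff_distrib pm_scale_mult
      pm.scale_right_diff_distrib mult.commute del: pm_scale_single)

lemma rho_factor_factors_commute: "rho_factor m * rho_factors ns = rho_factors ns * rho_factor m"
proof (induction ns)
  case (Cons n ns)
  have "rho_factor m * rho_factors (n # ns) = rho_factor n * (rho_factor m * rho_factors ns)"
    using rho_factor_commute[of m n] by (simp flip: mult.assoc)
  then show ?case unfolding Cons by (simp add: mult.assoc)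
qed simp

lemma rho_factors_commute: "rho_factors ms * rho_factors ns = rho_factors ns * rho_factors ms"
proof (induction ms)
  case (Cons m ms)
  have "rho_factors (m # ms) * rho_factors ns = rho_factor m * rho_factors ns * rho_factors ms"
    using Cons by (simp add: mult.assoc)
  then show ?case unfolding rho_factor_factors_commute by (simp add: mult.assoc)
qed simp

lemma rho_factors_top: "rho_factors ns - pm_scale (of_int (prod_list ns)) 1 \<in> Ann"
proof (induction ns)
  case Nil
  then show ?case by (simp add: Ann_zero)
next
  case (Cons n ns)
  have "rho_factor n * (rho_factors ns - pm_scale (of_int (prod_list ns)) 1) + pm_scale (of_int (prod_list ns)) (word [\<rho>] - pm_scale rho_top 1) \<in> Ann" (is "?l \<in> _")
    by (intro Ann_add Ann_mult Cons Ann_scale top_Ann)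
  moreover have "?l = rho_factors (n # ns) - pm_scale (of_int (prod_list (n # ns))) 1"
    by (simp add: rho_factor_def right_diff_distrib left_diff_distrib pm_scale_mult pm.scale_right_diff_distrib
       pm.scale_left_diff_distrib mult.commute algebra_simps)
  ultimately show ?case by simp
qed

text \<open>Each vector is a multiple of the highest weight vector plus vectors of lower principal
  weight. Suitable factors remove the latter one after the other, without removing the former;
  they commute, so that the factors needed for two summands can be combined.\<close>

lemma isolate_top:
  "\<exists>ns. (\<forall>n\<in>set ns. n \<noteq> 0) \<and> rho_factors ns * p - pm_scale (of_int (prod_list ns) * hw p) 1 \<in> Ann"
  using neg_span_all[of p]
proof (induction rule: neg_span.induct)
  case (Ann p)
  then show ?case using hw_Ann by (intro exI[of _ "[]"]) simp
next
  case (neg_word ys c)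
  show ?case
  proof (cases ys)
    case Nil
    then show ?thesis
      by (intro exI[of _ "[]"]) (simp add: word_Nil hw.scale hw_one Ann_zero del: pm_scale_single)
  next
    case (Cons b bs)
    let ?w = "word (map basis ys)"
    \<comment> \<open>A nonempty word in lowering generators lies this far below the top.\<close>
    let ?n = "- sum_list (map degree ys)"
    have "sum_list (map degree zs) \<le> 0" if "\<forall>a\<in>set zs. degree a < 0" for zs
      using that by (induction zs) auto
    then have n: "?n \<noteq> 0" using neg_word Cons by (auto simp: add_nonneg_eq_0_iff) (smt (verit))
    have "word (map basis ys) = word [basis b] * word (map basis bs)" using Cons by (simp add: word_mult)
    then have "hw ?w = 0" using hw_negative neg_word Cons by simp
    moreover have "sum_list (map (\<lambda>a. complex_of_int (degree a)) zs) = of_int (sum_list (map degree zs))" for zs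
      by (induction zs) simp_all
    then have "word [\<rho>] * ?w - pm_scale (rho_top - of_int ?n) ?w \<in> Ann"
      using eigen_neg_word[OF bracket_\<rho> top_Ann, of ys] by simp
    then have "rho_factors [?n] * pm_scale c ?w \<in> Ann"
      using Ann_scale[of "word [\<rho>] * ?w - pm_scale (rho_top - of_int ?n) ?w" c]
      by (simp add: rho_factor_def pm_scale_mult left_diff_distrib pm.scale_right_diff_distrib del: pm_scale_single)
    ultimately show ?thesis using n
      by (intro exI[of _ "[?n]"]) (simp add: hw.scale del: pm_scale_single)
  qed
next
  case (add p q)
  then obtain ms ns where ms: "\<forall>n\<in>set ms. n \<noteq> 0" "rho_factors ms * p - pm_scale (of_int (prod_list ms) * hw p) 1 \<in> Ann"
    and ns: "\<forall>n\<in>set ns. n \<noteq> 0" "rho_factors ns * q - pm_scale (of_int (prod_list ns) * hw q) 1 \<in> Ann"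
    by blast
  let ?cp = "of_int (prod_list ms) * hw p" and ?cq = "of_int (prod_list ns) * hw q"
  have "rho_factors ns * (rho_factors ms * p - pm_scale ?cp 1) + pm_scale ?cp (rho_factors ns - pm_scale (of_int (prod_list ns)) 1)
    + (rho_factors ms * (rho_factors ns * q - pm_scale ?cq 1) + pm_scale ?cq (rho_factors ms - pm_scale (of_int (prod_list ms)) 1)) \<in> Ann"
    (is "?l \<in> _")
    by (intro Ann_add Ann_mult Ann_scale rho_factors_top ms ns)
  moreover have "?l = rho_factors (ms @ ns) * (p + q) - pm_scale (of_int (prod_list (ms @ ns)) * hw (p + q)) 1"
  proof -
    have "rho_factors ns * (rho_factors ms * p) = rho_factors (ms @ ns) * p"
      using rho_factors_commute[of ns ms] by (simp flip: mult.assoc)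
    moreover have "rho_factors ms * (rho_factors ns * q) = rho_factors (ms @ ns) * q"
      by (simp flip: mult.assoc)
    ultimately have "?l = rho_factors (ms @ ns) * p - pm_scale (?cp * of_int (prod_list ns)) 1
      + (rho_factors (ms @ ns) * q - pm_scale (?cq * of_int (prod_list ms)) 1)"
      by (simp only: right_diff_distrib pm_scale_mult pm.scale_right_diff_distrib pm.scale_scale mult_1_right) simp
    also have "\<dots> = rho_factors (ms @ ns) * (p + q) - pm_scale (?cp * of_int (prod_list ns) + ?cq * of_int (prod_list ms)) 1"
      by (simp only: distrib_left pm.scale_left_distrib) simp
    also have "?cp * of_int (prod_list ns) + ?cq * of_int (prod_list ms) = of_int (prod_list (ms @ ns)) * hw (p + q)"
      by (simp only: hw.add prod_list.append of_int_mult) (simp only: distrib_left ac_simps)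
    finally show ?thesis .
  qed
  ultimately have "rho_factors (ms @ ns) * (p + q) - pm_scale (of_int (prod_list (ms @ ns)) * hw (p + q)) 1 \<in> Ann"
    by (simp only:)
  moreover have "\<forall>n\<in>set (ms @ ns). n \<noteq> 0" using ms(1) ns(1) by auto
  ultimately show ?case by blast
qed

section \<open>The maximal submodule\<close>

text \<open>The vectors whose whole orbit has no component along the highest weight
  vector.\<close>

definition max_sub :: "env_elt set set"
  where "max_sub = verma_pr ` hw_null"

lemma verma_pr_max_sub: "verma_pr p \<in> max_sub \<longleftrightarrow> p \<in> hw_null"
proof
  assume "verma_pr p \<in> max_sub"
  then obtain q where q: "q \<in> hw_null" "p - q \<in> Ann" unfolding max_sub_def by (auto simp: verma_pr_eq_iff)
  then show "p \<in> hw_null" using hw_null_add[of "p - q" q] Ann_hw_null by auto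
qed (simp add: max_sub_def)

lemma lie_submodule_iff:
  "lie_submodule K (verma \<eta> \<epsilon> \<theta>) \<longleftrightarrow> V.subspace K \<and> (\<forall>x. \<forall>v\<in>K. act (verma \<eta> \<epsilon> \<theta>) x v \<in> K)"
  by (simp add: lie_submodule_def V.submodule_iff)

lemma lie_submodule_max_sub: "lie_submodule max_sub (verma \<eta> \<epsilon> \<theta>)"
  unfolding lie_submodule_iff V.subspace_def max_sub_def
  using V.carrier_eq V.zero_eq
  by (auto simp: V.add_eq V.smult_eq V.act_eq hw_null_zero hw_null_add hw_null_scale hw_null_mult intro!: imageI)

text \<open>A submodule that is not contained in \<open>max_sub\<close> contains a vector with a
  component along the highest weight vector. By \<open>isolate_top\<close> it then contains the
  highest weight vector itself, which generates the Verma module.\<close>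

lemma submodule_le_max_sub:
  assumes K: "lie_submodule K (verma \<eta> \<epsilon> \<theta>)" and proper: "K \<noteq> carrier (verma \<eta> \<epsilon> \<theta>)"
  shows "K \<subseteq> max_sub"
proof (rule ccontr)
  assume "\<not> K \<subseteq> max_sub"
  have stable: "verma_pr (word [x] * p) \<in> K" if "verma_pr p \<in> K" for x p
  proof -
    have "act (verma \<eta> \<epsilon> \<theta>) x (verma_pr p) \<in> K" using K that by (simp add: lie_submodule_iff)
    then show ?thesis using V.act_eq[of x p] by simp
  qed
  have sub: "V.subspace K" using K by (simp add: lie_submodule_iff)
  have mult: "verma_pr (u * p) \<in> K" if p: "verma_pr p \<in> K" for u p
  proof (induction u rule: poly_mapping_add_induct)
    case zero
    then show ?case using V.K_zero[OF sub] by simp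
  next
    case (add u v)
    then show ?case using V.K_add[OF sub, of "u * p" "v * p"] by (simp add: distrib_right)
  next
    case (single w c)
    have "verma_pr (word w * p) \<in> K"
    proof (induction w)
      case Nil
      then show ?case using p by (simp add: word_Nil)
    next
      case (Cons x w)
      then show ?case using stable[of "word w * p" x] by (simp add: word_mult flip: mult.assoc)
    qed
    from V.K_scale[OF sub _ this, of c] show ?case
      by (simp flip: pm_scale_mult(1))
  qed
  obtain v where v: "v \<in> K" "v \<notin> max_sub" using \<open>\<not> K \<subseteq> max_sub\<close> by blast
  then obtain p where p: "v = verma_pr p" using sub by (auto simp: V.subspace_def V.carrier_eq)
  with v have "verma_pr p \<in> K" "p \<notin> hw_null" by (simp_all add: verma_pr_max_sub)
  then obtain u where u: "hw (u * p) \<noteq> 0" "verma_pr (u * p) \<in> K"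
    using mult by (auto simp: hw_null_def)
  obtain ns where ns: "\<forall>n\<in>set ns. n \<noteq> 0"
    "rho_factors ns * (u * p) - pm_scale (of_int (prod_list ns) * hw (u * p)) 1 \<in> Ann"
    using isolate_top by blast
  define c where "c = of_int (prod_list ns) * hw (u * p)"
  have "c \<noteq> 0" using ns(1) u(1) by (auto simp: c_def prod_list_zero_iff)
  have "verma_pr (pm_scale c 1) \<in> K"
    using mult[OF u(2), of "rho_factors ns"] ns(2) unfolding verma_pr_eq_iff[symmetric] c_def by simp
  from V.K_scale[OF sub _ this, of "1 / c"] have "verma_pr 1 \<in> K"
    using \<open>c \<noteq> 0\<close> by simp
  from mult[OF this] have "carrier (verma \<eta> \<epsilon> \<theta>) \<subseteq> K" by (auto simp: V.carrier_eq)
  with proper sub show False by (auto simp: V.subspace_def)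
qed

lemma maximal_submodule_iff: "maximal_submodule J (verma \<eta> \<epsilon> \<theta>) \<longleftrightarrow> J = max_sub"
proof -
  have "verma_pr 1 \<notin> max_sub" using hw_hw_null[of 1] hw_one by (auto simp: verma_pr_max_sub)
  then have "max_sub \<noteq> carrier (verma \<eta> \<epsilon> \<theta>)" by (auto simp: V.carrier_eq)
  then show ?thesis
    using lie_submodule_max_sub submodule_le_max_sub unfolding maximal_submodule_def by blast
qed

definition irr_pr :: "(lie list \<Rightarrow>\<^sub>0 complex) \<Rightarrow> env_elt set set"
  where "irr_pr p = max_sub +>\<^bsub>verma \<eta> \<epsilon> \<theta>\<^esub> verma_pr p"

lemma presentation_irr:
  "presentation (irr_hw \<eta> \<epsilon> \<theta>) UNIV UNIV (\<lambda>x. x) (\<lambda>x p. word [x] * p) irr_pr"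
proof -
  have "irr_hw \<eta> \<epsilon> \<theta> = quot_mod (verma \<eta> \<epsilon> \<theta>) max_sub"
    unfolding irr_hw_def maximal_submodule_iff by simp
  then show ?thesis
    unfolding irr_pr_def using lie_submodule_max_sub
    by (simp add: V.presentation_quot lie_submodule_iff)
qed

lemma irr_pr_eq_iff: "irr_pr p = irr_pr q \<longleftrightarrow> p - q \<in> hw_null"
  using lie_submodule_max_sub V.coset_eq_iff[of max_sub p q]
  by (simp add: irr_pr_def lie_submodule_iff verma_pr_max_sub)

text \<open>The coordinate \<open>\<psi>\<close> along the highest weight vector \<open>v\<close>.
  For generators of degree at most zero it is an eigenfunctional: lowering generators never reach
  the top, and the Cartan subalgebra acts on the top by \<open>\<chi>\<close>. The last property
  says that \<open>v\<close> is a highest weight vector as far as \<open>\<psi>\<close> can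
  see.\<close>

lemma irr_functional:
  obtains v \<psi> where "v \<in> carrier (irr_hw \<eta> \<epsilon> \<theta>)" "\<psi> v = 1"
    "\<And>x y. x \<in> carrier (irr_hw \<eta> \<epsilon> \<theta>) \<Longrightarrow> y \<in> carrier (irr_hw \<eta> \<epsilon> \<theta>) \<Longrightarrow>
      \<psi> (x \<oplus>\<^bsub>irr_hw \<eta> \<epsilon> \<theta>\<^esub> y) = \<psi> x + \<psi> y"
    "\<And>c x. x \<in> carrier (irr_hw \<eta> \<epsilon> \<theta>) \<Longrightarrow> \<psi> (c \<odot>\<^bsub>irr_hw \<eta> \<epsilon> \<theta>\<^esub> x) = c * \<psi> x"
    "\<And>a x. degree a \<le> 0 \<Longrightarrow> x \<in> carrier (irr_hw \<eta> \<epsilon> \<theta>) \<Longrightarrow>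
      \<psi> (act (irr_hw \<eta> \<epsilon> \<theta>) (basis a) x) = \<chi> a * \<psi> x"
    "\<And>a. degree a \<ge> 0 \<Longrightarrow> \<psi> (act (irr_hw \<eta> \<epsilon> \<theta>) (basis a) v) = \<chi> a"
proof -
  interpret W: presentation "irr_hw \<eta> \<epsilon> \<theta>" UNIV UNIV "\<lambda>x. x" "\<lambda>x p. word [x] * p" irr_pr
    by (rule presentation_irr)
  define \<psi> where "\<psi> w = hw (SOME p. irr_pr p = w)" for w
  have psi: "\<psi> (irr_pr p) = hw p" for p
  proof -
    have "irr_pr (SOME q. irr_pr q = irr_pr p) = irr_pr p" by (rule someI) simp
    then have "hw ((SOME q. irr_pr q = irr_pr p) - p) = 0" using irr_pr_eq_iff hw_hw_null by blast
    then show ?thesis by (simp add: \<psi>_def hw.diff)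
  qed
  have low: "hw (word [basis a] * p) = \<chi> a * hw p" if "degree a \<le> 0" for a p
  proof (cases "degree a < 0")
    case True
    then have "\<chi> a = 0" by (cases a) auto
    then show ?thesis using hw_negative[OF True] by simp
  next
    case False
    then have "a \<in> {D 0, H 0, C}" using that by (cases a) (auto, presburger+)
    then show ?thesis by (rule hw_cartan)
  qed
  show ?thesis
  proof (rule that[of "irr_pr 1" \<psi>])
    show "\<psi> (act (irr_hw \<eta> \<epsilon> \<theta>) (basis a) (irr_pr 1)) = \<chi> a" if "degree a \<ge> 0" for a
      using hw_borel[OF that, of 1] by (simp add: W.act_eq psi hw_one)
  qed (auto simp: W.carrier_eq W.add_eq W.smult_eq W.act_eq psi hw_one hw.add hw.scale low)
qed

end

section \<open>Tensor products\<close>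

context presentation begin

lemma subspace_gen_eq: "subspace_gen N A = \<Inter>{K. subspace K \<and> A \<subseteq> K}"
  by (simp add: subspace_gen_def hull_def submodule_iff)

lemma subspace_carrier: "subspace (carrier N)"
  by (auto simp: subspace_def carrier_eq zero_eq add_eq smult_eq S_zero S_add S_scale)

lemma subspace_subspace_gen: "A \<subseteq> carrier N \<Longrightarrow> subspace (subspace_gen N A)"
  using subspace_carrier unfolding subspace_gen_eq by (auto simp: subspace_def)

lemma subspace_gen_minimal: "subspace K \<Longrightarrow> A \<subseteq> K \<Longrightarrow> subspace_gen N A \<subseteq> K"
  unfolding subspace_gen_eq by blast

lemma subspace_gen_superset: "A \<subseteq> subspace_gen N A"
  unfolding subspace_gen_eq by blast

lemma ac_zero: "r \<in> R \<Longrightarrow> ac r 0 = 0" using ac_diff[of r 0 0] by simp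

lemma ac_scale: "r \<in> R \<Longrightarrow> ac r (pm_scale c p) = pm_scale c (ac r p)"
  using linear_ac by (simp add: module_hom_iff)

lemma subspace_gen_stable:
  assumes A: "A \<subseteq> carrier N" and r: "r \<in> R"
    and gen: "\<And>v. v \<in> A \<Longrightarrow> act N (ix r) v \<in> subspace_gen N A"
    and v: "v \<in> subspace_gen N A"
  shows "act N (ix r) v \<in> subspace_gen N A"
proof -
  let ?G = "subspace_gen N A"
  let ?K = "{v \<in> ?G. act N (ix r) v \<in> ?G}"
  have G: "subspace ?G" by (rule subspace_subspace_gen[OF A])
  then have sub: "?G \<subseteq> \<pi> ` S" by (simp add: subspace_def carrier_eq)
  have "subspace ?K"
    unfolding subspace_def
  proof (intro conjI ballI allI)
    show "?K \<subseteq> carrier N" using G by (auto simp: subspace_def)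
    show "\<zero>\<^bsub>N\<^esub> \<in> ?K" using G r by (simp add: subspace_def zero_eq act_eq S_zero ac_zero)
  next
    fix u w assume "u \<in> ?K" "w \<in> ?K"
    moreover from this obtain p q where "p \<in> S" "q \<in> S" "u = \<pi> p" "w = \<pi> q" using sub by blast
    ultimately show "u \<oplus>\<^bsub>N\<^esub> w \<in> ?K"
      using K_add[OF G, of p q] K_add[OF G, of "ac r p" "ac r q"] r
      by (simp add: add_eq act_eq S_add S_act ac_add)
  next
    fix c u assume "u \<in> ?K"
    moreover from this obtain p where "p \<in> S" "u = \<pi> p" using sub by blast
    ultimately show "c \<odot>\<^bsub>N\<^esub> u \<in> ?K"
      using K_scale[OF G, of p c] K_scale[OF G, of "ac r p" c] r
      by (simp add: smult_eq act_eq S_scale S_act ac_scale)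
  qed
  moreover have "A \<subseteq> ?K" using gen subspace_gen_superset by blast
  ultimately show ?thesis using subspace_gen_minimal v by blast
qed

end

text \<open>The part of the module axioms that makes the action on a tensor product well
  defined.\<close>

definition linear_actions :: "(lie, 'v) act_module \<Rightarrow> bool"
  where "linear_actions N \<longleftrightarrow>
    (\<forall>u\<in>carrier N. \<forall>v\<in>carrier N. u \<oplus>\<^bsub>N\<^esub> v \<in> carrier N) \<and> (\<forall>c. \<forall>v\<in>carrier N. c \<odot>\<^bsub>N\<^esub> v \<in> carrier N) \<and>
    (\<forall>x. \<forall>v\<in>carrier N. act N x v \<in> carrier N) \<and>
    (\<forall>x. \<forall>u\<in>carrier N. \<forall>v\<in>carrier N. act N x (u \<oplus>\<^bsub>N\<^esub> v) = act N x u \<oplus>\<^bsub>N\<^esub> act N x v) \<and>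
    (\<forall>x c. \<forall>v\<in>carrier N. act N x (c \<odot>\<^bsub>N\<^esub> v) = c \<odot>\<^bsub>N\<^esub> act N x v)"

lemma presentation_linear_actions:
  assumes "presentation N S UNIV (\<lambda>x. x) ac \<pi>"
  shows "linear_actions N"
proof -
  interpret presentation N S UNIV "\<lambda>x. x" ac \<pi> by fact
  show ?thesis
    by (auto simp: linear_actions_def carrier_eq add_eq smult_eq act_eq[OF UNIV_I, simplified]
        ac_add ac_scale S_add S_scale S_act)
qed

lemma presentation_free_pairs:
  fixes f :: "'r \<Rightarrow> 'a \<times> 'b \<Rightarrow> ('a \<times> 'b \<Rightarrow>\<^sub>0 complex)"
  assumes "\<And>x u v. x \<in> R \<Longrightarrow> u \<in> carrier A \<Longrightarrow> v \<in> carrier B \<Longrightarrow>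
    Poly_Mapping.keys (f x (u, v)) \<subseteq> carrier A \<times> carrier B"
  shows "presentation (free_pairs A B f) {p. Poly_Mapping.keys p \<subseteq> carrier A \<times> carrier B} R (\<lambda>x. x)
    (\<lambda>x. lin_ext pm_scale (f x)) (\<lambda>p. p)"
proof (rule presentation.intro)
  fix x and p :: "'a \<times> 'b \<Rightarrow>\<^sub>0 complex"
  assume x: "x \<in> R" and p: "p \<in> {p. Poly_Mapping.keys p \<subseteq> carrier A \<times> carrier B}"
  have "Poly_Mapping.keys (f x a) \<subseteq> carrier A \<times> carrier B" if "a \<in> Poly_Mapping.keys p" for a
    using assms[OF x, of "fst a" "snd a"] p that by (cases a) auto
  then show "lin_ext pm_scale (f x) p \<in> {p. Poly_Mapping.keys p \<subseteq> carrier A \<times> carrier B}"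
    by (simp add: keys_lin_ext)
qed (simp_all add: free_pairs_def keys_add_subset keys_scale_subset linear_lin_ext[OF module_pm_scale])

lemma bilinear_relators_cases:
  assumes "r \<in> bilinear_relators A B"
  obtains (addl) a a' b where "a \<in> carrier A" "a' \<in> carrier A" "b \<in> carrier B"
      "r = pair (a \<oplus>\<^bsub>A\<^esub> a') b - pair a b - pair a' b"
    | (addr) a b b' where "a \<in> carrier A" "b \<in> carrier B" "b' \<in> carrier B"
      "r = pair a (b \<oplus>\<^bsub>B\<^esub> b') - pair a b - pair a b'"
    | (scl) c a b where "a \<in> carrier A" "b \<in> carrier B"
      "r = pair (c \<odot>\<^bsub>A\<^esub> a) b - pm_scale c (pair a b)"
    | (scr) c a b where "a \<in> carrier A" "b \<in> carrier B"
      "r = pair a (c \<odot>\<^bsub>B\<^esub> b) - pm_scale c (pair a b)"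
  using assms unfolding bilinear_relators_def
proof (elim UnE CollectE exE conjE, goal_cases)
  case 1 show ?case by (rule addl[OF 1(6,7,8,5)])
next
  case 2 show ?case by (rule addr[OF 2(6,7,8,5)])
next
  case 3 show ?case by (rule scl[OF 3(6,7,5)])
next
  case 4 show ?case by (rule scr[OF 4(6,7,5)])
qed

lemma bilinear_relatorsI:
  "a \<in> carrier A \<Longrightarrow> a' \<in> carrier A \<Longrightarrow> b \<in> carrier B \<Longrightarrow>
    pair (a \<oplus>\<^bsub>A\<^esub> a') b - pair a b - pair a' b \<in> bilinear_relators A B"
  "a \<in> carrier A \<Longrightarrow> b \<in> carrier B \<Longrightarrow> b' \<in> carrier B \<Longrightarrow>
    pair a (b \<oplus>\<^bsub>B\<^esub> b') - pair a b - pair a b' \<in> bilinear_relators A B"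
  "a \<in> carrier A \<Longrightarrow> b \<in> carrier B \<Longrightarrow> pair (c \<odot>\<^bsub>A\<^esub> a) b - pm_scale c (pair a b) \<in> bilinear_relators A B"
  "a \<in> carrier A \<Longrightarrow> b \<in> carrier B \<Longrightarrow> pair a (c \<odot>\<^bsub>B\<^esub> b) - pm_scale c (pair a b) \<in> bilinear_relators A B"
  unfolding bilinear_relators_def
     apply (rule UnI1, rule UnI1, rule UnI1, intro CollectI exI conjI, rule refl, assumption+)
    apply (rule UnI1, rule UnI1, rule UnI2, intro CollectI exI conjI, rule refl, assumption+)
   apply (rule UnI1, rule UnI2, intro CollectI exI conjI, rule refl, assumption+)
  apply (rule UnI2, intro CollectI exI conjI, rule refl, assumption+)
  done

lemma bilinear_relators_pairs:
  assumes "\<And>u v. u \<in> carrier A \<Longrightarrow> v \<in> carrier A \<Longrightarrow> u \<oplus>\<^bsub>A\<^esub> v \<in> carrier A"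
    "\<And>c u. u \<in> carrier A \<Longrightarrow> c \<odot>\<^bsub>A\<^esub> u \<in> carrier A"
    "\<And>u v. u \<in> carrier B \<Longrightarrow> v \<in> carrier B \<Longrightarrow> u \<oplus>\<^bsub>B\<^esub> v \<in> carrier B"
    "\<And>c u. u \<in> carrier B \<Longrightarrow> c \<odot>\<^bsub>B\<^esub> u \<in> carrier B"
    and r: "r \<in> bilinear_relators A B"
  shows "Poly_Mapping.keys r \<subseteq> carrier A \<times> carrier B"
  using r by (cases rule: bilinear_relators_cases)
    (simp_all add: keys_diff_subset assms keys_scale_subset)

locale tensor =
  fixes A :: "(lie, 'a) act_module" and B :: "(lie, 'b) act_module"
  assumes A: "linear_actions A" and B: "linear_actions B"
begin

definition pair_act :: "lie \<Rightarrow> 'a \<times> 'b \<Rightarrow> ('a \<times> 'b \<Rightarrow>\<^sub>0 complex)"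
  where "pair_act x = (\<lambda>(u, v). pair (act A x u) v + pair u (act B x v))"

abbreviation "FP \<equiv> free_pairs A B pair_act"
abbreviation "Pairs \<equiv> {p :: 'a \<times> 'b \<Rightarrow>\<^sub>0 complex. Poly_Mapping.keys p \<subseteq> carrier A \<times> carrier B}"
abbreviation "rel \<equiv> subspace_gen FP (bilinear_relators A B)"

lemmas A_closed = A[unfolded linear_actions_def]
lemmas B_closed = B[unfolded linear_actions_def]

sublocale P: presentation FP Pairs UNIV "\<lambda>x. x" "\<lambda>x. lin_ext pm_scale (pair_act x)" "\<lambda>p. p"
proof (rule presentation_free_pairs)
  fix x u v assume "u \<in> carrier A" "v \<in> carrier B"
  then show "Poly_Mapping.keys (pair_act x (u, v)) \<subseteq> carrier A \<times> carrier B"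
    using A_closed B_closed by (simp add: pair_act_def keys_add_subset)
qed

lemma relators: "bilinear_relators A B \<subseteq> carrier FP"
proof
  fix r assume r: "r \<in> bilinear_relators A B"
  have "Poly_Mapping.keys r \<subseteq> carrier A \<times> carrier B"
    by (rule bilinear_relators_pairs[OF _ _ _ _ r]) (use A_closed B_closed in auto)
  then show "r \<in> carrier FP" by (simp add: P.carrier_eq)
qed

lemma rel_subspace: "P.subspace rel"
  by (rule P.subspace_subspace_gen[OF relators])

lemma rel_add: "p \<in> rel \<Longrightarrow> q \<in> rel \<Longrightarrow> p + q \<in> rel"
  using rel_subspace P.K_add[OF rel_subspace, of p q] P.carrier_eq by (auto simp: P.subspace_def)

lemma pair_act_linear: "lin_ext pm_scale (pair_act x) (pair u v) = pair (act A x u) v + pair u (act B x v)"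
  by (simp add: pair_act_def)

text \<open>The action on a tensor product is well defined: a relator is mapped to the sum of the
  relators obtained by acting on either factor.\<close>

lemma rel_stable: "v \<in> rel \<Longrightarrow> act FP x v \<in> rel"
proof (rule P.subspace_gen_stable[OF relators UNIV_I])
  fix r assume r: "r \<in> bilinear_relators A B"
  have act: "act FP x r = lin_ext pm_scale (pair_act x) r" for r by (simp add: free_pairs_def)
  have r1: "pair (a \<oplus>\<^bsub>A\<^esub> a') b - pair a b - pair a' b \<in> rel"
    if "a \<in> carrier A" "a' \<in> carrier A" "b \<in> carrier B" for a a' b
    by (rule subsetD[OF P.subspace_gen_superset bilinear_relatorsI(1)[OF that]])
  have r2: "pair a (b \<oplus>\<^bsub>B\<^esub> b') - pair a b - pair a b' \<in> rel"
    if "a \<in> carrier A" "b \<in> carrier B" "b' \<in> carrier B" for a b b'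
    by (rule subsetD[OF P.subspace_gen_superset bilinear_relatorsI(2)[OF that]])
  have r3: "pair (c \<odot>\<^bsub>A\<^esub> a) b - pm_scale c (pair a b) \<in> rel"
    if "a \<in> carrier A" "b \<in> carrier B" for a b c
    by (rule subsetD[OF P.subspace_gen_superset bilinear_relatorsI(3)[OF that]])
  have r4: "pair a (c \<odot>\<^bsub>B\<^esub> b) - pm_scale c (pair a b) \<in> rel"
    if "a \<in> carrier A" "b \<in> carrier B" for a b c
    by (rule subsetD[OF P.subspace_gen_superset bilinear_relatorsI(4)[OF that]])
  show "act FP x r \<in> rel"
    using r
  proof (cases rule: bilinear_relators_cases)
    case (addl a a' b)
    show ?thesis
      using addl(1-3) A_closed B_closed rel_add[OF r1[of "act A x a" "act A x a'" b] r1[of a a' "act B x b"]]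
      unfolding act addl(4)
      by (simp add: lin_ext_pm.diff lin_ext_pm.add lin_ext_pm.scale pair_act_linear pm.scale_right_distrib algebra_simps
          del: lin_ext_pm_single pm_scale_single)
  next
    case (addr a b b')
    show ?thesis
      using addr(1-3) A_closed B_closed rel_add[OF r2[of "act A x a" b b'] r2[of a "act B x b" "act B x b'"]]
      unfolding act addr(4)
      by (simp add: lin_ext_pm.diff lin_ext_pm.add lin_ext_pm.scale pair_act_linear pm.scale_right_distrib algebra_simps
          del: lin_ext_pm_single pm_scale_single)
  next
    case (scl c a b)
    show ?thesis
      using scl(1-2) A_closed B_closed rel_add[OF r3[of "act A x a" b c] r3[of a "act B x b" c]]
      unfolding act scl(3)
      by (simp add: lin_ext_pm.diff lin_ext_pm.add lin_ext_pm.scale pair_act_linear pm.scale_right_distrib algebra_simps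
          del: lin_ext_pm_single pm_scale_single)
  next
    case (scr c a b)
    show ?thesis
      using scr(1-2) A_closed B_closed rel_add[OF r4[of "act A x a" b c] r4[of a "act B x b" c]]
      unfolding act scr(3)
      by (simp add: lin_ext_pm.diff lin_ext_pm.add lin_ext_pm.scale pair_act_linear pm.scale_right_distrib algebra_simps
          del: lin_ext_pm_single pm_scale_single)
  qed
qed

definition tensor_class :: "('a \<times> 'b \<Rightarrow>\<^sub>0 complex) \<Rightarrow> ('a \<times> 'b \<Rightarrow>\<^sub>0 complex) set"
  where "tensor_class p = rel +>\<^bsub>FP\<^esub> p"

lemma presentation_tensor:
  "presentation (tensor_mod A B) Pairs UNIV (\<lambda>x. x) (\<lambda>x. lin_ext pm_scale (pair_act x)) tensor_class"
proof -
  have "(\<lambda>x (u, v). pair (act A x u) v + pair u (act B x v)) = pair_act" by (simp add: pair_act_def[abs_def])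
  then have "tensor_mod A B = quot_mod FP rel" unfolding tensor_mod_def Let_def by (simp only:)
  then show ?thesis
    using P.presentation_quot[OF rel_subspace rel_stable] by (simp only: tensor_class_def[abs_def])
qed

sublocale T: presentation "tensor_mod A B" Pairs UNIV "\<lambda>x. x" "\<lambda>x. lin_ext pm_scale (pair_act x)" tensor_class
  by (rule presentation_tensor)

lemma tensor_class_eq_iff: "p \<in> Pairs \<Longrightarrow> q \<in> Pairs \<Longrightarrow> tensor_class p = tensor_class q \<longleftrightarrow> p - q \<in> rel"
  using P.coset_eq_iff[OF rel_subspace, of p q] by (simp add: tensor_class_def)

text \<open>A functional \<open>\<psi>\<close> on the second factor and a linear map
  \<open>f\<close> on the first one induce the map that sends the tensor of \<open>u\<close> and
  \<open>v\<close> to the multiple of \<open>f u\<close> by \<open>\<psi> v\<close>. If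
  \<open>\<psi>\<close> is an eigenfunctional for an element of the Lie algebra, this map
  intertwines the element with its action on the first factor, shifted by the eigenvalue.\<close>

lemma tensor_functional:
  fixes \<psi> :: "'b \<Rightarrow> complex" and s :: "complex \<Rightarrow> 'c::ab_group_add \<Rightarrow> 'c" and f :: "'a \<Rightarrow> 'c"
  assumes s: "Modules.module s"
    and f_add: "\<And>u v. u \<in> carrier A \<Longrightarrow> v \<in> carrier A \<Longrightarrow> f (u \<oplus>\<^bsub>A\<^esub> v) = f u + f v"
    and f_smult: "\<And>c u. u \<in> carrier A \<Longrightarrow> f (c \<odot>\<^bsub>A\<^esub> u) = s c (f u)"
    and \<psi>_add: "\<And>u v. u \<in> carrier B \<Longrightarrow> v \<in> carrier B \<Longrightarrow> \<psi> (u \<oplus>\<^bsub>B\<^esub> v) = \<psi> u + \<psi> v"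
    and \<psi>_smult: "\<And>c u. u \<in> carrier B \<Longrightarrow> \<psi> (c \<odot>\<^bsub>B\<^esub> u) = c * \<psi> u"
  obtains \<Phi> where
    "\<And>u v. u \<in> carrier A \<Longrightarrow> v \<in> carrier B \<Longrightarrow> \<Phi> (tensor_class (pair u v)) = s (\<psi> v) (f u)"
    "\<And>p q. p \<in> carrier (tensor_mod A B) \<Longrightarrow> q \<in> carrier (tensor_mod A B) \<Longrightarrow>
      \<Phi> (p \<oplus>\<^bsub>tensor_mod A B\<^esub> q) = \<Phi> p + \<Phi> q"
    "\<And>c p. p \<in> carrier (tensor_mod A B) \<Longrightarrow> \<Phi> (c \<odot>\<^bsub>tensor_mod A B\<^esub> p) = s c (\<Phi> p)"
    "\<And>x u v. u \<in> carrier A \<Longrightarrow> v \<in> carrier B \<Longrightarrow>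
      \<Phi> (act (tensor_mod A B) x (tensor_class (pair u v))) = s (\<psi> v) (f (act A x u)) + s (\<psi> (act B x v)) (f u)"
    "\<And>x k g p. p \<in> carrier (tensor_mod A B) \<Longrightarrow> linear_map s s g \<Longrightarrow>
      (\<And>u. u \<in> carrier A \<Longrightarrow> f (act A x u) = g (f u)) \<Longrightarrow>
      (\<And>v. v \<in> carrier B \<Longrightarrow> \<psi> (act B x v) = k * \<psi> v) \<Longrightarrow>
      \<Phi> (act (tensor_mod A B) x p) = g (\<Phi> p) + s k (\<Phi> p)"
proof -
  interpret s: Modules.module s by fact
  define L where "L = lin_ext s (\<lambda>(u, v). s (\<psi> v) (f u))"
  interpret L: Modules.module_hom pm_scale s L
    unfolding L_def by (rule linear_lin_ext[OF s])
  have L_pair: "L (pair u v) = s (\<psi> v) (f u)" for u v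
    by (simp add: L_def lin_ext_single[OF s])
  have "P.subspace {p \<in> Pairs. L p = 0}"
    unfolding P.subspace_def by (auto simp: free_pairs_def keys_add_subset keys_scale_subset L.zero L.add L.scale)
  moreover have "bilinear_relators A B \<subseteq> {p \<in> Pairs. L p = 0}"
  proof
    fix r assume r: "r \<in> bilinear_relators A B"
    then have "r \<in> Pairs" using relators by (auto simp: P.carrier_eq)
    moreover from r have "L r = 0"
      by (cases rule: bilinear_relators_cases)
        (simp_all add: L.diff L.scale L_pair f_add f_smult \<psi>_add \<psi>_smult s.scale_left_distrib
          s.scale_right_distrib mult.commute del: pm_scale_single)
    ultimately show "r \<in> {p \<in> Pairs. L p = 0}" by simp
  qed
  ultimately have L_rel: "p \<in> rel \<Longrightarrow> L p = 0" for p
    using P.subspace_gen_minimal by blast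
  define \<Phi> where "\<Phi> w = L (SOME p. p \<in> Pairs \<and> tensor_class p = w)" for w
  have \<Phi>: "\<Phi> (tensor_class p) = L p" if p: "p \<in> Pairs" for p
  proof -
    define q where "q = (SOME q. q \<in> Pairs \<and> tensor_class q = tensor_class p)"
    have "q \<in> Pairs \<and> tensor_class q = tensor_class p" unfolding q_def by (rule someI[of _ p]) (use p in simp)
    then have "L (q - p) = 0" using tensor_class_eq_iff[of q p] p L_rel by blast
    then show ?thesis by (simp add: \<Phi>_def q_def L.diff)
  qed
  have pair_act_L: "L (lin_ext pm_scale (pair_act x) (pair u v)) = s (\<psi> v) (f (act A x u)) + s (\<psi> (act B x v)) (f u)" for x u v
    unfolding pair_act_linear by (simp add: L.add L_pair)
  show ?thesis
  proof (rule that[of \<Phi>])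
    fix x k g p
    assume p: "p \<in> carrier (tensor_mod A B)" and g: "linear_map s s g"
      and fg: "\<And>u. u \<in> carrier A \<Longrightarrow> f (act A x u) = g (f u)"
      and k: "\<And>v. v \<in> carrier B \<Longrightarrow> \<psi> (act B x v) = k * \<psi> v"
    interpret g: Modules.module_hom s s g by fact
    obtain q where q: "q \<in> Pairs" "p = tensor_class q" using p by (auto simp: T.carrier_eq)
    have "L (lin_ext pm_scale (pair_act x) q) = g (L q) + s k (L q)"
    proof (rule linear_map_eqI[where f = "\<lambda>q. L (lin_ext pm_scale (pair_act x) q)" and g = "\<lambda>q. g (L q) + s k (L q)"])
      show "linear_map pm_scale s (\<lambda>q. L (lin_ext pm_scale (pair_act x) q))"
        by (rule linear_comp[OF linear_lin_ext[OF module_pm_scale] L.module_hom_axioms])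
      have "linear_map s s (s k)"
        by (rule linear_mapI[OF s s]) (simp_all add: s.scale_right_distrib mult.commute)
      then show "linear_map pm_scale s (\<lambda>q. g (L q) + s k (L q))"
        by (intro linear_add linear_comp[OF L.module_hom_axioms g] linear_comp[OF L.module_hom_axioms])
      fix a assume "a \<in> Poly_Mapping.keys q"
      then obtain u v where "a = (u, v)" "u \<in> carrier A" "v \<in> carrier B" using q by (cases a) auto
      then show "L (lin_ext pm_scale (pair_act x) (Poly_Mapping.single a 1)) =
          g (L (Poly_Mapping.single a 1)) + s k (L (Poly_Mapping.single a 1))"
        using pair_act_L[of x u v] by (simp add: L_pair fg k g.scale del: lin_ext_pm_single)
    qed
    then show "\<Phi> (act (tensor_mod A B) x p) = g (\<Phi> p) + s k (\<Phi> p)"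
      using q P.S_act[of x q] by (simp add: T.act_eq \<Phi>)
  next
    fix x u v assume "u \<in> carrier A" "v \<in> carrier B"
    then have uv: "pair u v \<in> Pairs" by simp
    show "\<Phi> (act (tensor_mod A B) x (tensor_class (pair u v))) = s (\<psi> v) (f (act A x u)) + s (\<psi> (act B x v)) (f u)"
      using T.act_eq[OF UNIV_I uv, of x] \<Phi>[OF P.S_act[OF UNIV_I uv, of x]] pair_act_L[of x u v]
      by (simp only:)
  qed (auto simp: T.carrier_eq T.add_eq T.smult_eq \<Phi> L_pair L.add L.scale keys_add_subset keys_scale_subset)
qed

end

section \<open>The polynomial modules\<close>

lemma shift_add: "shift a b (g + h) = shift a b g + shift a b h"
proof -
  have "map_poly (\<lambda>c. pcompose c [:- b, 1:]) (g + h)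
    = map_poly (\<lambda>c. pcompose c [:- b, 1:]) g + map_poly (\<lambda>c. pcompose c [:- b, 1:]) h"
    by (rule poly_eqI) (simp add: coeff_map_poly pcompose_add)
  then show ?thesis by (simp add: shift_def pcompose_add)
qed

lemma shift_const_mult: "shift a b (poly_const c * g) = poly_const c * shift a b g"
proof -
  have "map_poly (\<lambda>c. pcompose c [:- b, 1:]) (poly_const c * g)
    = poly_const c * map_poly (\<lambda>c. pcompose c [:- b, 1:]) g"
    by (rule poly_eqI) (simp add: coeff_map_poly pcompose_smult)
  then show ?thesis by (simp add: shift_def pcompose_smult)
qed

lemma shift_zero_right: "shift a 0 g = pcompose g [:[:- a:], 1:]"
  by (simp add: shift_def)

lemma shift_mult: "shift a 0 (g * h) = shift a 0 g * shift a 0 h"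
  by (simp add: shift_zero_right pcompose_mult)

lemma shift_t: "shift a 0 poly_t = poly_t" and shift_one: "shift a 0 1 = 1"
  by (simp_all add: shift_zero_right poly_t_def pcompose_1)

lemma shift_shift: "shift a 0 (shift b 0 g) = shift (a + b) 0 g"
  by (simp add: shift_zero_right pcompose_assoc[symmetric] pcompose_pCons add.commute)

lemma shift_zero: "shift 0 0 g = g"
  by (simp add: shift_zero_right pcompose_idR)

abbreviation scale_poly :: "complex \<Rightarrow> poly_st \<Rightarrow> poly_st"
  where "scale_poly c g \<equiv> poly_const c * g"

lemma module_scale_poly: "Modules.module scale_poly"
proof
  have "poly_const (a + b) = poly_const a + poly_const b" for a b by simp
  then show "scale_poly (a + b) g = scale_poly a g + scale_poly b g" for a b g
    by (simp only: distrib_right)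
  have "poly_const (a * b) = poly_const a * poly_const b" for a b by simp
  then show "scale_poly a (scale_poly b g) = scale_poly (a * b) g" for a b g
    by (simp only: mult.assoc)
  have "poly_const 1 = 1" by (simp add: one_pCons)
  then show "scale_poly 1 g = g" for g by (simp only: mult_1)
qed (rule distrib_left)

lemma linear_scale_mult: "linear_map scale_poly scale_poly (\<lambda>g. p * g)"
  by (rule linear_mapI[OF module_scale_poly module_scale_poly]) (simp_all add: algebra_simps)

lemma linear_shift: "linear_map scale_poly scale_poly (shift a b)"
  by (rule linear_mapI[OF module_scale_poly module_scale_poly]) (simp_all only: shift_add shift_const_mult)

text \<open>The common part of the three families. The actions of \<open>E i\<close> and \<open>F
  i\<close>, in which they differ, are merely required to be linear.\<close>

definition polynomial_type :: "(lie, poly_st) act_module \<Rightarrow> complex \<Rightarrow> complex \<Rightarrow> bool"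
  where "polynomial_type M lam \<gamma> \<longleftrightarrow> (\<exists>f. M = poly_module f \<and> (\<forall>a. linear_map scale_poly scale_poly (f a)) \<and>
    (\<forall>i g. f (H i) g = poly_const (lam powi i) * poly_t * shift (of_int i) 0 g) \<and>
    (\<forall>i g. f (D i) g = poly_const (lam powi i) * (poly_s + poly_const (of_int i * \<gamma>)) * shift (of_int i) 0 g) \<and>
    (\<forall>g. f C g = 0))"

lemma polynomial_type_families:
  assumes "M \<in> {Omega_mod lam \<alpha> \<beta> \<gamma>, Delta_mod lam \<alpha> \<beta> \<gamma>, Theta_mod lam \<alpha> \<beta> \<gamma>}"
  shows "polynomial_type M lam \<gamma>"
proof -
  have lin: "linear_map scale_poly scale_poly (\<lambda>g. p * shift a b g)" for p a b
    by (rule linear_comp[OF linear_shift linear_scale_mult])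
  have zero: "linear_map scale_poly scale_poly (\<lambda>g. 0)"
    by (rule linear_zero[OF module_scale_poly module_scale_poly])
  show ?thesis
    using assms unfolding Omega_mod_def Delta_mod_def Theta_mod_def polynomial_type_def
    apply (elim insertE emptyE)
    subgoal
      by (rule exI, rule conjI, assumption, intro conjI allI;
        (simp only: gen.case)?; (rename_tac a, case_tac a; simp only: gen.case; rule lin zero)?)
    subgoal
      by (rule exI, rule conjI, assumption, intro conjI allI;
        (simp only: gen.case)?; (rename_tac a, case_tac a; simp only: gen.case; rule lin zero)?)
    subgoal
      by (rule exI, rule conjI, assumption, intro conjI allI;
        (simp only: gen.case)?; (rename_tac a, case_tac a; simp only: gen.case; rule lin zero)?)
    done
qed

lemma polynomial_type_simps:
  assumes "polynomial_type M lam \<gamma>"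
  shows "carrier M = UNIV" "\<zero>\<^bsub>M\<^esub> = 0" "g \<oplus>\<^bsub>M\<^esub> h = g + h" "c \<odot>\<^bsub>M\<^esub> g = poly_const c * g"
    "act M (basis (H i)) g = poly_const (lam powi i) * poly_t * shift (of_int i) 0 g"
    "act M (basis (D i)) g = poly_const (lam powi i) * (poly_s + poly_const (of_int i * \<gamma>)) * shift (of_int i) 0 g"
    "act M (basis C) g = 0"
    "linear_map scale_poly scale_poly (act M x)"
    "linear_actions M"
proof -
  obtain f where M: "M = poly_module f" and f: "\<And>a. linear_map scale_poly scale_poly (f a)"
    and H: "\<And>i g. f (H i) g = poly_const (lam powi i) * poly_t * shift (of_int i) 0 g"
    and D: "\<And>i g. f (D i) g = poly_const (lam powi i) * (poly_s + poly_const (of_int i * \<gamma>)) * shift (of_int i) 0 g"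
    and C: "\<And>g. f C g = 0"
    using assms unfolding polynomial_type_def by blast
  show "carrier M = UNIV" "\<zero>\<^bsub>M\<^esub> = 0" "g \<oplus>\<^bsub>M\<^esub> h = g + h" "c \<odot>\<^bsub>M\<^esub> g = poly_const c * g"
    by (simp_all add: M poly_module_def)
  have act: "act M (basis a) g = f a g" for a
    using lin_ext_single[OF module_scale_poly, of "\<lambda>a. f a g" a 1]
    by (simp add: M poly_module_def one_pCons[symmetric])
  show "act M (basis (H i)) g = poly_const (lam powi i) * poly_t * shift (of_int i) 0 g"
    "act M (basis (D i)) g = poly_const (lam powi i) * (poly_s + poly_const (of_int i * \<gamma>)) * shift (of_int i) 0 g"
    "act M (basis C) g = 0"
    by (simp_all only: act H D C)
  have lin: "linear_map scale_poly scale_poly (act M x)" for x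
    using linear_lin_ext_family[OF module_scale_poly f, where p = x] by (simp add: M poly_module_def)
  then show "linear_map scale_poly scale_poly (act M x)" .
  show "linear_actions M"
    using lin by (simp add: linear_actions_def M poly_module_def module_hom_iff)
qed

lemma powi_cancel: "(lam :: complex) \<noteq> 0 \<Longrightarrow> lam powi (- i) * lam powi i = 1"
  by (simp add: power_int_minus)

text \<open>The two translations cancel, and so do the powers of \<open>lam\<close>. The result is
  affine in the index \<open>i\<close>, a property that is independent of the parameters.\<close>

lemma polynomial_type_DH:
  assumes M: "polynomial_type M lam \<gamma>" and "lam \<noteq> 0"
  shows "act M (basis (D (- i))) (act M (basis (H i)) g) = (poly_s - poly_const (of_int i * \<gamma>)) * (poly_t * g)"
proof -
  have "poly_const (lam powi (- i)) * poly_const (lam powi i) = 1"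
    using powi_cancel[OF assms(2), of i] by (simp add: one_pCons mult.commute)
  moreover have "shift (of_int (- i)) 0 (poly_const (lam powi i) * poly_t * shift (of_int i) 0 g)
     = poly_const (lam powi i) * (poly_t * g)"
    unfolding mult.assoc shift_const_mult by (simp add: shift_mult shift_t shift_shift shift_zero)
  moreover have "poly_s + poly_const (of_int (- i) * \<gamma>) = poly_s - poly_const (of_int i * \<gamma>)"
    by (simp add: poly_s_def)
  moreover have "a * b = 1 \<Longrightarrow> a * r * (b * (poly_t * g)) = r * (poly_t * g)" for a b r :: poly_st
    by (metis mult.assoc mult.left_commute mult_1)
  ultimately show ?thesis
    unfolding polynomial_type_simps(5,6)[OF M] by (simp only:)
qed

section \<open>Whittaker modules\<close>

lemma gen_bracket_degree: "Poly_Mapping.keys (gen_bracket a b) \<subseteq> {c. degree c = degree a + degree b}"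
  by (cases a; cases b) (auto simp: in_keys_iff lookup_add lookup_minus lookup_single when_def split: if_splits)

text \<open>Any given vector of a Whittaker module is annihilated by the elements that lie deep
  enough in this filtration.\<close>

definition deg_ge :: "int \<Rightarrow> lie set"
  where "deg_ge m = {x. Poly_Mapping.keys x \<subseteq> {a. degree a \<ge> m}}"

lemma deg_ge_mono: "m \<le> n \<Longrightarrow> deg_ge n \<subseteq> deg_ge m"
  by (auto simp: deg_ge_def)

lemma deg_ge_bracket: "x \<in> deg_ge m \<Longrightarrow> y \<in> deg_ge n \<Longrightarrow> lie_bracket x y \<in> deg_ge (m + n)"
  unfolding deg_ge_def
proof (intro CollectI keys_bracket)
  fix a b
  assume "x \<in> {x. Poly_Mapping.keys x \<subseteq> {a. degree a \<ge> m}}" "y \<in> {x. Poly_Mapping.keys x \<subseteq> {a. degree a \<ge> n}}"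
    "a \<in> Poly_Mapping.keys x" "b \<in> Poly_Mapping.keys y"
  then have "degree a \<ge> m" "degree b \<ge> n" by auto
  then show "Poly_Mapping.keys (gen_bracket a b) \<subseteq> {a. degree a \<ge> m + n}"
    using gen_bracket_degree[of a b] by auto
qed

lemma deg_ge_exhausts: "\<exists>k\<ge>0. x \<in> deg_ge (- k)"
proof (induction x rule: poly_mapping_add_induct)
  case zero
  then show ?case by (intro exI[of _ 0]) (simp add: deg_ge_def)
next
  case (add x y)
  then obtain k l where "k \<ge> 0" "x \<in> deg_ge (- k)" "l \<ge> 0" "y \<in> deg_ge (- l)" by blast
  then have "x \<in> deg_ge (- max k l)" "y \<in> deg_ge (- max k l)"
    using deg_ge_mono[of "- max k l" "- k"] deg_ge_mono[of "- max k l" "- l"] by auto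
  then have "x + y \<in> deg_ge (- max k l)" by (simp add: deg_ge_def keys_add_subset)
  then show ?case using \<open>k \<ge> 0\<close> by (intro exI[of _ "max k l"]) auto
next
  case (single a c)
  then show ?case by (intro exI[of _ "\<bar>degree a\<bar>"]) (auto simp: deg_ge_def abs_if)
qed

locale whittaker =
  fixes \<mu>1 \<mu>2 \<mu>3 \<mu>4 \<mu>5 :: complex
begin

abbreviation "u a \<equiv> env_of LplusC (basis a)"
abbreviation "sc \<equiv> env_scalar LplusC"
abbreviation "U \<equiv> env LplusC"

definition wh_gens :: "env_elt set"
  where "wh_gens = {u (D 1) \<ominus>\<^bsub>U\<^esub> sc \<mu>1, u (D 2) \<ominus>\<^bsub>U\<^esub> sc \<mu>2, u (E 0) \<ominus>\<^bsub>U\<^esub> sc \<mu>3,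
             u (F 1) \<ominus>\<^bsub>U\<^esub> sc \<mu>4, u C \<ominus>\<^bsub>U\<^esub> sc \<mu>5} \<union>
            {u (D j) | j. j \<ge> 3} \<union> {u (E k) | k. k \<ge> 1} \<union>
            {u (F l) | l. l \<ge> 2} \<union> {u (H m) | m. m \<ge> 1}"

abbreviation "N \<equiv> whittaker_N \<mu>1 \<mu>2 \<mu>3 \<mu>4 \<mu>5"

definition J :: "env_elt set" where "J = left_ideal_gen U wh_gens"

lemma N_eq: "N = quot_mod (env_regular LplusC) J"
  unfolding whittaker_N_def J_def wh_gens_def Let_def ..

lemma word_LplusC: "degree a > 0 \<or> a = C \<Longrightarrow> word [basis a] \<in> P.Fg"
  by (simp add: LplusC_eq)

lemma wh_gens_carrier: "wh_gens \<subseteq> carrier U"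
proof -
  have u: "u a \<in> carrier U" if "degree a > 0 \<or> a = C" for a
    unfolding env_of_eq P.env_simps(1) by (rule imageI[OF word_LplusC[OF that]])
  have diff: "u a \<ominus>\<^bsub>U\<^esub> sc c \<in> carrier U" if "degree a > 0 \<or> a = C" for a c
  proof -
    have c: "pm_scale c (word []) \<in> P.Fg" by (auto intro: keys_scale_subset)
    then show ?thesis
      unfolding env_of_eq env_scalar_eq P.env_minus[OF word_LplusC[OF that] c] P.env_simps(1)
      using word_LplusC[OF that] by (intro imageI) (simp add: keys_diff_subset del: pm_scale_single)
  qed
  show ?thesis unfolding wh_gens_def by (auto intro!: u diff)
qed

lemma J: "P.reg.subspace J" "r \<in> carrier U \<Longrightarrow> v \<in> J \<Longrightarrow> r \<otimes>\<^bsub>U\<^esub> v \<in> J"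
  using P.left_ideal_left_ideal_gen[OF wh_gens_carrier] by (simp_all add: J_def P.left_ideal_iff)

definition N_class :: "(lie list \<Rightarrow>\<^sub>0 complex) \<Rightarrow> env_elt set"
  where "N_class p = J +>\<^bsub>env_regular LplusC\<^esub> env_class LplusC p"

lemma presentation_N: "presentation N P.Fg P.Fg (env_class LplusC) (*) N_class"
  unfolding N_class_def N_eq
  by (rule P.reg.presentation_quot[OF J(1)]) (use J(2) in \<open>auto simp: env_regular_def P.env_simps(1)\<close>)

sublocale N: presentation N P.Fg P.Fg "env_class LplusC" "(*)" N_class
  by (rule presentation_N)

lemma one_P: "1 \<in> P.Fg" by (simp add: zero_list_def)

text \<open>The bound 5 lies above the degree 4 of $d_2$, the largest degree of a generator that
  may act on the Whittaker vector by a nonzero scalar.\<close>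

lemma N_class_high:
  assumes "x \<in> deg_ge 5"
  shows "x \<in> LplusC" "N_class (word [x]) = \<zero>\<^bsub>N\<^esub>"
proof -
  have J0: "env_class LplusC p \<in> J" if "p \<in> env_ideal LplusC" "p \<in> P.Fg" for p
    using P.env_class_eq_iff[of p 0] P.reg.K_zero[OF J(1)] that by simp
  have "x \<in> LplusC \<and> env_class LplusC (word [x]) \<in> J"
  proof (induction x rule: poly_mapping_add_induct)
    case zero
    have "word [pm_scale 0 0] - pm_scale 0 (word [0]) \<in> env_relators LplusC"
      unfolding env_relators_def using P.g_zero by blast
    then have "word [0] \<in> env_ideal LplusC" using P.relators_env_ideal by auto
    then show ?case using P.g_zero by (intro conjI J0) auto
  next
    case (add x y)
    have "word [x + y] - word [x] - word [y] \<in> env_relators LplusC"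
      unfolding env_relators_def using add by blast
    then have "word [x + y] - word [x] - word [y] \<in> env_ideal LplusC" 
       "word [x + y] - word [x] - word [y] \<in> P.Fg"
      using P.relators_env_ideal P.relators_carrier by blast+
    then have "env_class LplusC (word [x + y] - word [x] - word [y]) \<in> J" by (rule J0)
    moreover have x: "word [x] \<in> P.Fg" and y: "word [y] \<in> P.Fg" using add by auto
    moreover note r = \<open>word [x + y] - word [x] - word [y] \<in> P.Fg\<close>
    ultimately have "env_class LplusC ((word [x + y] - word [x] - word [y]) + word [x]) \<in> J"
      using add by (intro P.reg.K_add[OF J(1) r x]) simp_all
    from P.reg.K_add[OF J(1) P.reg.S_add[OF r x] y this] show ?case using add P.g_add by simp
  next
    case (single a c)
    then have "degree a \<ge> 5" using assms by (auto simp: deg_ge_def)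
    then have a: "basis a \<in> LplusC" by (simp add: LplusC_eq)
    have "u a \<in> wh_gens"
    proof (cases a)
      case (E i)
      then have "i \<ge> 1" using \<open>degree a \<ge> 5\<close> by simp
      then show ?thesis unfolding wh_gens_def E by blast
    next
      case (F i)
      then have "i \<ge> 2" using \<open>degree a \<ge> 5\<close> by simp
      then show ?thesis unfolding wh_gens_def F by blast
    next
      case (H i)
      then have "i \<ge> 1" using \<open>degree a \<ge> 5\<close> by simp
      then show ?thesis unfolding wh_gens_def H by blast
    next
      case (D i)
      then have "i \<ge> 3" using \<open>degree a \<ge> 5\<close> by simp
      then show ?thesis unfolding wh_gens_def D by blast
    qed (use \<open>degree a \<ge> 5\<close> in simp)
    then have "env_class LplusC (word [basis a]) \<in> J"
      unfolding J_def left_ideal_gen_def env_of_eq by (rule hull_inc)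
    moreover have wa: "word [basis a] \<in> P.Fg" using a by auto
    ultimately have 1: "env_class LplusC (pm_scale c (word [basis a])) \<in> J"
      by (intro P.reg.K_scale[OF J(1)])
    have r: "word [pm_scale c (basis a)] - pm_scale c (word [basis a]) \<in> env_relators LplusC"
      unfolding env_relators_def using a by blast
    then have 2: "env_class LplusC (word [pm_scale c (basis a)] - pm_scale c (word [basis a])) \<in> J"
      using P.relators_env_ideal P.relators_carrier by (intro J0) blast+
    have "env_class LplusC ((word [pm_scale c (basis a)] - pm_scale c (word [basis a])) + pm_scale c (word [basis a])) \<in> J"
      using r P.relators_carrier by (intro P.reg.K_add[OF J(1) _ _ 2 1] P.reg.S_scale wa) blast
    then show ?case using P.g_scale[OF a, of c] by simp
  qed
  then show "x \<in> LplusC" and "N_class (word [x]) = \<zero>\<^bsub>N\<^esub>"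
    using P.reg.coset_eq_iff[OF J(1), of "word [x]" 0] by (auto simp: N_class_def N.zero_eq)
qed

section \<open>The induced module\<close>

text \<open>The action on the free vector space over which the induced module is defined, before
  the passage to the tensor product over the smaller enveloping algebra.\<close>

definition ind_act :: "lie \<Rightarrow> env_elt \<times> env_elt set \<Rightarrow> (env_elt \<times> env_elt set \<Rightarrow>\<^sub>0 complex)"
  where "ind_act x = (\<lambda>(u, v). pair (env_of UNIV x \<otimes>\<^bsub>env UNIV\<^esub> u) v)"

abbreviation "FI \<equiv> free_pairs (env_regular UNIV) N ind_act"
abbreviation "PairsI \<equiv> {p :: env_elt \<times> env_elt set \<Rightarrow>\<^sub>0 complex.
  Poly_Mapping.keys p \<subseteq> carrier (env_regular UNIV) \<times> carrier N}"

definition bal :: "(env_elt \<times> env_elt set \<Rightarrow>\<^sub>0 complex) set"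
  where "bal = {pair (u \<otimes>\<^bsub>env UNIV\<^esub> env_incl r) v - pair u (act N r v) | u r v.
           u \<in> carrier (env_regular UNIV) \<and> r \<in> carrier (env LplusC) \<and> v \<in> carrier N}"

definition irel :: "(env_elt \<times> env_elt set \<Rightarrow>\<^sub>0 complex) set"
  where "irel = subspace_gen FI (bilinear_relators (env_regular UNIV) N \<union> bal)"

lemma induced_eq: "induced N = quot_mod FI irel"
proof -
  have "(\<lambda>x (u, v). pair (env_of UNIV x \<otimes>\<^bsub>env UNIV\<^esub> u) v) = ind_act" by (simp add: ind_act_def[abs_def])
  then show ?thesis unfolding induced_def Let_def irel_def bal_def by (simp only:)
qed

lemma env_class_carrier: "env_class UNIV p \<in> carrier (env_regular UNIV)"
  by (simp add: L.reg.carrier_eq)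

lemma env_mult_eq: "env_of UNIV x \<otimes>\<^bsub>env UNIV\<^esub> env_class UNIV p = env_class UNIV (word [x] * p)"
  using L.env_simps(4)[of "word [x]" p] by (simp add: env_of_eq)

lemma ind_act_pair: "lin_ext pm_scale (ind_act x) (pair (env_class UNIV p) v) = pair (env_class UNIV (word [x] * p)) v"
  by (simp add: ind_act_def env_mult_eq)

sublocale FI: presentation FI PairsI UNIV "\<lambda>x. x" "\<lambda>x. lin_ext pm_scale (ind_act x)" "\<lambda>p. p"
proof (rule presentation_free_pairs)
  fix x u v assume "u \<in> carrier (env_regular UNIV)" "v \<in> carrier N"
  then show "Poly_Mapping.keys (ind_act x (u, v)) \<subseteq> carrier (env_regular UNIV) \<times> carrier N"
    by (auto simp: ind_act_def L.reg.carrier_eq env_mult_eq)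
qed

lemma balE:
  assumes "r \<in> bal"
  obtains p q n where "q \<in> P.Fg" "n \<in> P.Fg"
    "r = pair (env_class UNIV (p * q)) (N_class n) - pair (env_class UNIV p) (N_class (q * n))"
  using assms unfolding bal_def
proof (elim CollectE exE conjE, goal_cases)
  case (1 a s v)
  obtain p where p: "a = env_class UNIV p" using 1(3) by (auto simp: L.reg.carrier_eq)
  obtain q where q: "q \<in> P.Fg" "s = env_class LplusC q" using 1(4) by (auto simp: P.env_simps(1))
  obtain n where n: "n \<in> P.Fg" "v = N_class n" using 1(5) by (auto simp: N.carrier_eq)
  show ?case
    by (rule 1(1)[OF q(1) n(1), of p])
      (use 1(2) L.env_simps(4)[of p q] in
        \<open>simp add: p q(2) n(2) env_incl_cl[OF q(1)] N.act_eq[OF q(1) n(1)] del: free_algebra_simps\<close>)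
qed

lemma relators_carrier: "bilinear_relators (env_regular UNIV) N \<union> bal \<subseteq> carrier FI"
proof
  fix r assume "r \<in> bilinear_relators (env_regular UNIV) N \<union> bal"
  moreover have "Poly_Mapping.keys r \<subseteq> carrier (env_regular UNIV) \<times> carrier N"
    if "r \<in> bilinear_relators (env_regular UNIV) N"
    by (rule bilinear_relators_pairs[OF _ _ _ _ that])
      (auto simp only: L.reg.carrier_eq N.carrier_eq image_iff L.reg.add_eq L.reg.smult_eq N.add_eq N.smult_eq
       intro: L.reg.S_add L.reg.S_scale N.S_add N.S_scale)
  moreover have "Poly_Mapping.keys r \<subseteq> carrier (env_regular UNIV) \<times> carrier N" if bal: "r \<in> bal"
  proof -
    obtain p q n where q: "q \<in> P.Fg" and n: "n \<in> P.Fg"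
      and r: "r = pair (env_class UNIV (p * q)) (N_class n) - pair (env_class UNIV p) (N_class (q * n))"
      using bal by (rule balE)
    have "N_class n \<in> carrier N" "N_class (q * n) \<in> carrier N"
      using n N.S_act[OF q n] by (simp_all only: N.carrier_eq image_eqI)
    then show ?thesis by (simp add: r keys_diff_subset env_class_carrier)
  qed
  ultimately show "r \<in> carrier FI" by (auto simp: FI.carrier_eq)
qed

lemma irel_subspace: "FI.subspace irel"
  unfolding irel_def by (rule FI.subspace_subspace_gen[OF relators_carrier])

lemma irel_pairs: "p \<in> irel \<Longrightarrow> p \<in> PairsI"
  using irel_subspace unfolding FI.subspace_def FI.carrier_eq by blast

lemma irel_add: "p \<in> irel \<Longrightarrow> q \<in> irel \<Longrightarrow> p + q \<in> irel"
  using FI.K_add[OF irel_subspace irel_pairs irel_pairs] by blast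

lemma irel_scale: "p \<in> irel \<Longrightarrow> pm_scale c p \<in> irel"
  using FI.K_scale[OF irel_subspace irel_pairs] by blast

lemma irel_bilinear: "r \<in> bilinear_relators (env_regular UNIV) N \<Longrightarrow> r \<in> irel"
  and irel_bal: "r \<in> bal \<Longrightarrow> r \<in> irel"
  unfolding irel_def using FI.subspace_gen_superset[of "bilinear_relators (env_regular UNIV) N \<union> bal"] by blast+

lemma irel_addl: "v \<in> carrier N \<Longrightarrow> pair (env_class UNIV (p + q)) v - pair (env_class UNIV p) v - pair (env_class UNIV q) v \<in> irel"
  using irel_bilinear[OF bilinear_relatorsI(1)[OF env_class_carrier[of p] env_class_carrier[of q], of v N]] L.reg.add_eq[of p q]
  by simp

lemma irel_scl: "v \<in> carrier N \<Longrightarrow> pair (env_class UNIV (pm_scale c p)) v - pm_scale c (pair (env_class UNIV p) v) \<in> irel"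
  using irel_bilinear[OF bilinear_relatorsI(3)[OF env_class_carrier[of p], of v N c]] L.reg.smult_eq[of p c]
  by simp

lemma irel_balanced: 
  assumes "q \<in> P.Fg" "n \<in> P.Fg"
  shows "pair (env_class UNIV (p * q)) (N_class n) - pair (env_class UNIV p) (N_class (q * n)) \<in> irel"
proof -
  have "pair (env_class UNIV p \<otimes>\<^bsub>env UNIV\<^esub> env_incl (env_class LplusC q)) (N_class n) - pair (env_class UNIV p) (act N (env_class LplusC q) (N_class n)) \<in> bal"
    unfolding bal_def using env_class_carrier assms by (auto simp del: free_algebra_simps simp: N.carrier_eq P.env_simps(1))
  then show ?thesis
    using irel_bal L.env_simps(4)[of p q] by (simp add: env_incl_cl[OF assms(1)] N.act_eq[OF assms])
qed

text \<open>Left multiplication commutes with the balancing on the right.\<close>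

lemma irel_stable: "v \<in> irel \<Longrightarrow> act FI x v \<in> irel"
  unfolding irel_def
proof (rule FI.subspace_gen_stable[OF relators_carrier UNIV_I], fold irel_def)
  have act: "act FI x r = lin_ext pm_scale (ind_act x) r" for r by (simp add: free_pairs_def)
  have carrier: "\<exists>p. u = env_class UNIV p" if "u \<in> carrier (env_regular UNIV)" for u
    using that by (auto simp: L.reg.carrier_eq)
  fix r assume "r \<in> bilinear_relators (env_regular UNIV) N \<union> bal"
  then consider "r \<in> bilinear_relators (env_regular UNIV) N" | "r \<in> bal" by blast
  then show "act FI x r \<in> irel"
  proof cases
    case 1
    then show ?thesis
    proof (cases rule: bilinear_relators_cases)
      case (addl a a' b)
      then obtain p q where "a = env_class UNIV p" "a' = env_class UNIV q" using carrier by blast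
      then show ?thesis using addl(3) irel_addl[OF addl(3), of "word [x] * p" "word [x] * q"]
        unfolding act addl(4) by (simp add: lin_ext_pm.diff L.reg.add_eq ind_act_pair distrib_left del: lin_ext_pm_single)
    next
      case (addr a b b')
      then obtain p where "a = env_class UNIV p" using carrier by blast
      then show ?thesis using irel_bilinear[OF bilinear_relatorsI(2)[OF env_class_carrier[of "word [x] * p"] addr(2,3)]]
        unfolding act addr(4) by (simp add: lin_ext_pm.diff ind_act_pair del: lin_ext_pm_single)
    next
      case (scl c a b)
      then obtain p where "a = env_class UNIV p" using carrier by blast
      then show ?thesis using irel_scl[OF scl(2), of c "word [x] * p"]
        unfolding act scl(3)
        by (simp add: lin_ext_pm.diff lin_ext_pm.scale L.reg.smult_eq ind_act_pair pm_scale_mult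
            del: lin_ext_pm_single pm_scale_single)
    next
      case (scr c a b)
      then obtain p where "a = env_class UNIV p" using carrier by blast
      then show ?thesis using irel_bilinear[OF bilinear_relatorsI(4)[OF env_class_carrier[of "word [x] * p"] scr(2)]]
        unfolding act scr(3)
        by (simp add: lin_ext_pm.diff lin_ext_pm.scale ind_act_pair del: lin_ext_pm_single pm_scale_single)
    qed
  next
    case 2
    then obtain p q n where q: "q \<in> P.Fg" and n: "n \<in> P.Fg"
      and r: "r = pair (env_class UNIV (p * q)) (N_class n) - pair (env_class UNIV p) (N_class (q * n))"
      by (rule balE)
    show ?thesis using irel_balanced[OF q n, of "word [x] * p"]
      unfolding act r by (simp add: lin_ext_pm.diff ind_act_pair mult.assoc del: lin_ext_pm_single)
  qed
qed

definition Ind_class :: "(env_elt \<times> env_elt set \<Rightarrow>\<^sub>0 complex) \<Rightarrow> (env_elt \<times> env_elt set \<Rightarrow>\<^sub>0 complex) set"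
  where "Ind_class p = irel +>\<^bsub>FI\<^esub> p"

lemma presentation_induced:
  "presentation (induced N) PairsI UNIV (\<lambda>x. x) (\<lambda>x. lin_ext pm_scale (ind_act x)) Ind_class"
  unfolding induced_eq Ind_class_def[abs_def] by (rule FI.presentation_quot[OF irel_subspace irel_stable])

sublocale Ind: presentation "induced N" PairsI UNIV "\<lambda>x. x" "\<lambda>x. lin_ext pm_scale (ind_act x)" Ind_class
  by (rule presentation_induced)

section \<open>Annihilation in high degrees\<close>

text \<open>The annihilator in the free algebra of the cyclic Whittaker vector.\<close>

definition cyclic_ann :: "(lie list \<Rightarrow>\<^sub>0 complex) set"
  where "cyclic_ann = {q. pair (env_class UNIV q) (N_class 1) \<in> irel}"

lemma one_N: "N_class 1 \<in> carrier N" unfolding N.carrier_eq by (rule imageI[OF one_P])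

lemma cyclic_ann_add:
  assumes "p \<in> cyclic_ann" "q \<in> cyclic_ann"
  shows "p + q \<in> cyclic_ann"
proof -
  have p: "pair (env_class UNIV p) (N_class 1) \<in> irel" and q: "pair (env_class UNIV q) (N_class 1) \<in> irel"
    using assms by (simp_all add: cyclic_ann_def)
  from irel_add[OF irel_add[OF irel_addl[OF one_N, of p q] p] q] show ?thesis by (simp add: cyclic_ann_def)
qed

lemma cyclic_ann_scale:
  assumes "p \<in> cyclic_ann"
  shows "pm_scale c p \<in> cyclic_ann"
proof -
  have p: "pair (env_class UNIV p) (N_class 1) \<in> irel" using assms by (simp add: cyclic_ann_def)
  from irel_add[OF irel_scl[OF one_N, of c p] irel_scale[OF p, of c]] show ?thesis by (simp add: cyclic_ann_def)
qed

lemma cyclic_ann_mult: "p \<in> cyclic_ann \<Longrightarrow> word [x] * p \<in> cyclic_ann"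
  using irel_stable[of "pair (env_class UNIV p) (N_class 1)" x] by (simp add: cyclic_ann_def free_pairs_def ind_act_pair del: lin_ext_pm_single)

lemma cyclic_ann_env_ideal: "p \<in> env_ideal UNIV \<Longrightarrow> p \<in> cyclic_ann"
proof -
  assume "p \<in> env_ideal UNIV"
  then have "env_class UNIV p = env_class UNIV 0" using L.env_class_eq_iff[of p 0] by simp
  moreover have "pair (env_class UNIV 0) (N_class 1) \<in> irel" using irel_scl[OF one_N, of 0 0] by simp
  ultimately show ?thesis by (simp add: cyclic_ann_def)
qed

lemma cyclic_ann_high:
  assumes "x \<in> deg_ge 5"
  shows "word [x] \<in> cyclic_ann"
proof -
  have x: "word [x] \<in> P.Fg" using N_class_high(1)[OF assms] by auto
  have "pair (env_class UNIV 1) (N_class (word [x])) \<in> irel"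
    using irel_bilinear[OF bilinear_relatorsI(4)[OF env_class_carrier[of 1] one_N, of 0]] N.smult_eq[OF one_P, of 0]
      N_class_high(2)[OF assms] N.zero_eq by simp
  from irel_add[OF irel_balanced[OF x one_P, of 1], simplified, OF this] show ?thesis by (simp add: cyclic_ann_def)
qed

text \<open>Elements of high degree kill the cyclic vector. When such an element is commuted past
  a letter of the word, the bracket still has high degree, because the letter lowers the degree by
  a bounded amount only.\<close>

lemma cyclic_ann_eventually: "\<exists>m>0. \<forall>x\<in>deg_ge m. word [x] * q \<in> cyclic_ann"
proof (induction q rule: poly_mapping_add_induct)
  case zero
  then show ?case using cyclic_ann_env_ideal[OF L.env_ideal_zero] by (intro exI[of _ 1]) simp
next
  case (add p q)
  then obtain m n where "m > 0" "\<forall>x\<in>deg_ge m. word [x] * p \<in> cyclic_ann" "n > 0" "\<forall>x\<in>deg_ge n. word [x] * q \<in> cyclic_ann"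
    by blast
  then show ?case using deg_ge_mono[of m "max m n"] deg_ge_mono[of n "max m n"]
    by (intro exI[of _ "max m n"]) (auto simp: distrib_left intro!: cyclic_ann_add)
next
  case (single w c)
  have "\<exists>m>0. \<forall>x\<in>deg_ge m. word [x] * word w \<in> cyclic_ann"
  proof (induction w)
    case Nil
    show ?case using cyclic_ann_high by (intro exI[of _ 5]) (simp add: word_Nil)
  next
    case (Cons y w)
    then obtain m where m: "m > 0" "\<forall>x\<in>deg_ge m. word [x] * word w \<in> cyclic_ann" by blast
    obtain k where k: "k \<ge> 0" "y \<in> deg_ge (- k)" using deg_ge_exhausts by blast
    have "word [x] * word (y # w) \<in> cyclic_ann" if x: "x \<in> deg_ge (m + k)" for x
    proof -
      have "word [x, y] - word [y, x] - word [lie_bracket x y] \<in> env_relators UNIV"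
        unfolding env_relators_def by blast
      then have "word [x, y] - word [y, x] - word [lie_bracket x y] \<in> env_ideal UNIV"
        using L.relators_env_ideal by blast
      from L.env_ideal_mult(2)[OF this, of "word w"]
      have 1: "(word [x, y] - word [y, x] - word [lie_bracket x y]) * word w \<in> cyclic_ann"
        by (intro cyclic_ann_env_ideal) simp
      have "x \<in> deg_ge m" using x deg_ge_mono[of m "m + k"] k(1) by auto
      then have 2: "word [y] * (word [x] * word w) \<in> cyclic_ann" by (rule cyclic_ann_mult[OF bspec[OF m(2)]])
      have "lie_bracket x y \<in> deg_ge m" using deg_ge_bracket[OF x k(2)] by simp
      then have 3: "word [lie_bracket x y] * word w \<in> cyclic_ann" using m(2) by auto
      from cyclic_ann_add[OF cyclic_ann_add[OF 1 2] 3] show ?thesis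
        by (simp add: left_diff_distrib word_mult)
    qed
    then show ?case using m(1) k(1) by (intro exI[of _ "m + k"]) auto
  qed
  then obtain m where m: "m > 0" "\<forall>x\<in>deg_ge m. word [x] * word w \<in> cyclic_ann" by blast
  then have "\<forall>x\<in>deg_ge m. word [x] * pm_scale c (word w) \<in> cyclic_ann"
    using cyclic_ann_scale by (simp add: pm_scale_mult del: pm_scale_single)
  then show ?case using m(1) by (intro exI[of _ m]) simp
qed

text \<open>The cyclic vector generates: a pair whose second component is the class of
  \<open>n\<close> is congruent, by balancing, to a pair whose first component has been multiplied
  by \<open>n\<close> from the right.\<close>

lemma pairs_eventually:
  assumes "p \<in> PairsI"
  shows "\<exists>m>0. \<forall>x\<in>deg_ge m. lin_ext pm_scale (ind_act x) p \<in> irel"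
proof (induction p rule: poly_mapping_add_induct)
  case zero
  then show ?case using FI.K_zero[OF irel_subspace] by (intro exI[of _ 1]) (simp add: lin_ext_pm.zero)
next
  case (add p q)
  then obtain m n where "m > 0" "\<forall>x\<in>deg_ge m. lin_ext pm_scale (ind_act x) p \<in> irel"
    "n > 0" "\<forall>x\<in>deg_ge n. lin_ext pm_scale (ind_act x) q \<in> irel" by blast
  then show ?case using deg_ge_mono[of m "max m n"] deg_ge_mono[of n "max m n"]
    by (intro exI[of _ "max m n"]) (auto simp: lin_ext_pm.add intro!: irel_add)
next
  case (single a c)
  obtain b v where a: "a = (b, v)" by (cases a)
  with single assms have b: "b \<in> carrier (env_regular UNIV)" and v: "v \<in> carrier N" by auto
  obtain q where q: "b = env_class UNIV q" using b by (auto simp: L.reg.carrier_eq)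
  obtain n where n: "n \<in> P.Fg" "v = N_class n" using v by (auto simp: N.carrier_eq)
  obtain m where m: "m > 0" "\<forall>x\<in>deg_ge m. word [x] * (q * n) \<in> cyclic_ann" using cyclic_ann_eventually by blast
  have "lin_ext pm_scale (ind_act x) (Poly_Mapping.single a c) \<in> irel" if "x \<in> deg_ge m" for x
  proof -
    have 1: "pair (env_class UNIV (word [x] * (q * n))) (N_class 1) \<in> irel" using m(2) that by (simp add: cyclic_ann_def)
    have 2: "pair (env_class UNIV (word [x] * q * n)) (N_class 1) - pair (env_class UNIV (word [x] * q)) (N_class n) \<in> irel"
      using irel_balanced[OF n(1) one_P, of "word [x] * q"] by simp
    have "pair (env_class UNIV (word [x] * q)) (N_class n) \<in> irel"
      using irel_add[OF 1 irel_scale[OF 2, of "-1"]]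
      by (simp add: mult.assoc pm.scale_right_diff_distrib del: pm_scale_single)
    then have "pm_scale c (lin_ext pm_scale (ind_act x) (pair (env_class UNIV q) (N_class n))) \<in> irel"
      unfolding ind_act_pair by (rule irel_scale)
    then show ?thesis by (simp add: a q n(2))
  qed
  then show ?case using m(1) by blast
qed

text \<open>The zero vector is written as a multiple of \<open>w\<close>, a form that isomorphisms
  respect by definition.\<close>

lemma whittaker_quotient_eventually_zero:
  assumes K: "lie_submodule K (induced N)" and w: "w \<in> carrier (quot_mod (induced N) K)"
  shows "\<exists>m>0. \<forall>x\<in>deg_ge m. act (quot_mod (induced N) K) x w = 0 \<odot>\<^bsub>quot_mod (induced N) K\<^esub> w"
proof -
  have sub: "Ind.subspace K" using K by (simp add: lie_submodule_def Ind.submodule_iff)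
  interpret Q: presentation "quot_mod (induced N) K" PairsI UNIV "\<lambda>x. x"
    "\<lambda>x. lin_ext pm_scale (ind_act x)" "\<lambda>p. K +>\<^bsub>induced N\<^esub> Ind_class p"
    by (rule Ind.presentation_quot[OF sub]) (use K in \<open>auto simp: lie_submodule_def\<close>)
  obtain p where p: "p \<in> PairsI" "w = K +>\<^bsub>induced N\<^esub> Ind_class p" using w by (auto simp: Q.carrier_eq)
  obtain m where m: "m > 0" "\<forall>x\<in>deg_ge m. lin_ext pm_scale (ind_act x) p \<in> irel"
    using pairs_eventually[OF p(1)] by blast
  have "act (quot_mod (induced N) K) x w = 0 \<odot>\<^bsub>quot_mod (induced N) K\<^esub> w" if "x \<in> deg_ge m" for x
  proof -
    have "Ind_class (lin_ext pm_scale (ind_act x) p) = Ind_class 0"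
      using FI.coset_eq_iff[OF irel_subspace FI.S_act[OF UNIV_I p(1)] FI.S_zero] m(2) that
      by (simp add: Ind_class_def)
    then show ?thesis using Q.act_eq[OF UNIV_I p(1), of x] Q.smult_eq[OF p(1), of 0] by (simp add: p(2))
  qed
  then show ?thesis using m(1) by blast
qed

end

section \<open>Comparison of the modules\<close>

lemma (in presentation) abelian_monoid: "abelian_monoid N"
  by (rule abelian_monoidI) (auto simp: carrier_eq zero_eq add_eq S_zero S_add ac_simps)

lemma additive_finsum:
  assumes "abelian_monoid G" and \<phi>_zero: "\<phi> \<zero>\<^bsub>G\<^esub> = (0 :: 'c::comm_monoid_add)"
    and \<phi>_add: "\<And>u v. u \<in> carrier G \<Longrightarrow> v \<in> carrier G \<Longrightarrow> \<phi> (u \<oplus>\<^bsub>G\<^esub> v) = \<phi> u + \<phi> v"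
    and "finite I" "w \<in> I \<rightarrow> carrier G"
  shows "\<phi> (finsum G w I) = (\<Sum>i\<in>I. \<phi> (w i))"
  using assms(4,5)
proof (induction I)
  interpret abelian_monoid G by fact
  case empty
  then show ?case by (simp add: \<phi>_zero)
next
  interpret abelian_monoid G by fact
  case (insert i I)
  then show ?case by (simp add: \<phi>_add)
qed

lemma lie_isomorphic_trans:
  assumes "lie_isomorphic L M" "lie_isomorphic M N"
  shows "lie_isomorphic L N"
proof -
  obtain \<phi> where \<phi>: "bij_betw \<phi> (carrier L) (carrier M)"
    "\<forall>u\<in>carrier L. \<forall>v\<in>carrier L. \<phi> (u \<oplus>\<^bsub>L\<^esub> v) = \<phi> u \<oplus>\<^bsub>M\<^esub> \<phi> v"
    "\<forall>c. \<forall>v\<in>carrier L. \<phi> (c \<odot>\<^bsub>L\<^esub> v) = c \<odot>\<^bsub>M\<^esub> \<phi> v"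
    "\<forall>x. \<forall>v\<in>carrier L. \<phi> (act L x v) = act M x (\<phi> v)"
    using assms(1) unfolding lie_isomorphic_def by blast
  obtain \<psi> where \<psi>: "bij_betw \<psi> (carrier M) (carrier N)"
    "\<forall>u\<in>carrier M. \<forall>v\<in>carrier M. \<psi> (u \<oplus>\<^bsub>M\<^esub> v) = \<psi> u \<oplus>\<^bsub>N\<^esub> \<psi> v"
    "\<forall>c. \<forall>v\<in>carrier M. \<psi> (c \<odot>\<^bsub>M\<^esub> v) = c \<odot>\<^bsub>N\<^esub> \<psi> v"
    "\<forall>x. \<forall>v\<in>carrier M. \<psi> (act M x v) = act N x (\<psi> v)"
    using assms(2) unfolding lie_isomorphic_def by blast
  have "\<phi> v \<in> carrier M" if "v \<in> carrier L" for v using \<phi>(1) that by (rule bij_betwE[THEN bspec])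
  then show ?thesis
    unfolding lie_isomorphic_def
    by (intro exI[of _ "\<psi> \<circ> \<phi>"]) (use \<phi> \<psi> in \<open>auto intro: bij_betw_trans\<close>)
qed

text \<open>The map that contracts the second factor with \<open>\<psi>\<close>, and its values on
  the tensor \<open>t0\<close> of 1 with the highest weight vector. Everything that distinguishes
  the tensor product from the other modules is read off from this map. The zero vector is also
  given as a multiple of \<open>t0\<close>, because isomorphisms are only known to respect sums,
  multiples and actions.\<close>

lemma (in weight) tensor_irr_functional:
  assumes M: "polynomial_type M lam \<gamma>"
  obtains t0 \<Phi> where "t0 \<in> carrier (tensor_mod M (irr_hw \<eta> \<epsilon> \<theta>))" "\<Phi> t0 = 1"
    "\<And>p q. p \<in> carrier (tensor_mod M (irr_hw \<eta> \<epsilon> \<theta>)) \<Longrightarrow> q \<in> carrier (tensor_mod M (irr_hw \<eta> \<epsilon> \<theta>)) \<Longrightarrow>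
      \<Phi> (p \<oplus>\<^bsub>tensor_mod M (irr_hw \<eta> \<epsilon> \<theta>)\<^esub> q) = \<Phi> p + \<Phi> q"
    "\<And>c p. p \<in> carrier (tensor_mod M (irr_hw \<eta> \<epsilon> \<theta>)) \<Longrightarrow>
      \<Phi> (c \<odot>\<^bsub>tensor_mod M (irr_hw \<eta> \<epsilon> \<theta>)\<^esub> p) = poly_const c * \<Phi> p"
    "\<And>a p. degree a \<le> 0 \<Longrightarrow> p \<in> carrier (tensor_mod M (irr_hw \<eta> \<epsilon> \<theta>)) \<Longrightarrow>
      \<Phi> (act (tensor_mod M (irr_hw \<eta> \<epsilon> \<theta>)) (basis a) p) = act M (basis a) (\<Phi> p) + poly_const (\<chi> a) * \<Phi> p"
    "\<And>a. degree a \<ge> 0 \<Longrightarrow>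
      \<Phi> (act (tensor_mod M (irr_hw \<eta> \<epsilon> \<theta>)) (basis a) t0) = act M (basis a) 1 + poly_const (\<chi> a)"
    "linear_actions (tensor_mod M (irr_hw \<eta> \<epsilon> \<theta>))" "abelian_monoid (tensor_mod M (irr_hw \<eta> \<epsilon> \<theta>))"
    "0 \<odot>\<^bsub>tensor_mod M (irr_hw \<eta> \<epsilon> \<theta>)\<^esub> t0 = \<zero>\<^bsub>tensor_mod M (irr_hw \<eta> \<epsilon> \<theta>)\<^esub>"
proof -
  let ?V = "irr_hw \<eta> \<epsilon> \<theta>"
  interpret tensor M ?V
    by unfold_locales (rule polynomial_type_simps(9)[OF M] presentation_linear_actions[OF presentation_irr])+
  note M_simps = polynomial_type_simps[OF M]
  obtain v \<psi> where v: "v \<in> carrier ?V" "\<psi> v = 1"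
    and add: "\<And>x y. x \<in> carrier ?V \<Longrightarrow> y \<in> carrier ?V \<Longrightarrow> \<psi> (x \<oplus>\<^bsub>?V\<^esub> y) = \<psi> x + \<psi> y"
    and smult: "\<And>c x. x \<in> carrier ?V \<Longrightarrow> \<psi> (c \<odot>\<^bsub>?V\<^esub> x) = c * \<psi> x"
    and low: "\<And>a x. degree a \<le> 0 \<Longrightarrow> x \<in> carrier ?V \<Longrightarrow> \<psi> (act ?V (basis a) x) = \<chi> a * \<psi> x"
    and high: "\<And>a. degree a \<ge> 0 \<Longrightarrow> \<psi> (act ?V (basis a) v) = \<chi> a"
    by (rule irr_functional) blast
  obtain \<Phi> where \<Phi>: "\<And>u v. u \<in> carrier M \<Longrightarrow> v \<in> carrier ?V \<Longrightarrow> \<Phi> (tensor_class (pair u v)) = scale_poly (\<psi> v) u"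
    "\<And>p q. p \<in> carrier (tensor_mod M ?V) \<Longrightarrow> q \<in> carrier (tensor_mod M ?V) \<Longrightarrow>
      \<Phi> (p \<oplus>\<^bsub>tensor_mod M ?V\<^esub> q) = \<Phi> p + \<Phi> q"
    "\<And>c p. p \<in> carrier (tensor_mod M ?V) \<Longrightarrow> \<Phi> (c \<odot>\<^bsub>tensor_mod M ?V\<^esub> p) = scale_poly c (\<Phi> p)"
    "\<And>x u v. u \<in> carrier M \<Longrightarrow> v \<in> carrier ?V \<Longrightarrow>
      \<Phi> (act (tensor_mod M ?V) x (tensor_class (pair u v))) = scale_poly (\<psi> v) (act M x u) + scale_poly (\<psi> (act ?V x v)) u"
    "\<And>x k g p. p \<in> carrier (tensor_mod M ?V) \<Longrightarrow> linear_map scale_poly scale_poly g \<Longrightarrow>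
      (\<And>u. u \<in> carrier M \<Longrightarrow> act M x u = g u) \<Longrightarrow>
      (\<And>v. v \<in> carrier ?V \<Longrightarrow> \<psi> (act ?V x v) = k * \<psi> v) \<Longrightarrow>
      \<Phi> (act (tensor_mod M ?V) x p) = g (\<Phi> p) + scale_poly k (\<Phi> p)"
    by (rule tensor_functional[OF module_scale_poly, where f = "\<lambda>u. u" and \<psi> = \<psi>])
      (use M_simps add smult in \<open>auto simp only:\<close>)
  have "poly_const 1 = 1" by (simp add: one_pCons)
  then have one: "scale_poly 1 g = g" for g by (simp only: mult_1)
  have pair: "pair 1 v \<in> Pairs" using v(1) M_simps(1) by simp
  have t0: "tensor_class (pair 1 v) \<in> carrier (tensor_mod M ?V)" unfolding T.carrier_eq using pair by (rule imageI)
  show ?thesis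
  proof (rule that[of "tensor_class (pair 1 v)" \<Phi>])
    show "\<Phi> (tensor_class (pair 1 v)) = 1" using \<Phi>(1)[of 1 v] v M_simps(1) by (simp add: one_pCons)
    show "\<Phi> (act (tensor_mod M ?V) (basis a) p) = act M (basis a) (\<Phi> p) + poly_const (\<chi> a) * \<Phi> p"
      if "degree a \<le> 0" "p \<in> carrier (tensor_mod M ?V)" for a p
      using \<Phi>(5)[OF that(2) M_simps(8) refl low[OF that(1)]] by simp
    show "\<Phi> (act (tensor_mod M ?V) (basis a) (tensor_class (pair 1 v))) = act M (basis a) 1 + poly_const (\<chi> a)"
      if "degree a \<ge> 0" for a
      using \<Phi>(4)[of 1 v "basis a"] v M_simps(1) high[OF that] one by simp
    show "0 \<odot>\<^bsub>tensor_mod M ?V\<^esub> tensor_class (pair 1 v) = \<zero>\<^bsub>tensor_mod M ?V\<^esub>"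
      using T.smult_eq[OF pair, of 0] by (simp add: T.zero_eq)
  qed (rule t0 \<Phi> presentation_linear_actions[OF presentation_tensor] T.abelian_monoid; assumption)+
qed

theorem proposition5p2:
  fixes lam \<alpha> \<beta> \<gamma> \<eta> \<epsilon> \<theta> :: complex
    and M :: "(lie, poly_st) act_module"
  assumes "lam \<noteq> 0" and "\<alpha> \<noteq> 0"
    and "\<not> (\<eta> = 0 \<and> \<epsilon> = 0 \<and> \<theta> = 0)"
    and "M \<in> {Omega_mod lam \<alpha> \<beta> \<gamma>, Delta_mod lam \<alpha> \<beta> \<gamma>, Theta_mod lam \<alpha> \<beta> \<gamma>}"
  shows "\<not> weight_module (tensor_mod M (irr_hw \<eta> \<epsilon> \<theta>)) \<and>
    (\<forall>W :: (lie, 'w) act_module. whittaker_module W \<longrightarrow>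
       \<not> lie_isomorphic (tensor_mod M (irr_hw \<eta> \<epsilon> \<theta>)) W) \<and>
    (\<forall>lam' \<alpha>' \<beta>' \<gamma>'. lam' \<noteq> 0 \<and> \<alpha>' \<noteq> 0 \<longrightarrow>
       \<not> lie_isomorphic (tensor_mod M (irr_hw \<eta> \<epsilon> \<theta>)) (Omega_mod lam' \<alpha>' \<beta>' \<gamma>') \<and>
       \<not> lie_isomorphic (tensor_mod M (irr_hw \<eta> \<epsilon> \<theta>)) (Delta_mod lam' \<alpha>' \<beta>' \<gamma>') \<and>
       \<not> lie_isomorphic (tensor_mod M (irr_hw \<eta> \<epsilon> \<theta>)) (Theta_mod lam' \<alpha>' \<beta>' \<gamma>'))"
proof -
  interpret weight \<eta> \<epsilon> \<theta> .
  let ?T = "tensor_mod M (irr_hw \<eta> \<epsilon> \<theta>)"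
  have M: "polynomial_type M lam \<gamma>" using assms(4) by (rule polynomial_type_families)
  note M_simps = polynomial_type_simps[OF M]
  obtain t0 \<Phi> where t0: "t0 \<in> carrier ?T" "\<Phi> t0 = 1"
    and add: "\<And>p q. p \<in> carrier ?T \<Longrightarrow> q \<in> carrier ?T \<Longrightarrow> \<Phi> (p \<oplus>\<^bsub>?T\<^esub> q) = \<Phi> p + \<Phi> q"
    and smult: "\<And>c p. p \<in> carrier ?T \<Longrightarrow> \<Phi> (c \<odot>\<^bsub>?T\<^esub> p) = poly_const c * \<Phi> p"
    and low: "\<And>a p. degree a \<le> 0 \<Longrightarrow> p \<in> carrier ?T \<Longrightarrow>
      \<Phi> (act ?T (basis a) p) = act M (basis a) (\<Phi> p) + poly_const (\<chi> a) * \<Phi> p"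
    and high: "\<And>a. degree a \<ge> 0 \<Longrightarrow> \<Phi> (act ?T (basis a) t0) = act M (basis a) 1 + poly_const (\<chi> a)"
    and T: "linear_actions ?T" "abelian_monoid ?T" "0 \<odot>\<^bsub>?T\<^esub> t0 = \<zero>\<^bsub>?T\<^esub>"
    by (rule tensor_irr_functional[OF M]) blast
  have one: "poly_const 1 = 1" by (simp add: one_pCons)
  have H0: "act M (basis (H 0)) g = poly_t * g" and D0: "act M (basis (D 0)) g = poly_s * g" for g
    unfolding M_simps(5,6) by (simp_all only: power_int_0_right of_int_0 mult_zero_left pCons_0_0 add_0_right
        one mult_1 shift_zero)
  have act: "act ?T x w \<in> carrier ?T" and plus: "u \<oplus>\<^bsub>?T\<^esub> w \<in> carrier ?T" and sc: "c \<odot>\<^bsub>?T\<^esub> w \<in> carrier ?T"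
    if "u \<in> carrier ?T" "w \<in> carrier ?T" for x c u w
    using T(1) that unfolding linear_actions_def by blast+
  have \<Phi>_zero: "\<Phi> \<zero>\<^bsub>?T\<^esub> = 0" using smult[OF t0(1), of 0] T(3) by simp
  have "\<not> weight_module ?T"
  proof
    assume "weight_module ?T"
    then have "\<exists>!w. (\<forall>\<chi>. w \<chi> \<in> weight_space ?T \<chi>) \<and> finite {\<chi>. w \<chi> \<noteq> \<zero>\<^bsub>?T\<^esub>} \<and>
        t0 = finsum ?T w {\<chi>. w \<chi> \<noteq> \<zero>\<^bsub>?T\<^esub>}"
      using t0(1) unfolding weight_module_def by (rule bspec)
    then obtain w where w: "\<forall>\<chi>. w \<chi> \<in> weight_space ?T \<chi>" and fin: "finite {\<chi>. w \<chi> \<noteq> \<zero>\<^bsub>?T\<^esub>}"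
      and sum: "t0 = finsum ?T w {\<chi>. w \<chi> \<noteq> \<zero>\<^bsub>?T\<^esub>}"
      by (elim ex1E conjE)
    \<comment> \<open>On the polynomial side \<open>h\<^sub>0\<close> has no eigenvectors.\<close>
    have "w \<chi> \<in> carrier ?T \<and> \<Phi> (w \<chi>) = 0" for \<chi>
    proof (cases \<chi>)
      case (fields a b c)
      then have wc: "w \<chi> \<in> carrier ?T" and eig: "act ?T (basis (H 0)) (w \<chi>) = b \<odot>\<^bsub>?T\<^esub> w \<chi>"
        using w by (auto simp: weight_space_def)
      have "act M (basis (H 0)) (\<Phi> (w \<chi>)) + poly_const \<epsilon> * \<Phi> (w \<chi>) = poly_const b * \<Phi> (w \<chi>)"
        using low[of "H 0", OF _ wc] smult[OF wc, of b] eig by simp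
      then have "poly_t * \<Phi> (w \<chi>) + poly_const \<epsilon> * \<Phi> (w \<chi>) - poly_const b * \<Phi> (w \<chi>) = 0"
        unfolding H0 by (simp only: right_minus_eq)
      moreover have "poly_const (\<epsilon> - b) = poly_const \<epsilon> - poly_const b" by simp
      ultimately have "(poly_t + poly_const (\<epsilon> - b)) * \<Phi> (w \<chi>) = 0"
        by (simp only: distrib_right left_diff_distrib add_diff_eq)
      moreover have "poly_t + poly_const (\<epsilon> - b) \<noteq> 0" by (simp add: poly_t_def)
      ultimately show ?thesis using wc by simp
    qed
    then have "\<Phi> t0 = 0"
      unfolding sum by (subst additive_finsum[OF T(2) \<Phi>_zero add fin]) auto
    then show False using t0(2) by simp
  qed
  moreover have "\<not> lie_isomorphic ?T W" if W: "whittaker_module W" for W :: "(lie, 'w) act_module"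
  proof
    assume "lie_isomorphic ?T W"
    obtain \<mu>1 \<mu>2 \<mu>3 \<mu>4 \<mu>5 K where K: "lie_submodule K (induced (whittaker_N \<mu>1 \<mu>2 \<mu>3 \<mu>4 \<mu>5))"
      and "lie_isomorphic W (quot_mod (induced (whittaker_N \<mu>1 \<mu>2 \<mu>3 \<mu>4 \<mu>5)) K)" (is "lie_isomorphic W ?Q")
      using W unfolding whittaker_module_def by blast
    with \<open>lie_isomorphic ?T W\<close> have "lie_isomorphic ?T ?Q" by (blast intro: lie_isomorphic_trans)
    then obtain \<phi> where \<phi>: "bij_betw \<phi> (carrier ?T) (carrier ?Q)"
      "\<forall>c. \<forall>v\<in>carrier ?T. \<phi> (c \<odot>\<^bsub>?T\<^esub> v) = c \<odot>\<^bsub>?Q\<^esub> \<phi> v"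
      "\<forall>x. \<forall>v\<in>carrier ?T. \<phi> (act ?T x v) = act ?Q x (\<phi> v)"
      unfolding lie_isomorphic_def by blast
    have "\<phi> t0 \<in> carrier ?Q" using \<phi>(1) t0(1) by (rule bij_betwE[THEN bspec])
    from whittaker.whittaker_quotient_eventually_zero[OF K this]
    obtain m where m: "m > 0" "\<forall>x\<in>deg_ge m. act ?Q x (\<phi> t0) = 0 \<odot>\<^bsub>?Q\<^esub> \<phi> t0" by blast
    \<comment> \<open>This generator kills the image of \<open>t0\<close>, but \<open>\<Phi>\<close> maps its value at \<open>t0\<close> to a nonzero multiple of \<open>poly_t\<close>.\<close>
    have "basis (H m) \<in> deg_ge m" using m(1) by (simp add: deg_ge_def)
    with m(2) \<phi>(2,3) t0(1) have "\<phi> (act ?T (basis (H m)) t0) = \<phi> (0 \<odot>\<^bsub>?T\<^esub> t0)" by simp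
    then have "act ?T (basis (H m)) t0 = 0 \<odot>\<^bsub>?T\<^esub> t0"
      using bij_betw_imp_inj_on[OF \<phi>(1)] act[OF t0(1) t0(1)] sc[OF t0(1) t0(1)] by (simp add: inj_on_eq_iff)
    then have "act M (basis (H m)) 1 + poly_const (\<chi> (H m)) = 0"
      using high[of "H m"] m(1) \<Phi>_zero T(3) by simp
    then have "poly_const (lam powi m) * poly_t = 0" using m(1) M_simps(5)[of m 1] by (simp add: shift_one)
    then show False using assms(1) by (simp add: poly_t_def)
  qed
  moreover have "\<not> lie_isomorphic ?T M'" if M': "polynomial_type M' lam' \<gamma>'" and "lam' \<noteq> 0" for M' lam' \<gamma>'
  proof
    assume "lie_isomorphic ?T M'"
    then obtain \<phi> where \<phi>: "bij_betw \<phi> (carrier ?T) (carrier M')"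
      "\<forall>u\<in>carrier ?T. \<forall>v\<in>carrier ?T. \<phi> (u \<oplus>\<^bsub>?T\<^esub> v) = \<phi> u \<oplus>\<^bsub>M'\<^esub> \<phi> v"
      "\<forall>x. \<forall>v\<in>carrier ?T. \<phi> (act ?T x v) = act M' x (\<phi> v)"
      unfolding lie_isomorphic_def by blast
    note inj = inj_onD[OF bij_betw_imp_inj_on[OF \<phi>(1)]]
    note M'_simps = polynomial_type_simps[OF M']
    \<comment> \<open>The central element acts as zero on polynomial modules and as \<open>\<theta>\<close> on the tensor product.\<close>
    define c0 where "c0 = act ?T (basis C) t0"
    have c0: "c0 \<in> carrier ?T" unfolding c0_def by (rule act[OF t0(1) t0(1)])
    have "\<phi> (c0 \<oplus>\<^bsub>?T\<^esub> c0) = \<phi> c0"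
      using \<phi>(2) c0 by (simp add: c0_def \<phi>(3) t0 M'_simps)
    then have "c0 \<oplus>\<^bsub>?T\<^esub> c0 = c0" by (rule inj) (use c0 plus in auto)
    then have "\<Phi> c0 = 0" using add[OF c0 c0] by simp
    then have \<theta>: "\<theta> = 0" using high[of C] M_simps(7)[of 1] by (simp add: c0_def)
    \<comment> \<open>Affine dependence on the index \<open>i\<close> is preserved by isomorphisms; the indices 0, 1, 2 suffice to test it.\<close>
    define A where "A i = act ?T (basis (D (- i))) (act ?T (basis (H i)) t0)" for i
    have HT: "act ?T (basis (H i)) t0 \<in> carrier ?T" for i by (rule act[OF t0(1) t0(1)])
    have A: "A i \<in> carrier ?T" for i unfolding A_def by (rule act[OF t0(1) HT])
    have \<phi>A: "\<phi> (A i) = (poly_s - poly_const (of_int i * \<gamma>')) * (poly_t * \<phi> t0)" for i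
      using polynomial_type_DH[OF M' \<open>lam' \<noteq> 0\<close>, of i "\<phi> t0"] by (simp add: A_def \<phi>(3) HT t0)
    have scalars: "poly_const (of_int 2 * c) = poly_const (of_int 1 * c) + poly_const (of_int 1 * c)"
      "poly_const (of_int 0 * c) = 0" for c by simp_all
    have "(r - (a + a)) * g + (r - 0) * g = (r - a) * g + (r - a) * g" for r a g :: poly_st
      by (simp add: algebra_simps)
    then have "\<phi> (A 2) + \<phi> (A 0) = \<phi> (A 1) + \<phi> (A 1)" unfolding \<phi>A scalars .
    then have "\<phi> (A 2 \<oplus>\<^bsub>?T\<^esub> A 0) = \<phi> (A 1 \<oplus>\<^bsub>?T\<^esub> A 1)" using \<phi>(2) A by (simp add: M'_simps(3))
    then have "A 2 \<oplus>\<^bsub>?T\<^esub> A 0 = A 1 \<oplus>\<^bsub>?T\<^esub> A 1" by (rule inj) (use A plus in auto)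
    then have rel: "\<Phi> (A 2) + \<Phi> (A 0) = \<Phi> (A 1) + \<Phi> (A 1)" using add[OF A A] by metis
    have pos: "\<Phi> (A i) = (poly_s - poly_const (of_int i * \<gamma>)) * poly_t" if "i > 0" for i
      using that low[of "D (- i)", OF _ HT[of i]] high[of "H i"] polynomial_type_DH[OF M assms(1), of i 1]
      by (simp add: A_def)
    \<comment> \<open>The index 0 alone sees the highest weight of the second factor.\<close>
    have zero: "\<Phi> (A 0) = (poly_s + poly_const \<eta>) * (poly_t + poly_const \<epsilon>)"
    proof -
      have "\<Phi> (A 0) = poly_s * (poly_t * 1 + poly_const \<epsilon>) + poly_const \<eta> * (poly_t * 1 + poly_const \<epsilon>)"
        using low[of "D 0", OF _ HT[of 0]] high[of "H 0"] unfolding A_def H0 D0 by simp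
      then show ?thesis by (simp only: distrib_right mult_1_right)
    qed
    have comb: "(r - (a + a)) * g + (r + b) * (g + c) = (r - a) * g + (r - a) * g \<Longrightarrow> c * r + b * g + b * c = 0"
      for r a g b c :: poly_st
      by (simp add: algebra_simps)
    have "poly_const \<epsilon> * poly_s + poly_const \<eta> * poly_t + poly_const \<eta> * poly_const \<epsilon> = 0"
      by (rule comb[OF rel[unfolded zero pos[OF zero_less_numeral] pos[OF zero_less_one] scalars]])
    then have "\<epsilon> = 0 \<and> \<eta> = 0" by (simp add: poly_s_def poly_t_def)
    with \<theta> assms(3) show False by simp
  qed
  ultimately show ?thesis
    using polynomial_type_families by (metis insertCI)
qed

end
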